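(* The map $$\dot n=\prod_{i=0}^4x_{\gamma_i}(c_i)\longmapsto\dot m,\qquad \dot w_0^{-1}\dot n=\dot m\dot n'\overline{\dot n}\quad(\dot m\in M,\ \dot n'\in N,\ \overline{\dot n}\in\overline N),$$ induced by $\mathcal N$ on $Z_M^0U_M\backslash N'$ (identified with the set $R'$ of its representatives $\underline c=(c_0,\dots,c_4)$, with $c_5=1$) is an isomorphism onto its image in $M$, up to a Zariski open dense subset.
   Context: $F$ is a $p$-adic field. $G$ is the split simply connected group of type $E_6$ over $F$ with a fixed $F$-splitting $(B=AU,A,\{x_\alpha\})$, extended to a Chevalley system of root subgroups $x_\beta$ for all roots $\beta$. Simple roots $\alpha_1,\dots,\alpha_6$ are in Bourbaki's labelling (chain $\alpha_1,\alpha_3,\alpha_4,\alpha_5,\alpha_6$, with $\alpha_2$ attached to $\alpha_4$), and $(abcdef)$ denotes $a\alpha_1+\cdots+f\alpha_6$. $P=MN$ is the standard maximal parabolic subgroup obtained by deleting $\alpha_2$, $\overline N$ the opposite of $N$, $U_M=U\cap M$. Set $\gamma_0=(122321)$, $\gamma_1=(112321)$, $\gamma_2=(112221)$, $\gamma_3=(111211)$, $\gamma_4=(011210)$, $\gamma_5=(010000)$. $\dot w_0=\dot w_G\dot w_M^{-1}$, where $\dot w_G,\dot w_M$ are the products along reduced decompositions of the longest Weyl elements of $G,M$ of $\dot s_i=x_{\alpha_i}(1)x_{-\alpha_i}(-1)x_{\alpha_i}(1)$. $\mathcal N$ sends $n$ to the $M$-component of $\dot w_0^{-1}n\in MN\overline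 N$. $N'\subset N$ is the set of $U_M$-conjugates of the points $\prod_{i=0}^5x_{\gamma_i}(c_i)$ with $(c_0,\dots,c_5)$ in $$R=\{c_i\ne0,\ c_0-c_1c_5\ne0,\ c_0(c_0-c_1c_5)-c_2c_3c_4c_5\ne0,\ 2c_0^2(c_3c_4+c_2c_5)-2c_2c_3^2c_4^2c_5+c_0c_1c_5^2(c_4-c_2)\ne0\},$$ which is a set of representatives for $U_M\backslash N'$. $Z_M^0=\{\gamma_0^\vee(t)\}$ acts on $U_M\backslash N'$ by conjugation: $\gamma_0^\vee(t)$ sends $(c_0,c_1,\dots,c_5)$ to $(t^2c_0,tc_1,\dots,tc_5)$. Representatives of $Z_M^0U_M\backslash N'$ are obtained by setting $c_5=1$: $$R'=\{(c_0,\dots,c_4):c_i\ne0,\ c_0-c_1\ne0,\ c_0(c_0-c_1)-c_2c_3c_4\ne0,\ 2c_0^2(c_3c_4+c_2)-2c_2c_3^2c_4^2+c_0c_1(c_4-c_2)\ne0\}.$$ The phrase "up to a Zariski open dense subset" means after restricting to a Zariski open dense subset of $R'$. The representative written with $i=0,\dots,4$ stands for the point with $c_5=1$, i.e. $\prod_{i=0}^4x_{\gamma_i}(c_i)\cdot x_{\gamma_5}(1)$. *)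

theory Defs
  imports
    "Jordan_Normal_Form.Matrix"
    "HOL-Analysis.Abstract_Topology"
    "HOL-Algebra.Generated_Groups"
begin

section \<open>p-adic fields\<close>

text \<open>
  A p-adic field (for some prime p) is a field of characteristic 0, complete with respect to a
  discrete nonarchimedean absolute value, with finite residue field. Characteristic 0 is the
  type class.
\<close>

definition nonarch_abs :: "('a::field \<Rightarrow> real) \<Rightarrow> bool" where
  "nonarch_abs \<nu> \<longleftrightarrow>
     (\<forall>x. 0 \<le> \<nu> x) \<and> (\<forall>x. \<nu> x = 0 \<longleftrightarrow> x = 0) \<and>
     (\<forall>x y. \<nu> (x * y) = \<nu> x * \<nu> y) \<and> (\<forall>x y. \<nu> (x + y) \<le> max (\<nu> x) (\<nu> y))"

definition discrete_abs :: "('a::field \<Rightarrow> real) \<Rightarrow> bool" where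
  "discrete_abs \<nu> \<longleftrightarrow>
     (\<exists>\<pi>. 0 < \<nu> \<pi> \<and> \<nu> \<pi> < 1 \<and> (\<forall>x. x \<noteq> 0 \<longrightarrow> (\<exists>k::int. \<nu> x = \<nu> \<pi> powi k)))"

definition complete_abs :: "('a::field \<Rightarrow> real) \<Rightarrow> bool" where
  "complete_abs \<nu> \<longleftrightarrow>
     (\<forall>s :: nat \<Rightarrow> 'a. (\<forall>e>0. \<exists>k. \<forall>m\<ge>k. \<forall>n\<ge>k. \<nu> (s m - s n) < e) \<longrightarrow>
        (\<exists>l. (\<lambda>n. \<nu> (s n - l)) \<longlonglongrightarrow> 0))"

definition finite_residue_field :: "('a::field \<Rightarrow> real) \<Rightarrow> bool" where
  "finite_residue_field \<nu> \<longleftrightarrow>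
     (\<exists>S. finite S \<and> (\<forall>x. \<nu> x \<le> 1 \<longrightarrow> (\<exists>y\<in>S. \<nu> (x - y) < 1)))"

definition padic_field :: "'a::field_char_0 itself \<Rightarrow> bool" where
  "padic_field _ \<longleftrightarrow>
     (\<exists>\<nu> :: 'a \<Rightarrow> real. nonarch_abs \<nu> \<and> discrete_abs \<nu> \<and> complete_abs \<nu> \<and> finite_residue_field \<nu>)"


section \<open>The root system of type E6\<close>

text \<open>
  Bourbaki labelling, labels 1 to 6. A root is the list of its six coefficients on the simple
  roots, so the coefficient on the i-th simple root is the list entry at position i - 1.
\<close>

definition cartan :: "nat \<Rightarrow> nat \<Rightarrow> int" where
  "cartan i j =
     (if i = j then 2
      else if {i, j} \<in> {{1, 3}, {3, 4}, {4, 5}, {5, 6}, {2, 4}} then - 1 else 0)"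

definition simple_root :: "nat \<Rightarrow> int list" where
  "simple_root i = map (\<lambda>j. if j = i then 1 else 0) [1..<7]"

definition coeff_at :: "int list \<Rightarrow> nat \<Rightarrow> int" where
  "coeff_at \<beta> i = \<beta> ! (i - 1)"

definition neg_root :: "int list \<Rightarrow> int list" where
  "neg_root = map uminus"

text \<open>
  As E6 is simply laced, the invariant form with all roots of square length 2 computes the pairing
  of a root with the coroot of another.
\<close>

definition root_form :: "int list \<Rightarrow> int list \<Rightarrow> int" where
  "root_form \<alpha> \<beta> = (\<Sum>i=1..6. \<Sum>j=1..6. coeff_at \<alpha> i * cartan i j * coeff_at \<beta> j)"

definition reflect :: "int list \<Rightarrow> int list \<Rightarrow> int list" where
  "reflect \<alpha> \<beta> = map2 (\<lambda>b a. b - root_form \<beta> \<alpha> * a) \<beta> \<alpha>"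

inductive_set roots :: "int list set" where
  simple: "i \<in> {1..6} \<Longrightarrow> simple_root i \<in> roots"
| reflect: "\<alpha> \<in> roots \<Longrightarrow> \<beta> \<in> roots \<Longrightarrow> reflect \<alpha> \<beta> \<in> roots"

text \<open>
  A word [i1, ..., ir] stands for the product of simple reflections s_i1 ... s_ir. Reducedness and
  maximal length refer to the Coxeter group generated by the reflections with labels in J.
\<close>

definition word_act :: "nat list \<Rightarrow> int list \<Rightarrow> int list" where
  "word_act w = foldr (\<lambda>i. reflect (simple_root i)) w"

definition reduced_word :: "nat set \<Rightarrow> nat list \<Rightarrow> bool" where
  "reduced_word J w \<longleftrightarrow> set w \<subseteq> J \<and>
     (\<forall>v. set v \<subseteq> J \<and> (\<forall>\<beta>\<in>roots. word_act v \<beta> = word_act w \<beta>) \<longrightarrow> length w \<le> length v)"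

definition longest_word :: "nat set \<Rightarrow> nat list \<Rightarrow> bool" where
  "longest_word J w \<longleftrightarrow>
     reduced_word J w \<and> (\<forall>v. reduced_word J v \<longrightarrow> length v \<le> length w)"


section \<open>The split simply connected group of type E6\<close>

text \<open>
  The group is realised, by Chevalley's construction, on the 27-dimensional minuscule module with
  highest weight the first fundamental weight. The weights of this module generate the full weight
  lattice, so the group generated by the root subgroups is the simply connected one, and it is the
  group of F-points. Weights are written as lists of their pairings with the six simple coroots;
  they form the Weyl orbit of the highest weight.
\<close>

definition minuscule_weights :: "int list list" where
  "minuscule_weights =
    [[1, 0, 0, 0, 0, 0], [-1, 0, 1, 0, 0, 0], [0, 0, -1, 1, 0, 0],
     [0, 1, 0, -1, 1, 0], [0, -1, 0, 0, 1, 0], [0, 1, 0, 0, -1, 1],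
     [0, -1, 0, 1, -1, 1], [0, 1, 0, 0, 0, -1], [0, 0, 1, -1, 0, 1],
     [0, -1, 0, 1, 0, -1], [1, 0, -1, 0, 0, 1], [0, 0, 1, -1, 1, -1],
     [-1, 0, 0, 0, 0, 1], [1, 0, -1, 0, 1, -1], [0, 0, 1, 0, -1, 0],
     [-1, 0, 0, 0, 1, -1], [1, 0, -1, 1, -1, 0], [-1, 0, 0, 1, -1, 0],
     [1, 1, 0, -1, 0, 0], [-1, 1, 1, -1, 0, 0], [1, -1, 0, 0, 0, 0],
     [-1, -1, 1, 0, 0, 0], [0, 1, -1, 0, 0, 0], [0, -1, -1, 1, 0, 0],
     [0, 0, 0, -1, 1, 0], [0, 0, 0, 0, -1, 1], [0, 0, 0, 0, 0, -1]]"

text \<open>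
  Row i of the Cartan matrix lists the pairings of the i-th simple root with the simple coroots.
\<close>

definition add_simple :: "int \<Rightarrow> nat \<Rightarrow> int list \<Rightarrow> int list" where
  "add_simple k i \<mu> = map (\<lambda>j. \<mu> ! (j - 1) + k * cartan i j) [1..<7]"

inductive_set weyl_orbit :: "int list \<Rightarrow> int list set" for \<mu> where
  base: "\<mu> \<in> weyl_orbit \<mu>"
| step: "\<kappa> \<in> weyl_orbit \<mu> \<Longrightarrow> i \<in> {1..6} \<Longrightarrow> add_simple (- (\<kappa> ! (i - 1))) i \<kappa> \<in> weyl_orbit \<mu>"

lemma distinct_minuscule_weights: "distinct minuscule_weights"
  by code_simp

lemma length_minuscule_weights: "length minuscule_weights = 27"
  by code_simp

lemma minuscule_weights_orbit: "set minuscule_weights = weyl_orbit [1, 0, 0, 0, 0, 0]"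
proof
  have *: "\<forall>k\<in>set [1..<27]. \<exists>j\<in>set [0..<k]. \<exists>i\<in>set [1..<7].
      minuscule_weights ! k
        = add_simple (- (minuscule_weights ! j ! (i - 1))) i (minuscule_weights ! j)"
    by code_simp
  have "k < 27 \<longrightarrow> minuscule_weights ! k \<in> weyl_orbit [1, 0, 0, 0, 0, 0]" for k
  proof (induction k rule: less_induct)
    case (less k)
    show ?case
    proof (cases "k = 0")
      case True
      then show ?thesis by (simp add: minuscule_weights_def weyl_orbit.base)
    next
      case False
      show ?thesis
      proof
        assume "k < 27"
        with False have "k \<in> set [1..<27]" by simp
        from *[rule_format, OF this] obtain j i where "j \<in> set [0..<k]" "i \<in> set [1..<7]"
          and eq: "minuscule_weights ! k
            = add_simple (- (minuscule_weights ! j ! (i - 1))) i (minuscule_weights ! j)"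
          by blast
        then have "j < k" "i \<in> {1..6}" by simp_all
        with less.IH \<open>k < 27\<close> have "minuscule_weights ! j \<in> weyl_orbit [1, 0, 0, 0, 0, 0]"
          by simp
        then show "minuscule_weights ! k \<in> weyl_orbit [1, 0, 0, 0, 0, 0]"
          unfolding eq using \<open>i \<in> {1..6}\<close> by (rule weyl_orbit.step)
      qed
    qed
  qed
  then show "set minuscule_weights \<subseteq> weyl_orbit [1, 0, 0, 0, 0, 0]"
    by (auto simp: in_set_conv_nth length_minuscule_weights)
  have **: "\<forall>\<kappa>\<in>set minuscule_weights. \<forall>i\<in>set [1..<7].
      add_simple (- (\<kappa> ! (i - 1))) i \<kappa> \<in> set minuscule_weights"
    by code_simp
  show "weyl_orbit [1, 0, 0, 0, 0, 0] \<subseteq> set minuscule_weights"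
  proof
    fix \<kappa> assume "\<kappa> \<in> weyl_orbit [1, 0, 0, 0, 0, 0]"
    then show "\<kappa> \<in> set minuscule_weights"
    proof induction
      case base
      show ?case by (simp add: minuscule_weights_def)
    next
      case (step \<kappa> i)
      then show ?case using ** by simp
    qed
  qed
qed

definition GL27 :: "'a::field mat monoid" where
  "GL27 = units_of (ring_mat TYPE('a) 27 ())"

text \<open>
  On a weight basis of a minuscule module indexed by the weights, the simple root vectors can be
  taken to be the following matrices without signs; the Serre relations hold because all pairings
  of weights with coroots are 0, 1 or -1.
\<close>

definition raising :: "nat \<Rightarrow> 'a::field mat" where
  "raising i = mat 27 27 (\<lambda>(r, s).
     if minuscule_weights ! r = add_simple 1 i (minuscule_weights ! s) then 1 else 0)"

definition lowering :: "nat \<Rightarrow> 'a::field mat" where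
  "lowering i = mat 27 27 (\<lambda>(r, s).
     if minuscule_weights ! r = add_simple (- 1) i (minuscule_weights ! s) then 1 else 0)"

text \<open>The simple coroots; being simply connected, the group has the torus generated by them.\<close>

definition simple_coroot :: "nat \<Rightarrow> 'a::field \<Rightarrow> 'a mat" where
  "simple_coroot i t = mat 27 27 (\<lambda>(r, s).
     if r = s then t powi (minuscule_weights ! r ! (i - 1)) else 0)"

definition weyl_rep :: "(int list \<Rightarrow> 'a::field \<Rightarrow> 'a mat) \<Rightarrow> int list \<Rightarrow> 'a mat" where
  "weyl_rep x \<alpha> = x \<alpha> 1 * x (neg_root \<alpha>) (- 1) * x \<alpha> 1"

text \<open>
  A Chevalley system extending the splitting: root subgroups for all roots, given on the simple
  roots and their negatives by the exponentials of the simple root vectors (which square to 0), and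
  permuted up to the sign of the parameter by the Weyl representatives. The remaining sign choices
  are left open.
\<close>

definition chevalley_system :: "(int list \<Rightarrow> 'a::field \<Rightarrow> 'a mat) \<Rightarrow> bool" where
  "chevalley_system x \<longleftrightarrow>
     (\<forall>i\<in>{1..6}. \<forall>t. x (simple_root i) t = 1\<^sub>m 27 + t \<cdot>\<^sub>m raising i) \<and>
     (\<forall>i\<in>{1..6}. \<forall>t. x (neg_root (simple_root i)) t = 1\<^sub>m 27 + t \<cdot>\<^sub>m lowering i) \<and>
     (\<forall>\<alpha>\<in>roots. \<forall>\<beta>\<in>roots. \<exists>\<epsilon>\<in>{1, - 1}. \<forall>t.
        weyl_rep x \<alpha> * x \<beta> t = x (reflect \<alpha> \<beta>) (\<epsilon> * t) * weyl_rep x \<alpha>)"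

text \<open>Levi factor, unipotent radical and its opposite, for P = MN with the second simple root deleted.\<close>

definition levi_M :: "(int list \<Rightarrow> 'a::field \<Rightarrow> 'a mat) \<Rightarrow> 'a mat set" where
  "levi_M x = generate GL27
     ({simple_coroot i t | i t. i \<in> {1..6} \<and> t \<noteq> 0} \<union>
      {x \<beta> t | \<beta> t. \<beta> \<in> roots \<and> coeff_at \<beta> 2 = 0})"

definition unip_N :: "(int list \<Rightarrow> 'a::field \<Rightarrow> 'a mat) \<Rightarrow> 'a mat set" where
  "unip_N x = generate GL27 {x \<beta> t | \<beta> t. \<beta> \<in> roots \<and> coeff_at \<beta> 2 > 0}"

definition opp_N :: "(int list \<Rightarrow> 'a::field \<Rightarrow> 'a mat) \<Rightarrow> 'a mat set" where
  "opp_N x = generate GL27 {x \<beta> t | \<beta> t. \<beta> \<in> roots \<and> coeff_at \<beta> 2 < 0}"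

definition word_rep :: "(int list \<Rightarrow> 'a::field \<Rightarrow> 'a mat) \<Rightarrow> nat list \<Rightarrow> 'a mat" where
  "word_rep x w = foldr (\<lambda>i A. weyl_rep x (simple_root i) * A) w (1\<^sub>m 27)"

text \<open>Here u and v are to be words for the longest Weyl elements of G and of M.\<close>

definition w0_rep ::
  "(int list \<Rightarrow> 'a::field \<Rightarrow> 'a mat) \<Rightarrow> nat list \<Rightarrow> nat list \<Rightarrow> 'a mat" where
  "w0_rep x u v = word_rep x u * inv\<^bsub>GL27\<^esub> (word_rep x v)"

definition is_M_component ::
  "(int list \<Rightarrow> 'a::field \<Rightarrow> 'a mat) \<Rightarrow> 'a mat \<Rightarrow> 'a mat \<Rightarrow> bool" where
  "is_M_component x g m \<longleftrightarrow>
     m \<in> levi_M x \<and> (\<exists>n'\<in>unip_N x. \<exists>nbar\<in>opp_N x. g = m * n' * nbar)"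

definition N_map ::
  "(int list \<Rightarrow> 'a::field \<Rightarrow> 'a mat) \<Rightarrow> nat list \<Rightarrow> nat list \<Rightarrow> 'a mat \<Rightarrow> 'a mat" where
  "N_map x u v n = (THE m. is_M_component x (inv\<^bsub>GL27\<^esub> (w0_rep x u v) * n) m)"


section \<open>The orbit representatives\<close>

definition gamma_root :: "nat \<Rightarrow> int list" where
  "gamma_root i =
     [[1, 2, 2, 3, 2, 1], [1, 1, 2, 3, 2, 1], [1, 1, 2, 2, 2, 1],
      [1, 1, 1, 2, 1, 1], [0, 1, 1, 2, 1, 0], [0, 1, 0, 0, 0, 0]] ! i"

definition n_point :: "(int list \<Rightarrow> 'a::field \<Rightarrow> 'a mat) \<Rightarrow> 'a vec \<Rightarrow> 'a mat" where
  "n_point x c =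
     x (gamma_root 0) (c $ 0) * x (gamma_root 1) (c $ 1) * x (gamma_root 2) (c $ 2) *
     x (gamma_root 3) (c $ 3) * x (gamma_root 4) (c $ 4) * x (gamma_root 5) 1"

definition R' :: "'a::field vec set" where
  "R' = {c \<in> carrier_vec 5.
     (\<forall>i<5. c $ i \<noteq> 0) \<and>
     c $ 0 - c $ 1 \<noteq> 0 \<and>
     c $ 0 * (c $ 0 - c $ 1) - c $ 2 * c $ 3 * c $ 4 \<noteq> 0 \<and>
     2 * (c $ 0)^2 * (c $ 3 * c $ 4 + c $ 2) - 2 * c $ 2 * (c $ 3)^2 * (c $ 4)^2
       + c $ 0 * c $ 1 * (c $ 4 - c $ 2) \<noteq> 0}"


section \<open>Zariski topology and regular maps\<close>

text \<open>
  F-points of subsets of affine spaces, the coordinates being given as a set K of functions on the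
  type of points. Only subsets of the relevant affine space (vectors or matrices of one fixed size)
  are ever considered, via subtopologies.
\<close>

inductive_set polyfun :: "('p \<Rightarrow> 'a::field) set \<Rightarrow> ('p \<Rightarrow> 'a) set" for K where
  coord: "f \<in> K \<Longrightarrow> f \<in> polyfun K"
| const: "(\<lambda>_. a) \<in> polyfun K"
| add: "f \<in> polyfun K \<Longrightarrow> g \<in> polyfun K \<Longrightarrow> (\<lambda>p. f p + g p) \<in> polyfun K"
| mult: "f \<in> polyfun K \<Longrightarrow> g \<in> polyfun K \<Longrightarrow> (\<lambda>p. f p * g p) \<in> polyfun K"

definition vec_coords :: "nat \<Rightarrow> ('a vec \<Rightarrow> 'a) set" where
  "vec_coords n = {\<lambda>c. c $ i | i. i < n}"

definition mat_coords :: "nat \<Rightarrow> ('a mat \<Rightarrow> 'a) set" where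
  "mat_coords n = {\<lambda>A. A $$ (i, j) | i j. i < n \<and> j < n}"

definition zariski :: "('p \<Rightarrow> 'a::field) set \<Rightarrow> 'p set \<Rightarrow> 'p topology" where
  "zariski K S = subtopology (topology_generated_by {{p. f p \<noteq> 0} | f. f \<in> polyfun K}) S"

definition regular_fun :: "('p \<Rightarrow> 'a::field) set \<Rightarrow> 'p set \<Rightarrow> ('p \<Rightarrow> 'a) \<Rightarrow> bool" where
  "regular_fun K S \<phi> \<longleftrightarrow>
     (\<forall>p\<in>S. \<exists>V. openin (zariski K S) V \<and> p \<in> V \<and>
        (\<exists>f\<in>polyfun K. \<exists>g\<in>polyfun K. \<forall>q\<in>V. g q \<noteq> 0 \<and> \<phi> q = f q / g q))"

definition regular_map ::
  "('p \<Rightarrow> 'a::field) set \<Rightarrow> ('q \<Rightarrow> 'a) set \<Rightarrow> 'p set \<Rightarrow> 'q set \<Rightarrow> ('p \<Rightarrow> 'q) \<Rightarrow> bool" where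
  "regular_map K L S T \<phi> \<longleftrightarrow> \<phi> ` S \<subseteq> T \<and> (\<forall>y\<in>L. regular_fun K S (\<lambda>p. y (\<phi> p)))"

definition regular_iso ::
  "('p \<Rightarrow> 'a::field) set \<Rightarrow> ('q \<Rightarrow> 'a) set \<Rightarrow> 'p set \<Rightarrow> 'q set \<Rightarrow> ('p \<Rightarrow> 'q) \<Rightarrow> bool" where
  "regular_iso K L S T \<phi> \<longleftrightarrow> regular_map K L S T \<phi> \<and>
     (\<exists>\<psi>. regular_map L K T S \<psi> \<and> (\<forall>p\<in>S. \<psi> (\<phi> p) = p) \<and> (\<forall>q\<in>T. \<phi> (\<psi> q) = q))"

definition locally_closed_in :: "'p topology \<Rightarrow> 'p set \<Rightarrow> bool" where
  "locally_closed_in X T \<longleftrightarrow> (\<exists>V C. openin X V \<and> closedin X C \<and> T = V \<inter> C)"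

text \<open>Local closedness makes the image a subvariety of Y.\<close>

definition iso_onto_image ::
  "('p \<Rightarrow> 'a::field) set \<Rightarrow> ('q \<Rightarrow> 'a) set \<Rightarrow> 'p set \<Rightarrow> 'q set \<Rightarrow> ('p \<Rightarrow> 'q) \<Rightarrow> bool" where
  "iso_onto_image K L S Y \<phi> \<longleftrightarrow>
     \<phi> ` S \<subseteq> Y \<and> locally_closed_in (zariski L Y) (\<phi> ` S) \<and> regular_iso K L S (\<phi> ` S) \<phi>"

end

theory Submission
  imports Defs "HOL-Computational_Algebra.Polynomial"
begin

text \<open>
  Grade the 27-dimensional module by the pairing of its weights with the coroot of the highest root
  \<open>\<gamma>\<^sub>0\<close>. The levels are 1, 0 and -1, and since \<open>\<gamma>\<^sub>0\<close> is the fundamental weight belonging to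
  \<open>\<alpha>\<^sub>2\<close>, the group \<open>M\<close> preserves levels while \<open>N\<close> raises and its opposite lowers them. Two
  consequences are the whole reason why the map can be inverted: the \<open>M\<close>-component \<open>m\<close> of
  \<open>g = m n' nbar\<close> is unique, and its block on the lowest level is the corresponding block of \<open>g\<close>
  itself (\<open>component_unique\<close>, \<open>component_low_block\<close>).

  The element \<open>w\<^sub>0\<close> enters only through \<open>w0_rep_inv\<close>: its inverse is \<open>m\<^sub>0 w(\<gamma>\<^sub>0)\<inverse>\<close> with a fixed
  \<open>m\<^sub>0\<close> in \<open>M\<close>, where \<open>w(\<gamma>\<^sub>0)\<close> is the Weyl representative of the highest root. Indeed the
  longest Weyl element of \<open>G\<close> and the reflection in \<open>\<gamma>\<^sub>0\<close> both send \<open>\<gamma>\<^sub>0\<close> to its negative, so they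
  differ by an element that fixes \<open>\<gamma>\<^sub>0\<close>, and the stabilizer of \<open>\<gamma>\<^sub>0\<close> is generated by the simple
  reflections of \<open>M\<close>.

  Injectivity. As \<open>w(\<gamma>\<^sub>0)\<close> exchanges the highest and the lowest level by a signed permutation, the
  lowest block of \<open>m\<^sub>0\<inverse> m\<close> is, up to signs, the block of the unipotent point that maps the lowest
  level to the highest. There one reads off \<open>c\<^sub>0\<close>, \<open>c\<^sub>0 \<plusminus> c\<^sub>1\<close>, \<open>c\<^sub>2\<close>, \<open>c\<^sub>3\<close> and
  \<open>c\<^sub>4\<close> (\<open>n_point_entries\<close>; the last three are products of two root vectors, one of which carries
  the coordinate 1). Hence the coordinates are linear functions of the entries of \<open>m\<close>.

  Existence and regularity. The identity \<open>w\<inverse> x(c) = x(-1/c) h(1/c) xbar(1/c)\<close> of SL2, applied to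
  \<open>\<gamma>\<^sub>0\<close>, and the commutator relations rewrite \<open>w(\<gamma>\<^sub>0)\<inverse> n\<close> as a product of elements of \<open>N\<close> and
  \<open>M\<close> followed by elements of \<open>M\<close> and the opposite of \<open>N\<close> (\<open>inv_weyl_n_point\<close>). The product of the
  factors from \<open>M\<close> is the component, and its entries are rational functions of the coordinates. The
  denominators are \<open>c\<^sub>0\<close>, \<open>c\<^sub>0 \<plusminus> c\<^sub>1\<close> and \<open>c\<^sub>0 (c\<^sub>0 \<plusminus> c\<^sub>1) \<plusminus> c\<^sub>2 c\<^sub>3 c\<^sub>4\<close>, with signs that
  depend on the choices in the Chevalley system; the open dense subset is the one on which they do
  not vanish.

  A morphism of this kind with a polynomial left inverse \<open>\<psi>\<close> is an isomorphism onto a locally closed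
  image, because a matrix \<open>A\<close> in \<open>M\<close> lies in the image exactly if \<open>\<psi> A\<close> lies in the open set and \<open>A\<close>
  satisfies all polynomial equations that hold on the image (\<open>iso_onto_image_by_retraction\<close>).

  All matrix identities are checked on rows: \<open>x \<beta> t\<close> adds \<open>\<plusminus> t\<close> times row \<open>s\<close> to row \<open>r\<close> whenever
  weight \<open>r\<close> is weight \<open>s\<close> plus \<open>\<beta>\<close>. The signs of these row operations are never computed; what is
  needed about them follows from the conjugation axiom of a Chevalley system.
\<close>

section \<open>Roots\<close>

definition root_weight :: "int list \<Rightarrow> nat \<Rightarrow> int" where
  "root_weight \<beta> j = (\<Sum>i=1..6. coeff_at \<beta> i * cartan i j)"

lemma cartan_sym: "cartan i j = cartan j i"
  by (simp add: cartan_def insert_commute)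

lemma root_form_weight: "root_form \<alpha> \<beta> = (\<Sum>j=1..6. root_weight \<alpha> j * coeff_at \<beta> j)"
  unfolding root_form_def root_weight_def sum_distrib_right by (rule sum.swap)

lemma root_form_sym: "root_form \<alpha> \<beta> = root_form \<beta> \<alpha>"
  unfolding root_form_def by (subst sum.swap) (simp add: cartan_sym mult_ac)

lemma coeff_at_reflect:
  "length \<alpha> = 6 \<Longrightarrow> length \<beta> = 6 \<Longrightarrow> i \<in> {1..6} \<Longrightarrow>
     coeff_at (reflect \<alpha> \<beta>) i = coeff_at \<beta> i - root_form \<beta> \<alpha> * coeff_at \<alpha> i"
  by (auto simp: coeff_at_def reflect_def)

lemma coeff_at_neg: "length \<beta> = 6 \<Longrightarrow> i \<in> {1..6} \<Longrightarrow> coeff_at (neg_root \<beta>) i = - coeff_at \<beta> i"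
  by (auto simp: coeff_at_def neg_root_def)

lemma length_reflect [simp]: "length \<alpha> = 6 \<Longrightarrow> length \<beta> = 6 \<Longrightarrow> length (reflect \<alpha> \<beta>) = 6"
  by (simp add: reflect_def)

lemma length_neg [simp]: "length (neg_root \<beta>) = length \<beta>"
  by (simp add: neg_root_def)

lemma length_simple [simp]: "length (simple_root i) = 6"
  by (simp add: simple_root_def)

lemma coeff_at_eqI:
  assumes "length \<alpha> = 6" "length \<beta> = 6" "\<And>i. i \<in> {1..6} \<Longrightarrow> coeff_at \<alpha> i = coeff_at \<beta> i"
  shows "\<alpha> = \<beta>"
proof (rule nth_equalityI)
  fix i assume "i < length \<alpha>"
  then show "\<alpha> ! i = \<beta> ! i"
    using assms(3)[of "Suc i"] assms(1) by (simp add: coeff_at_def)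
qed (simp add: assms)

lemma root_weight_reflect:
  assumes "length \<alpha> = 6" "length \<beta> = 6"
  shows "root_weight (reflect \<alpha> \<beta>) j = root_weight \<beta> j - root_form \<beta> \<alpha> * root_weight \<alpha> j"
proof -
  have "root_weight (reflect \<alpha> \<beta>) j
      = (\<Sum>i=1..6. (coeff_at \<beta> i - root_form \<beta> \<alpha> * coeff_at \<alpha> i) * cartan i j)"
    unfolding root_weight_def using coeff_at_reflect[OF assms] by (intro sum.cong) auto
  then show ?thesis
    by (simp add: root_weight_def left_diff_distrib sum_subtractf sum_distrib_left mult.assoc)
qed

lemma root_weight_neg:
  "length \<beta> = 6 \<Longrightarrow> root_weight (neg_root \<beta>) j = - root_weight \<beta> j"
  by (simp add: root_weight_def coeff_at_neg sum_negf)

lemma root_form_reflect_left: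
  assumes "length \<alpha> = 6" "length \<beta> = 6"
  shows "root_form (reflect \<alpha> \<beta>) \<gamma> = root_form \<beta> \<gamma> - root_form \<beta> \<alpha> * root_form \<alpha> \<gamma>"
  by (simp add: root_form_weight[of _ \<gamma>] root_weight_reflect[OF assms] left_diff_distrib
      sum_subtractf sum_distrib_left mult.assoc)

lemma root_form_neg_left: "length \<beta> = 6 \<Longrightarrow> root_form (neg_root \<beta>) \<gamma> = - root_form \<beta> \<gamma>"
  by (simp add: root_form_weight[of _ \<gamma>] root_weight_neg sum_negf)

lemma root_form_reflect_right:
  assumes "length \<alpha> = 6" "length \<beta> = 6"
  shows "root_form \<gamma> (reflect \<alpha> \<beta>) = root_form \<gamma> \<beta> - root_form \<beta> \<alpha> * root_form \<gamma> \<alpha>"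
  using root_form_reflect_left[OF assms, of \<gamma>] by (simp add: root_form_sym)

lemma root_form_neg_right: "length \<beta> = 6 \<Longrightarrow> root_form \<gamma> (neg_root \<beta>) = - root_form \<gamma> \<beta>"
  using root_form_neg_left[of \<beta> \<gamma>] by (simp add: root_form_sym)

lemma root_form_isometry:
  assumes "length \<alpha> = 6" "length \<beta> = 6" "length \<gamma> = 6" "root_form \<alpha> \<alpha> = 2"
  shows "root_form (reflect \<alpha> \<beta>) (reflect \<alpha> \<gamma>) = root_form \<beta> \<gamma>"
  using assms
  by (simp add: root_form_reflect_left root_form_reflect_right root_form_sym[of \<gamma> \<alpha>] algebra_simps)

lemma reflect_self:
  assumes "length \<alpha> = 6" "root_form \<alpha> \<alpha> = 2"
  shows "reflect \<alpha> \<alpha> = neg_root \<alpha>"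
  using assms by (intro coeff_at_eqI) (simp_all add: coeff_at_reflect coeff_at_neg)

lemma reflect_orthogonal:
  assumes "length \<alpha> = 6" "length \<beta> = 6" "root_form \<beta> \<alpha> = 0"
  shows "reflect \<alpha> \<beta> = \<beta>"
  using assms by (intro coeff_at_eqI) (simp_all add: coeff_at_reflect)

lemma reflect_reflect:
  assumes "length \<alpha> = 6" "length \<beta> = 6" "root_form \<alpha> \<alpha> = 2"
  shows "reflect \<alpha> (reflect \<alpha> \<beta>) = \<beta>"
  using assms
  by (intro coeff_at_eqI) (simp_all add: coeff_at_reflect root_form_reflect_left)

lemma reflect_neg:
  assumes "length \<alpha> = 6" "length \<beta> = 6"
  shows "reflect \<alpha> (neg_root \<beta>) = neg_root (reflect \<alpha> \<beta>)"
  using assms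
  by (intro coeff_at_eqI) (simp_all add: coeff_at_reflect coeff_at_neg root_form_neg_left)

lemma neg_neg [simp]: "neg_root (neg_root \<beta>) = \<beta>"
  by (simp add: neg_root_def map_idI)

lemma reflect_conj:
  assumes "length \<alpha> = 6" "length \<beta> = 6" "length \<gamma> = 6" "root_form \<alpha> \<alpha> = 2"
  shows "reflect (reflect \<alpha> \<beta>) (reflect \<alpha> \<gamma>) = reflect \<alpha> (reflect \<beta> \<gamma>)"
proof (rule coeff_at_eqI)
  fix i :: nat assume i: "i \<in> {1..6}"
  show "coeff_at (reflect (reflect \<alpha> \<beta>) (reflect \<alpha> \<gamma>)) i = coeff_at (reflect \<alpha> (reflect \<beta> \<gamma>)) i"
    using assms i root_form_isometry[of \<alpha> \<gamma> \<beta>]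
    by (simp add: coeff_at_reflect root_form_reflect_left[of \<beta> \<gamma>] root_form_sym[of \<alpha> \<beta>] algebra_simps
      del: atLeastAtMost_iff)
qed (use assms in simp_all)

text \<open>
  Explicit formulas, so that statements about all positive roots can be decided by rewriting.
\<close>
fun simple_reflection :: "nat \<Rightarrow> int list \<Rightarrow> int list" where
  "simple_reflection i [a, b, c, d, e, f] =
     (if i = 1 then [c - a, b, c, d, e, f]
      else if i = 2 then [a, d - b, c, d, e, f]
      else if i = 3 then [a, b, a + d - c, d, e, f]
      else if i = 4 then [a, b, c, b + c + e - d, e, f]
      else if i = 5 then [a, b, c, d, d + f - e, f]
      else [a, b, c, d, e, e - f])"
| "simple_reflection i _ = []"

lemma length6_cases:
  assumes "length (\<beta> :: int list) = 6"
  obtains a b c d e f where "\<beta> = [a, b, c, d, e, f]"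
proof -
  have "\<beta> = [\<beta> ! 0, \<beta> ! 1, \<beta> ! 2, \<beta> ! 3, \<beta> ! 4, \<beta> ! 5]"
    using assms by (intro nth_equalityI) (auto simp: less_Suc_eq numeral_eq_Suc)
  then show ?thesis by (rule that)
qed

lemma sum_1_6: "(\<Sum>i=1..6. f i) = f 1 + f 2 + f 3 + f 4 + f 5 + f (6::nat)" for f :: "nat \<Rightarrow> int"
  by (simp add: numeral_eq_Suc)

lemma all_1_6: "(\<forall>i\<in>{1..6}. P i) \<longleftrightarrow> P 1 \<and> P 2 \<and> P 3 \<and> P 4 \<and> P 5 \<and> P (6::nat)"
proof -
  have "{1..6} = {1, 2, 3, 4, 5, 6::nat}" by auto
  then show ?thesis by simp
qed

lemma root_weight_explicit:
  "root_weight [a, b, c, d, e, f] 1 = 2 * a - c"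
  "root_weight [a, b, c, d, e, f] 2 = 2 * b - d"
  "root_weight [a, b, c, d, e, f] 3 = 2 * c - a - d"
  "root_weight [a, b, c, d, e, f] 4 = 2 * d - b - c - e"
  "root_weight [a, b, c, d, e, f] 5 = 2 * e - d - f"
  "root_weight [a, b, c, d, e, f] 6 = 2 * f - e"
  unfolding root_weight_def sum_1_6
  by (simp_all add: cartan_def coeff_at_def doubleton_eq_iff del: One_nat_def)

lemma coeff_at_simple: "j \<in> {1..6} \<Longrightarrow> coeff_at (simple_root i) j = (if j = i then 1 else 0)"
  by (auto simp: coeff_at_def simple_root_def)

lemma root_form_simple:
  assumes "i \<in> {1..6}"
  shows "root_form \<beta> (simple_root i) = root_weight \<beta> i"
proof -
  have "root_form \<beta> (simple_root i) = (\<Sum>j=1..6. if j = i then root_weight \<beta> j else 0)"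
    unfolding root_form_weight by (intro sum.cong) (auto simp: coeff_at_simple)
  then show ?thesis using assms by simp
qed

lemma reflect_simple:
  assumes "i \<in> {1..6}" "length \<beta> = 6"
  shows "reflect (simple_root i) \<beta> = simple_reflection i \<beta>"
proof -
  obtain a b c d e f where \<beta>: "\<beta> = [a, b, c, d, e, f]" using length6_cases[OF assms(2)] .
  have "i = 1 \<or> i = 2 \<or> i = 3 \<or> i = 4 \<or> i = 5 \<or> i = 6" using assms(1) by auto
  then show ?thesis
    using root_form_simple[OF assms(1), of \<beta>]
    by (auto simp: reflect_def \<beta> simple_root_def root_weight_explicit upt_rec
        root_weight_explicit(1)[unfolded One_nat_def])
qed

lemma root_form_simple_self: "i \<in> {1..6} \<Longrightarrow> root_form (simple_root i) (simple_root i) = 2"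
proof -
  assume i: "i \<in> {1..6}"
  have "root_weight (simple_root i) i = (\<Sum>j=1..6. if j = i then 2 else 0)"
    unfolding root_weight_def by (intro sum.cong) (auto simp: coeff_at_simple cartan_def)
  then show ?thesis using i by (simp add: root_form_simple)
qed

lemma roots_length: "\<beta> \<in> roots \<Longrightarrow> length \<beta> = 6"
  by (induction rule: roots.induct) simp_all

lemma roots_norm: "\<beta> \<in> roots \<Longrightarrow> root_form \<beta> \<beta> = 2"
  by (induction rule: roots.induct) (simp_all add: root_form_simple_self root_form_isometry roots_length)

lemma neg_root_roots: "\<beta> \<in> roots \<Longrightarrow> neg_root \<beta> \<in> roots"
  using roots.reflect[of \<beta> \<beta>] by (simp add: reflect_self roots_length roots_norm)

text \<open>
  The simple roots come first, and every later root is carried to an earlier one by some simple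
  reflection, which makes it easy to see that all of them are roots.
\<close>
definition positive_roots :: "int list list" where
  "positive_roots =
    [[1, 0, 0, 0, 0, 0], [0, 1, 0, 0, 0, 0], [0, 0, 1, 0, 0, 0], [0, 0, 0, 1, 0, 0],
     [0, 0, 0, 0, 1, 0], [0, 0, 0, 0, 0, 1], [1, 0, 1, 0, 0, 0], [0, 1, 0, 1, 0, 0],
     [0, 0, 1, 1, 0, 0], [0, 0, 0, 1, 1, 0], [0, 0, 0, 0, 1, 1], [1, 0, 1, 1, 0, 0],
     [0, 1, 1, 1, 0, 0], [0, 1, 0, 1, 1, 0], [0, 0, 1, 1, 1, 0], [0, 0, 0, 1, 1, 1],
     [1, 1, 1, 1, 0, 0], [1, 0, 1, 1, 1, 0], [0, 1, 1, 1, 1, 0], [0, 1, 0, 1, 1, 1],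
     [0, 0, 1, 1, 1, 1], [1, 1, 1, 1, 1, 0], [1, 0, 1, 1, 1, 1], [0, 1, 1, 2, 1, 0],
     [0, 1, 1, 1, 1, 1], [1, 1, 1, 2, 1, 0], [1, 1, 1, 1, 1, 1], [0, 1, 1, 2, 1, 1],
     [1, 1, 2, 2, 1, 0], [1, 1, 1, 2, 1, 1], [0, 1, 1, 2, 2, 1], [1, 1, 2, 2, 1, 1],
     [1, 1, 1, 2, 2, 1], [1, 1, 2, 2, 2, 1], [1, 1, 2, 3, 2, 1], [1, 2, 2, 3, 2, 1]]"

definition all_roots :: "int list list" where
  "all_roots = positive_roots @ map neg_root positive_roots"

lemma simple_root_list: "map simple_root [1..<7] = take 6 positive_roots"
  by code_simp

lemma positive_roots_simple_reflection:
  "\<forall>i\<in>set [1..<7]. \<forall>\<beta>\<in>set positive_roots.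
     \<beta> = positive_roots ! (i - 1) \<or> simple_reflection i \<beta> \<in> set positive_roots"
  by code_simp

lemma positive_roots_reached:
  "\<forall>k\<in>set [6..<36]. \<exists>i\<in>set [1..<7]. simple_reflection i (positive_roots ! k) \<in> set (take k positive_roots)"
  by code_simp

lemma positive_roots_nonneg:
  "\<forall>\<beta>\<in>set positive_roots. length \<beta> = 6 \<and> (\<forall>k\<in>set \<beta>. 0 \<le> k) \<and> (\<exists>k\<in>set \<beta>. 0 < k)"
  by code_simp

lemma simple_root_nth: "i \<in> {1..6} \<Longrightarrow> simple_root i = positive_roots ! (i - 1)"
proof -
  assume i: "i \<in> {1..6}"
  then have "simple_root i = map simple_root [1..<7] ! (i - 1)" by (auto simp: nth_map)
  also have "\<dots> = positive_roots ! (i - 1)" using i unfolding simple_root_list by auto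
  finally show ?thesis .
qed

lemma length_positive_roots: "length positive_roots = 36"
  by code_simp

lemma simple_root_positive: "i \<in> {1..6} \<Longrightarrow> simple_root i \<in> set positive_roots"
  by (auto simp: simple_root_nth length_positive_roots intro!: nth_mem)

lemma simple_reflection_positive:
  assumes "i \<in> {1..6}" "\<beta> \<in> set positive_roots" "\<beta> \<noteq> simple_root i"
  shows "reflect (simple_root i) \<beta> \<in> set positive_roots"
proof -
  have "length \<beta> = 6" using positive_roots_nonneg assms(2) by auto
  moreover have "i \<in> set [1..<7]" using assms(1) by auto
  ultimately show ?thesis
    using positive_roots_simple_reflection assms
    by (metis simple_root_nth reflect_simple)
qed

lemma all_roots_length: "\<beta> \<in> set all_roots \<Longrightarrow> length \<beta> = 6"
  using positive_roots_nonneg by (auto simp: all_roots_def)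

lemma all_roots_simple_reflection:
  assumes "i \<in> {1..6}" "\<beta> \<in> set all_roots"
  shows "reflect (simple_root i) \<beta> \<in> set all_roots"
proof -
  have *: "reflect (simple_root i) \<beta> \<in> set all_roots" if "\<beta> \<in> set positive_roots" for \<beta>
    using simple_reflection_positive[OF assms(1) that] simple_root_positive[OF assms(1)] assms(1)
    by (cases "\<beta> = simple_root i") (auto simp: all_roots_def reflect_self root_form_simple_self)
  show ?thesis
  proof (cases "\<beta> \<in> set positive_roots")
    case False
    then obtain \<gamma> where \<gamma>: "\<beta> = neg_root \<gamma>" "\<gamma> \<in> set positive_roots"
      using assms(2) by (auto simp: all_roots_def)
    then have "length \<gamma> = 6" using positive_roots_nonneg by auto
    with *[OF \<gamma>(2)] show ?thesis by (auto simp: \<gamma>(1) reflect_neg all_roots_def)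
  qed (rule *)
qed

text \<open>
  The reflection in \<open>s\<^sub>\<alpha> \<beta>\<close> is \<open>s\<^sub>\<alpha> s\<^sub>\<beta> s\<^sub>\<alpha>\<close>, so a set that is stable under the simple
  reflections is stable under the reflections in all roots.
\<close>
lemma roots_subset_all_roots: "roots \<subseteq> set all_roots"
proof
  fix \<beta> assume "\<beta> \<in> roots"
  then have "\<beta> \<in> roots \<and> \<beta> \<in> set all_roots \<and> (\<forall>\<gamma>\<in>set all_roots. reflect \<beta> \<gamma> \<in> set all_roots)"
  proof induction
    case (simple i)
    then show ?case
      using all_roots_simple_reflection simple_root_positive roots.simple
      by (auto simp: all_roots_def)
  next
    case (reflect \<alpha> \<beta>)
    have "reflect (reflect \<alpha> \<beta>) \<gamma> \<in> set all_roots" if "\<gamma> \<in> set all_roots" for \<gamma>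
    proof -
      have "reflect (reflect \<alpha> \<beta>) \<gamma> = reflect \<alpha> (reflect \<beta> (reflect \<alpha> \<gamma>))"
        using reflect_conj[of \<alpha> \<beta> "reflect \<alpha> \<gamma>"] reflect that
        by (simp add: reflect_reflect roots_length roots_norm all_roots_length)
      then show ?thesis using reflect that by simp
    qed
    then show ?case using reflect by (auto intro: roots.reflect)
  qed
  then show "\<beta> \<in> set all_roots" by simp
qed

lemma positive_roots_subset_roots: "set positive_roots \<subseteq> roots"
proof -
  have "k < 36 \<longrightarrow> positive_roots ! k \<in> roots" for k
  proof (induction k rule: less_induct)
    case (less k)
    show ?case
    proof (intro impI)
      assume k: "k < 36"
      show "positive_roots ! k \<in> roots"
      proof (cases "k < 6")
        case True
        then show ?thesis
          using simple_root_nth[of "Suc k"] roots.simple[of "Suc k"] by auto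
      next
        case False
        then have "k \<in> set [6..<36]" using k unfolding set_upt by simp
        from bspec[OF positive_roots_reached this] obtain i where "i \<in> set [1..<7]"
          and mem: "simple_reflection i (positive_roots ! k) \<in> set (take k positive_roots)"
          by (rule bexE)
        then have i: "i \<in> {1..6}" by auto
        have len: "length (positive_roots ! k) = 6"
          using positive_roots_nonneg k by (simp add: length_positive_roots)
        obtain j where "j < k" "positive_roots ! j = reflect (simple_root i) (positive_roots ! k)"
          using mem i len k by (auto simp: in_set_conv_nth length_positive_roots reflect_simple)
        then have "reflect (simple_root i) (positive_roots ! k) \<in> roots"
          using less k by (metis order.strict_trans)
        then have "reflect (simple_root i) (reflect (simple_root i) (positive_roots ! k)) \<in> roots"
          by (rule roots.reflect[OF roots.simple[OF i]])
        then show ?thesis using i len by (simp add: reflect_reflect root_form_simple_self)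
      qed
    qed
  qed
  then show ?thesis by (auto simp: in_set_conv_nth length_positive_roots)
qed

lemma roots_eq: "roots = set all_roots"
  using roots_subset_all_roots positive_roots_subset_roots neg_root_roots by (auto simp: all_roots_def)

lemma coeff_at_mem: "length \<beta> = 6 \<Longrightarrow> i \<in> {1..6} \<Longrightarrow> coeff_at \<beta> i \<in> set \<beta>"
  by (auto simp: coeff_at_def)

lemma positive_coeff: "\<beta> \<in> set positive_roots \<Longrightarrow> i \<in> {1..6} \<Longrightarrow> 0 \<le> coeff_at \<beta> i"
  using positive_roots_nonneg coeff_at_mem by blast

lemma nonpositive_coeff:
  "\<beta> \<in> roots \<Longrightarrow> \<beta> \<notin> set positive_roots \<Longrightarrow> i \<in> {1..6} \<Longrightarrow> coeff_at \<beta> i \<le> 0"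
  using positive_coeff[of "neg_root \<beta>" i] coeff_at_neg[of \<beta> i]
  by (auto simp: roots_eq all_roots_def dest: all_roots_length) (metis coeff_at_neg neg_0_le_iff_le neg_neg
      length_neg positive_coeff positive_roots_nonneg neg_le_0_iff_le atLeastAtMost_iff)

lemma neg_positive_not_positive: "\<beta> \<in> set positive_roots \<Longrightarrow> neg_root \<beta> \<notin> set positive_roots"
proof
  assume \<beta>: "\<beta> \<in> set positive_roots" and neg: "neg_root \<beta> \<in> set positive_roots"
  obtain k where k: "k \<in> set \<beta>" "0 < k" using positive_roots_nonneg \<beta> by auto
  then have "- k \<in> set (neg_root \<beta>)" by (simp add: neg_root_def)
  then have "0 \<le> - k" using positive_roots_nonneg neg by blast
  then show False using k by simp
qed

lemma root_negative:
  "\<beta> \<in> roots \<Longrightarrow> \<beta> \<notin> set positive_roots \<longleftrightarrow> neg_root \<beta> \<in> set positive_roots"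
  using neg_positive_not_positive[of \<beta>] neg_positive_not_positive[of "neg_root \<beta>"]
  by (auto simp: roots_eq all_roots_def)

section \<open>The longest Weyl element sends the highest root to its negative\<close>

lemma word_act_simps [simp]:
  "word_act [] \<beta> = \<beta>"
  "word_act (i # w) \<beta> = reflect (simple_root i) (word_act w \<beta>)"
  "word_act (a @ b) \<beta> = word_act a (word_act b \<beta>)"
  by (simp_all add: word_act_def)

lemma length_word_act [simp]: "length \<beta> = 6 \<Longrightarrow> length (word_act w \<beta>) = 6"
  by (induction w) simp_all

lemma word_act_roots: "set w \<subseteq> {1..6} \<Longrightarrow> \<beta> \<in> roots \<Longrightarrow> word_act w \<beta> \<in> roots"
  by (induction w) (auto intro!: roots.reflect roots.simple)

lemma word_act_isometry:
  "set w \<subseteq> {1..6} \<Longrightarrow> length \<beta> = 6 \<Longrightarrow> length \<gamma> = 6 \<Longrightarrow>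
     root_form (word_act w \<beta>) (word_act w \<gamma>) = root_form \<beta> \<gamma>"
  by (induction w) (auto simp: root_form_isometry root_form_simple_self)

lemma word_act_reflect:
  "set w \<subseteq> {1..6} \<Longrightarrow> length \<beta> = 6 \<Longrightarrow> length \<gamma> = 6 \<Longrightarrow>
     word_act w (reflect \<beta> \<gamma>) = reflect (word_act w \<beta>) (word_act w \<gamma>)"
  by (induction w) (auto simp: reflect_conj root_form_simple_self)

lemma word_act_rev:
  "set w \<subseteq> {1..6} \<Longrightarrow> length \<beta> = 6 \<Longrightarrow> word_act (rev w) (word_act w \<beta>) = \<beta>"
  by (induction w) (auto simp: reflect_reflect root_form_simple_self)

lemma word_act_neg:
  "length \<beta> = 6 \<Longrightarrow> word_act w (neg_root \<beta>) = neg_root (word_act w \<beta>)"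
  by (induction w) (auto simp: reflect_neg)

text \<open>
  Used to pass from the images of the simple roots to the signs of the images of all positive roots.
\<close>
lemma word_act_linear:
  assumes "length \<beta> = 6"
  shows "j \<in> {1..6} \<Longrightarrow>
    coeff_at (word_act w \<beta>) j
      = (\<Sum>i=1..6. coeff_at \<beta> i * coeff_at (word_act w (simple_root i)) j)"
proof (induction w arbitrary: j)
  case Nil
  have "(\<Sum>i=1..6. coeff_at \<beta> i * coeff_at (simple_root i) j)
      = (\<Sum>i=1..6. if i = j then coeff_at \<beta> i else 0)"
    using Nil by (intro sum.cong) (auto simp: coeff_at_simple)
  then show ?case using Nil by simp
next
  case (Cons a w)
  let ?k = "\<lambda>\<gamma>. root_form (simple_root a) \<gamma>"
  have "?k (word_act w \<beta>)
      = (\<Sum>j=1..6. \<Sum>i=1..6. root_weight (simple_root a) j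
          * (coeff_at \<beta> i * coeff_at (word_act w (simple_root i)) j))"
    unfolding root_form_weight sum_distrib_left[symmetric] using Cons.IH by (intro sum.cong) auto
  also have "\<dots> = (\<Sum>i=1..6. coeff_at \<beta> i * ?k (word_act w (simple_root i)))"
    by (subst sum.swap) (simp add: root_form_weight sum_distrib_left mult_ac)
  finally have k: "?k (word_act w \<beta>) = (\<Sum>i=1..6. coeff_at \<beta> i * ?k (word_act w (simple_root i)))" .
  have "coeff_at (word_act (a # w) \<beta>) j
      = coeff_at (word_act w \<beta>) j - ?k (word_act w \<beta>) * coeff_at (simple_root a) j"
    using assms Cons.prems by (simp add: coeff_at_reflect root_form_sym del: atLeastAtMost_iff)
  also have "\<dots> = (\<Sum>i=1..6. coeff_at \<beta> i * (coeff_at (word_act w (simple_root i)) j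
        - ?k (word_act w (simple_root i)) * coeff_at (simple_root a) j))"
    using Cons.IH[OF Cons.prems]
    by (simp add: k right_diff_distrib sum_subtractf sum_distrib_right mult.assoc)
  also have "\<dots> = (\<Sum>i=1..6. coeff_at \<beta> i * coeff_at (word_act (a # w) (simple_root i)) j)"
    using Cons.prems
    by (intro sum.cong) (simp_all add: coeff_at_reflect root_form_sym del: atLeastAtMost_iff)
  finally show ?case .
qed

text \<open>
  Read the word from the right. When the image of \<open>\<alpha>\<^sub>i\<close> first becomes negative, at the letter \<open>j\<close>, it
  must have been \<open>\<alpha>\<^sub>j\<close> just before, because this is the only positive root that \<open>s\<^sub>j\<close> makes negative.
  This is the exchange condition: \<open>s\<^sub>j b = b s\<^sub>i\<close>, so that the letter \<open>j\<close> can be traded for a final \<open>i\<close>.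
\<close>
lemma exchange:
  assumes "set r \<subseteq> {1..6}" "i \<in> {1..6}" "word_act r (simple_root i) \<notin> set positive_roots"
  obtains a j b where "r = a @ j # b" "word_act b (simple_root i) = simple_root j"
  using assms
proof (induction r arbitrary: thesis)
  case Nil
  then show ?case using simple_root_positive by simp
next
  case (Cons j r)
  show ?case
  proof (cases "word_act r (simple_root i) \<in> set positive_roots")
    case True
    have "word_act r (simple_root i) = simple_root j"
      using simple_reflection_positive[OF _ True, of j] Cons.prems by auto
    then show ?thesis using Cons.prems(1)[of "[]"] by simp
  next
    case False
    then obtain a k b where "r = a @ k # b" "word_act b (simple_root i) = simple_root k"
      using Cons by auto
    then show ?thesis using Cons.prems(1)[of "j # a"] by simp
  qed
qed

text \<open>
  If the image is positive, every word for \<open>u s\<^sub>i\<close> makes \<open>\<alpha>\<^sub>i\<close> negative and can be shortened by one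
  letter to a word for \<open>u\<close>. So \<open>u\<close> followed by \<open>i\<close> is reduced, and \<open>u\<close> is not longest.
\<close>
lemma longest_word_negative:
  assumes u: "longest_word {1..6} u" and i: "i \<in> {1..6}"
  shows "word_act u (simple_root i) \<notin> set positive_roots"
proof
  assume pos: "word_act u (simple_root i) \<in> set positive_roots"
  have red: "reduced_word {1..6} u" and su: "set u \<subseteq> {1..6}"
    using u by (auto simp: longest_word_def reduced_word_def)
  have "reduced_word {1..6} (u @ [i])"
    unfolding reduced_word_def
  proof (intro conjI allI impI)
    show "set (u @ [i]) \<subseteq> {1..6}" using su i by auto
    fix v assume v: "set v \<subseteq> {1..6} \<and> (\<forall>\<beta>\<in>roots. word_act v \<beta> = word_act (u @ [i]) \<beta>)"
    have "word_act v (simple_root i) = neg_root (word_act u (simple_root i))"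
      using v roots.simple[OF i] i
      by (simp add: reflect_self root_form_simple_self word_act_neg)
    then have "word_act v (simple_root i) \<notin> set positive_roots"
      using neg_positive_not_positive[OF pos] by simp
    then obtain a j b where ab: "v = a @ j # b" "word_act b (simple_root i) = simple_root j"
      using v i exchange by metis
    have "word_act (a @ b) \<beta> = word_act u \<beta>" if "\<beta> \<in> roots" for \<beta>
    proof -
      let ?s = "reflect (simple_root i)"
      have len: "length \<beta> = 6" using that by (rule roots_length)
      have sb: "set b \<subseteq> {1..6}" using v ab(1) by auto
      have j: "root_form (simple_root j) (simple_root j) = 2"
        using v ab(1) root_form_simple_self by auto
      have "word_act u \<beta> = word_act u (?s (?s \<beta>))"
        using len i by (simp add: reflect_reflect root_form_simple_self)
      also have "\<dots> = word_act v (?s \<beta>)"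
        using v roots.reflect[OF roots.simple[OF i] that] by simp
      also have "\<dots> = word_act a (word_act b \<beta>)"
        using len j word_act_reflect[OF sb, of "simple_root i" \<beta>]
        by (simp add: ab reflect_reflect)
      finally show ?thesis by simp
    qed
    moreover have "set (a @ b) \<subseteq> {1..6}" using v ab(1) by auto
    ultimately have "length u \<le> length (a @ b)"
      using red unfolding reduced_word_def by blast
    then show "length (u @ [i]) \<le> length v" using ab(1) by simp
  qed
  then show False using u unfolding longest_word_def by fastforce
qed

abbreviation highest_root :: "int list" where
  "highest_root \<equiv> [1, 2, 2, 3, 2, 1]"

lemma highest_root_positive: "highest_root \<in> set positive_roots"
  by (simp add: positive_roots_def)

text \<open>
  In other words, the highest root is the fundamental weight of the second simple root.
\<close>
lemma root_form_highest: "length \<beta> = 6 \<Longrightarrow> root_form highest_root \<beta> = coeff_at \<beta> 2"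
  unfolding root_form_weight sum_1_6
  by (simp add: root_weight_explicit del: One_nat_def)

lemma dominant_root_check:
  "\<forall>\<beta>\<in>set positive_roots. \<beta> = highest_root \<or>
     (\<exists>i\<in>set [1..<7]. simple_reflection i \<beta> \<noteq> \<beta> \<and> \<beta> ! (i - 1) < simple_reflection i \<beta> ! (i - 1))"
  by code_simp

lemma dominant_root:
  assumes "\<beta> \<in> set positive_roots" "\<And>i. i \<in> {1..6} \<Longrightarrow> 0 \<le> root_form \<beta> (simple_root i)"
  shows "\<beta> = highest_root"
proof (rule ccontr)
  assume "\<beta> \<noteq> highest_root"
  then obtain i where i: "i \<in> {1..6}" "\<beta> ! (i - 1) < reflect (simple_root i) \<beta> ! (i - 1)"
    using dominant_root_check assms(1) positive_roots_nonneg by (fastforce simp: reflect_simple)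
  have "length \<beta> = 6" using assms(1) positive_roots_nonneg by auto
  then have "coeff_at (reflect (simple_root i) \<beta>) i = coeff_at \<beta> i - root_form \<beta> (simple_root i)"
    using i(1) by (simp add: coeff_at_reflect coeff_at_simple del: atLeastAtMost_iff)
  then show False using i assms(2)[OF i(1)] by (simp add: coeff_at_def)
qed

text \<open>
  The longest element makes every positive root negative, and so does its inverse. Therefore the
  image of the highest root pairs nonpositively with every simple root, its negative is a dominant
  root, and the highest root is the only one.
\<close>
lemma longest_word_highest_root:
  assumes u: "longest_word {1..6} u"
  shows "word_act u highest_root = neg_root highest_root"
proof -
  have su: "set u \<subseteq> {1..6}" using u by (auto simp: longest_word_def reduced_word_def)
  have sru: "set (rev u) \<subseteq> {1..6}" using su by simp
  have len: "length highest_root = 6" by simp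
  have h: "highest_root \<in> roots" using highest_root_positive positive_roots_subset_roots by auto
  have le: "root_form (word_act u highest_root) (simple_root i) \<le> 0" if i: "i \<in> {1..6}" for i
  proof -
    define \<rho> where "\<rho> = word_act (rev u) (simple_root i)"
    have \<rho>: "\<rho> \<in> roots" using word_act_roots[OF sru roots.simple[OF i]] by (simp add: \<rho>_def)
    have u\<rho>: "word_act u \<rho> = simple_root i"
      using word_act_rev[OF sru, of "simple_root i"] by (simp add: \<rho>_def)
    have "\<rho> \<notin> set positive_roots"
    proof
      assume pos: "\<rho> \<in> set positive_roots"
      have "coeff_at (word_act u \<rho>) i \<le> 0"
        unfolding word_act_linear[OF roots_length[OF \<rho>] i]
        using pos positive_coeff su longest_word_negative[OF u] word_act_roots[OF su roots.simple]
        by (intro sum_nonpos mult_nonneg_nonpos nonpositive_coeff[OF _ _ i]) auto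
      then show False using i by (simp add: u\<rho> coeff_at_simple)
    qed
    then have "coeff_at \<rho> 2 \<le> 0" using \<rho> nonpositive_coeff by simp
    then have "root_form highest_root \<rho> \<le> 0" using roots_length[OF \<rho>] by (simp add: root_form_highest)
    then show ?thesis
      using word_act_isometry[OF su len roots_length[OF \<rho>]] by (simp add: u\<rho>)
  qed
  let ?\<beta> = "word_act u highest_root"
  have \<beta>: "?\<beta> \<in> roots" using word_act_roots[OF su h] .
  have "?\<beta> \<notin> set positive_roots"
  proof
    assume pos: "?\<beta> \<in> set positive_roots"
    have "root_form ?\<beta> ?\<beta> = (\<Sum>j=1..6. root_weight ?\<beta> j * coeff_at ?\<beta> j)" by (rule root_form_weight)
    also have "\<dots> \<le> 0"
      using le positive_coeff[OF pos] by (intro sum_nonpos mult_nonpos_nonneg) (auto simp: root_form_simple)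
    finally show False using roots_norm[OF \<beta>] by simp
  qed
  then have "neg_root ?\<beta> \<in> set positive_roots" using root_negative[OF \<beta>] by simp
  then have "neg_root ?\<beta> = highest_root"
    using le roots_length[OF \<beta>] by (intro dominant_root) (auto simp: root_form_neg_left)
  then show ?thesis by (metis neg_neg)
qed

section \<open>Roots and the weights of the minuscule module\<close>

definition weight_coord :: "nat \<Rightarrow> nat \<Rightarrow> int" where
  "weight_coord r j = minuscule_weights ! r ! (j - 1)"

definition pairing :: "int list \<Rightarrow> nat \<Rightarrow> int" where
  "pairing \<beta> r = (\<Sum>i=1..6. coeff_at \<beta> i * weight_coord r i)"

text \<open>
  Weight \<open>r\<close> is weight \<open>s\<close> plus \<open>\<beta>\<close>. These are the positions at which a root vector of \<open>\<beta>\<close> has a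
  nonzero entry, in row \<open>r\<close> and column \<open>s\<close>.
\<close>
definition link :: "int list \<Rightarrow> nat \<Rightarrow> nat \<Rightarrow> bool" where
  "link \<beta> s r \<longleftrightarrow> s < 27 \<and> r < 27 \<and>
     (\<forall>j\<in>{1..6}. weight_coord r j = weight_coord s j + root_weight \<beta> j)"

lemma weights_shape: "\<forall>\<mu>\<in>set minuscule_weights. length \<mu> = 6 \<and> (\<forall>k\<in>set \<mu>. k = - 1 \<or> k = 0 \<or> k = 1)"
  by code_simp

lemma length_weight: "r < 27 \<Longrightarrow> length (minuscule_weights ! r) = 6"
  using weights_shape by (simp add: length_minuscule_weights)

lemma weight_coord_cases:
  assumes "r < 27" "j \<in> {1..6}"
  shows "weight_coord r j \<in> {- 1, 0, 1}"
proof -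
  have "weight_coord r j \<in> set (minuscule_weights ! r)"
    using assms length_weight by (auto simp: weight_coord_def)
  then show ?thesis using weights_shape assms(1) by (fastforce simp: length_minuscule_weights)
qed

lemma weight_eqI:
  assumes "r < 27" "s < 27" "\<And>j. j \<in> {1..6} \<Longrightarrow> weight_coord r j = weight_coord s j"
  shows "r = s"
proof -
  have "minuscule_weights ! r = minuscule_weights ! s"
  proof (rule nth_equalityI)
    fix i assume "i < length (minuscule_weights ! r)"
    then show "minuscule_weights ! r ! i = minuscule_weights ! s ! i"
      using assms(3)[of "Suc i"] length_weight[OF assms(1)] by (simp add: weight_coord_def)
  qed (simp add: assms length_weight)
  then show ?thesis
    using distinct_minuscule_weights assms by (simp add: nth_eq_iff_index_eq length_minuscule_weights)
qed

lemma pairing_reflect: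
  assumes "length \<alpha> = 6" "length \<beta> = 6"
  shows "pairing (reflect \<alpha> \<beta>) r = pairing \<beta> r - root_form \<beta> \<alpha> * pairing \<alpha> r"
proof -
  have "pairing (reflect \<alpha> \<beta>) r
      = (\<Sum>i=1..6. (coeff_at \<beta> i - root_form \<beta> \<alpha> * coeff_at \<alpha> i) * weight_coord r i)"
    unfolding pairing_def using coeff_at_reflect[OF assms] by (intro sum.cong) auto
  then show ?thesis
    by (simp add: pairing_def left_diff_distrib sum_subtractf sum_distrib_left mult.assoc)
qed

lemma pairing_neg: "length \<beta> = 6 \<Longrightarrow> pairing (neg_root \<beta>) r = - pairing \<beta> r"
  by (simp add: pairing_def coeff_at_neg sum_negf)

lemma pairing_simple:
  assumes "i \<in> {1..6}" shows "pairing (simple_root i) r = weight_coord r i"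
proof -
  have "pairing (simple_root i) r = (\<Sum>j=1..6. if j = i then weight_coord r j else 0)"
    unfolding pairing_def by (intro sum.cong) (auto simp: coeff_at_simple)
  then show ?thesis using assms by simp
qed

lemma root_weight_simple:
  assumes "i \<in> {1..6}" shows "root_weight (simple_root i) j = cartan i j"
proof -
  have "root_weight (simple_root i) j = (\<Sum>k=1..6. if k = i then cartan k j else 0)"
    unfolding root_weight_def by (intro sum.cong) (auto simp: coeff_at_simple)
  then show ?thesis using assms by simp
qed

lemma pairing_shift:
  assumes "\<forall>j\<in>{1..6}. weight_coord r j = weight_coord s j + k * root_weight \<alpha> j"
  shows "pairing \<beta> r = pairing \<beta> s + k * root_form \<alpha> \<beta>"
proof -
  have "pairing \<beta> r = (\<Sum>j=1..6. coeff_at \<beta> j * (weight_coord s j + k * root_weight \<alpha> j))"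
    unfolding pairing_def using assms by (intro sum.cong) auto
  then show ?thesis
    by (simp add: pairing_def root_form_weight distrib_left sum.distrib sum_distrib_left mult_ac)
qed

text \<open>
  The module is minuscule: all pairings are -1, 0 or 1, and the weights are permuted by the
  reflections. Both properties pass from \<open>\<alpha>\<close> and \<open>\<beta>\<close> to \<open>s\<^sub>\<alpha> \<beta>\<close> because its reflection is
  \<open>s\<^sub>\<alpha> s\<^sub>\<beta> s\<^sub>\<alpha>\<close>.
\<close>
lemma weight_reflection:
  assumes "\<beta> \<in> roots"
  shows "\<forall>s<27. pairing \<beta> s \<in> {- 1, 0, 1} \<and>
    (\<exists>r<27. \<forall>j\<in>{1..6}. weight_coord r j = weight_coord s j + (- pairing \<beta> s) * root_weight \<beta> j)"
  using assms
proof induction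
  case (simple i)
  show ?case
  proof (intro allI impI conjI)
    fix s :: nat assume s: "s < 27"
    show "pairing (simple_root i) s \<in> {- 1, 0, 1}"
      unfolding pairing_simple[OF simple] by (rule weight_coord_cases[OF s simple])
    have "minuscule_weights ! s \<in> weyl_orbit [1, 0, 0, 0, 0, 0]"
      using s by (simp add: minuscule_weights_orbit[symmetric] length_minuscule_weights)
    from weyl_orbit.step[OF this simple] obtain r where r: "r < 27"
      "minuscule_weights ! r = add_simple (- weight_coord s i) i (minuscule_weights ! s)"
      by (auto simp: minuscule_weights_orbit[symmetric] in_set_conv_nth length_minuscule_weights
          weight_coord_def)
    have "weight_coord r j = weight_coord s j + - pairing (simple_root i) s * root_weight (simple_root i) j"
      if "j \<in> {1..6}" for j
    proof -
      have "[1..<7] ! (j - 1) = j" using that by (subst nth_upt) auto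
      then show ?thesis
        using that r(2) simple
        by (auto simp: weight_coord_def[of r] add_simple_def root_weight_simple pairing_simple nth_map
            weight_coord_def[of s j] simp del: upt_rec_numeral)
    qed
    then show "\<exists>r<27. \<forall>j\<in>{1..6}. weight_coord r j
        = weight_coord s j + - pairing (simple_root i) s * root_weight (simple_root i) j"
      using r(1) by blast
  qed
next
  case (reflect \<alpha> \<beta>)
  note l = roots_length[OF reflect(1)] roots_length[OF reflect(2)]
  show ?case
  proof (intro allI impI)
    fix s :: nat assume s: "s < 27"
    obtain s1 where s1: "s1 < 27"
      "\<forall>j\<in>{1..6}. weight_coord s1 j = weight_coord s j + - pairing \<alpha> s * root_weight \<alpha> j"
      using reflect s by blast
    obtain s2 where s2: "s2 < 27"
      "\<forall>j\<in>{1..6}. weight_coord s2 j = weight_coord s1 j + - pairing \<beta> s1 * root_weight \<beta> j"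
      using reflect s1(1) by blast
    obtain s3 where s3: "s3 < 27"
      "\<forall>j\<in>{1..6}. weight_coord s3 j = weight_coord s2 j + - pairing \<alpha> s2 * root_weight \<alpha> j"
      using reflect s2(1) by blast
    have p1: "pairing (reflect \<alpha> \<beta>) s = pairing \<beta> s1"
      using pairing_shift[OF s1(2), of \<beta>] by (simp add: pairing_reflect l root_form_sym)
    have p2: "pairing \<alpha> s1 = - pairing \<alpha> s"
      using pairing_shift[OF s1(2), of \<alpha>] reflect roots_norm by simp
    have p3: "pairing \<alpha> s2 = - pairing \<alpha> s - pairing \<beta> s1 * root_form \<beta> \<alpha>"
      using pairing_shift[OF s2(2), of \<alpha>] p2 by simp
    have "\<forall>j\<in>{1..6}. weight_coord s3 j
        = weight_coord s j + - pairing (reflect \<alpha> \<beta>) s * root_weight (reflect \<alpha> \<beta>) j"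
    proof
      fix j :: nat assume j: "j \<in> {1..6}"
      show "weight_coord s3 j
          = weight_coord s j + - pairing (reflect \<alpha> \<beta>) s * root_weight (reflect \<alpha> \<beta>) j"
        using bspec[OF s1(2) j] bspec[OF s2(2) j] bspec[OF s3(2) j]
        by (simp add: p1 p3 root_weight_reflect l algebra_simps)
    qed
    moreover have "pairing (reflect \<alpha> \<beta>) s \<in> {- 1, 0, 1}"
      unfolding p1 using reflect s1(1) by blast
    ultimately show "pairing (reflect \<alpha> \<beta>) s \<in> {- 1, 0, 1} \<and> (\<exists>r<27. \<forall>j\<in>{1..6}. weight_coord r j
        = weight_coord s j + - pairing (reflect \<alpha> \<beta>) s * root_weight (reflect \<alpha> \<beta>) j)"
      using s3(1) by blast
  qed
qed

lemma pairing_cases: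
  assumes "\<beta> \<in> roots" "s < 27"
  obtains "pairing \<beta> s = - 1" | "pairing \<beta> s = 0" | "pairing \<beta> s = 1"
  using weight_reflection[OF assms(1)] assms(2) by auto

lemma link_bound: "link \<beta> s r \<Longrightarrow> s < 27" "link \<beta> s r \<Longrightarrow> r < 27"
  by (simp_all add: link_def)

lemma link_pairing: "link \<beta> s r \<Longrightarrow> pairing \<alpha> r = pairing \<alpha> s + root_form \<beta> \<alpha>"
  using pairing_shift[of r s 1 \<beta> \<alpha>] by (simp add: link_def)

lemma link_pairing_source:
  assumes "\<beta> \<in> roots" "link \<beta> s r"
  shows "pairing \<beta> s = - 1"
proof -
  have "pairing \<beta> s \<in> {- 1, 0, 1}" "pairing \<beta> r \<in> {- 1, 0, 1}"
    using weight_reflection[OF assms(1)] link_bound[OF assms(2)] by blast+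
  then show ?thesis using link_pairing[OF assms(2), of \<beta>] roots_norm[OF assms(1)] by auto
qed

lemma link_pairing_target: "\<beta> \<in> roots \<Longrightarrow> link \<beta> s r \<Longrightarrow> pairing \<beta> r = 1"
  using link_pairing[of \<beta> s r \<beta>] link_pairing_source[of \<beta> s r] roots_norm[of \<beta>] by simp

lemma link_from: "\<beta> \<in> roots \<Longrightarrow> s < 27 \<Longrightarrow> pairing \<beta> s = - 1 \<Longrightarrow> \<exists>r. link \<beta> s r"
  using weight_reflection[of \<beta>] by (fastforce simp: link_def)

lemma link_to:
  assumes "\<beta> \<in> roots" "r < 27" "pairing \<beta> r = 1"
  shows "\<exists>s. link \<beta> s r"
  using weight_reflection[OF assms(1)] assms(2,3) by (fastforce simp: link_def)

lemma link_neg: "length \<beta> = 6 \<Longrightarrow> link (neg_root \<beta>) s r \<longleftrightarrow> link \<beta> r s"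
  by (auto simp: link_def root_weight_neg)

lemma link_source_unique: "link \<beta> s r \<Longrightarrow> link \<beta> s' r \<Longrightarrow> s = s'"
  by (intro weight_eqI) (auto simp: link_def)

lemma link_irrefl: "\<beta> \<in> roots \<Longrightarrow> \<not> link \<beta> s s"
  using link_pairing_source link_pairing_target by fastforce

lemma link_asym: "\<beta> \<in> roots \<Longrightarrow> link \<beta> s r \<Longrightarrow> \<not> link \<beta> r s"
  using link_pairing_source link_pairing_target by fastforce

lemma link_comp:
  assumes "length \<alpha> = 6" "length \<beta> = 6" "root_form \<beta> \<alpha> = - 1"
  shows "link \<alpha> q r \<Longrightarrow> link \<beta> s q \<Longrightarrow> link (reflect \<alpha> \<beta>) s r"
    and "link \<beta> q r \<Longrightarrow> link \<alpha> s q \<Longrightarrow> link (reflect \<alpha> \<beta>) s r"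
  using assms by (auto simp: link_def root_weight_reflect)

text \<open>
  The reflection in \<open>\<alpha>\<close>, acting on the positions of the weights.
\<close>
definition mirror :: "int list \<Rightarrow> nat \<Rightarrow> nat \<Rightarrow> bool" where
  "mirror \<alpha> s r \<longleftrightarrow> s < 27 \<and> r < 27 \<and>
     (\<forall>j\<in>{1..6}. weight_coord r j = weight_coord s j + (- pairing \<alpha> s) * root_weight \<alpha> j)"

lemma mirror_ex: "\<alpha> \<in> roots \<Longrightarrow> s < 27 \<Longrightarrow> \<exists>r. mirror \<alpha> s r"
  using weight_reflection[of \<alpha>] by (fastforce simp: mirror_def)

lemma mirror_pairing:
  assumes "mirror \<alpha> s r" "length \<alpha> = 6" "length \<beta> = 6"
  shows "pairing \<beta> r = pairing (reflect \<alpha> \<beta>) s"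
proof -
  have "\<forall>j\<in>{1..6}. weight_coord r j = weight_coord s j + - pairing \<alpha> s * root_weight \<alpha> j"
    using assms(1) by (simp add: mirror_def)
  from pairing_shift[OF this, of \<beta>] show ?thesis
    using assms by (simp add: pairing_reflect root_form_sym)
qed

lemma orthogonal_witness_simple:
  "\<forall>i\<in>set [1..<7]. \<forall>\<alpha>\<in>set positive_roots. simple_reflection i \<alpha> \<noteq> \<alpha> \<or>
     (\<exists>\<mu>\<in>set minuscule_weights. \<mu> ! (i - 1) = - 1 \<and> sum_list (map2 (*) \<alpha> \<mu>) = 0)"
  by code_simp

lemma pairing_sum_list:
  assumes "length \<beta> = 6" "r < 27"
  shows "pairing \<beta> r = sum_list (map2 (*) \<beta> (minuscule_weights ! r))"
proof -
  obtain a b c d e f where "\<beta> = [a, b, c, d, e, f]" using length6_cases[OF assms(1)] .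
  moreover obtain a b c d e f where "minuscule_weights ! r = [a, b, c, d, e, f]"
    using length6_cases[OF length_weight[OF assms(2)]] .
  ultimately show ?thesis unfolding pairing_def sum_1_6
    by (simp add: weight_coord_def coeff_at_def)
qed

text \<open>
  A weight on which \<open>\<beta>\<close> acts and that \<open>s\<^sub>\<alpha>\<close> fixes; it decides the sign with which \<open>w(\<alpha>)\<close>
  normalizes the root group of \<open>\<beta>\<close>. The statement is invariant under the Weyl group, so simple \<open>\<beta>\<close>
  suffice.
\<close>
lemma orthogonal_witness:
  assumes "\<beta> \<in> roots"
  shows "\<forall>\<alpha>\<in>roots. root_form \<alpha> \<beta> = 0 \<longrightarrow> (\<exists>s<27. pairing \<beta> s = - 1 \<and> pairing \<alpha> s = 0)"
  using assms
proof induction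
  case (simple i)
  have pos: "\<exists>s<27. pairing (simple_root i) s = - 1 \<and> pairing \<alpha> s = 0"
    if \<alpha>: "\<alpha> \<in> set positive_roots" and orth: "root_form \<alpha> (simple_root i) = 0" for \<alpha>
  proof -
    have l: "length \<alpha> = 6" using \<alpha> positive_roots_nonneg by auto
    have "i \<in> set [1..<7]" using simple by auto
    moreover have "simple_reflection i \<alpha> = \<alpha>"
      using reflect_orthogonal[of "simple_root i" \<alpha>] simple l orth by (simp add: reflect_simple)
    ultimately obtain \<mu> where \<mu>: "\<mu> \<in> set minuscule_weights" "\<mu> ! (i - 1) = - 1"
      "sum_list (map2 (*) \<alpha> \<mu>) = 0"
      using orthogonal_witness_simple \<alpha> by blast
    then obtain s where "s < 27" "\<mu> = minuscule_weights ! s"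
      by (auto simp: in_set_conv_nth length_minuscule_weights)
    then show ?thesis using \<mu> l simple
      by (auto simp: pairing_simple weight_coord_def pairing_sum_list)
  qed
  show ?case
  proof (intro ballI impI)
    fix \<alpha> assume \<alpha>: "\<alpha> \<in> roots" "root_form \<alpha> (simple_root i) = 0"
    show "\<exists>s<27. pairing (simple_root i) s = - 1 \<and> pairing \<alpha> s = 0"
    proof (cases "\<alpha> \<in> set positive_roots")
      case False
      then show ?thesis
        using pos[of "neg_root \<alpha>"] \<alpha> root_negative[OF \<alpha>(1)] roots_length[OF \<alpha>(1)]
        by (auto simp: pairing_neg root_form_neg_left)
    qed (use pos \<alpha> in auto)
  qed
next
  case (reflect \<gamma> \<beta>)
  note l = roots_length[OF reflect(1)] roots_length[OF reflect(2)]
  note n = roots_norm[OF reflect(1)]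
  show ?case
  proof (intro ballI impI)
    fix \<alpha> assume \<alpha>: "\<alpha> \<in> roots" "root_form \<alpha> (reflect \<gamma> \<beta>) = 0"
    note la = roots_length[OF \<alpha>(1)]
    have "root_form (reflect \<gamma> \<alpha>) \<beta> = root_form (reflect \<gamma> (reflect \<gamma> \<alpha>)) (reflect \<gamma> \<beta>)"
      using l la n by (simp add: root_form_isometry)
    then have "root_form (reflect \<gamma> \<alpha>) \<beta> = 0" using \<alpha>(2) l la n by (simp add: reflect_reflect)
    then obtain s where s: "s < 27" "pairing \<beta> s = - 1" "pairing (reflect \<gamma> \<alpha>) s = 0"
      using reflect \<alpha>(1) roots.reflect by metis
    obtain r where r: "mirror \<gamma> s r" using mirror_ex[OF reflect(1) s(1)] ..
    then have "pairing (reflect \<gamma> \<beta>) r = - 1" "pairing \<alpha> r = 0"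
      using mirror_pairing[OF r l(1), of "reflect \<gamma> \<beta>"] mirror_pairing[OF r l(1) la] s l n
      by (simp_all add: reflect_reflect)
    then show "\<exists>s<27. pairing (reflect \<gamma> \<beta>) s = - 1 \<and> pairing \<alpha> s = 0"
      using r by (auto simp: mirror_def)
  qed
qed

lemma mirror_cases:
  assumes \<alpha>: "\<alpha> \<in> roots" and m: "mirror \<alpha> s r"
  obtains "pairing \<alpha> s = - 1" "link \<alpha> s r" | "pairing \<alpha> s = 0" "r = s" | "pairing \<alpha> s = 1" "link \<alpha> r s"
proof -
  have "s < 27" using m by (simp add: mirror_def)
  from \<alpha> this show ?thesis
  proof (cases rule: pairing_cases)
    case 1
    then show ?thesis using m that by (simp add: mirror_def link_def)
  next
    case 2
    then have "r = s" using m by (intro weight_eqI) (auto simp: mirror_def)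
    with 2 show ?thesis using that by simp
  next
    case 3
    then show ?thesis using m that by (simp add: mirror_def link_def)
  qed
qed

text \<open>
  The grading that cuts out the parabolic subgroup: a root vector raises the level by the coefficient
  of the root on the second simple root.
\<close>
abbreviation level :: "nat \<Rightarrow> int" where
  "level r \<equiv> pairing highest_root r"

lemma highest_root_roots: "highest_root \<in> roots"
  using highest_root_positive positive_roots_subset_roots by auto

lemma link_level: "\<beta> \<in> roots \<Longrightarrow> link \<beta> s r \<Longrightarrow> level r = level s + coeff_at \<beta> 2"
  using link_pairing[of \<beta> s r highest_root] root_form_highest[of \<beta>] roots_length[of \<beta>]
  by (simp add: root_form_sym)

section \<open>The root subgroups as elementary row operations\<close>

lemma mirror_sym:
  assumes "\<alpha> \<in> roots" "mirror \<alpha> s r" shows "mirror \<alpha> r s"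
proof -
  have "pairing \<alpha> r = - pairing \<alpha> s"
    using mirror_pairing[OF assms(2), of \<alpha>] assms(1)
    by (simp add: reflect_self roots_length roots_norm pairing_neg)
  then show ?thesis using assms(2) by (auto simp: mirror_def)
qed

lemma mirror_unique: "mirror \<alpha> s r \<Longrightarrow> mirror \<alpha> s r' \<Longrightarrow> r = r'"
  by (intro weight_eqI) (auto simp: mirror_def)

lemma link_coord:
  "link \<beta> s r \<Longrightarrow> j \<in> {1..6} \<Longrightarrow> weight_coord r j = weight_coord s j + root_weight \<beta> j"
  by (simp add: link_def)

lemma mirror_coord:
  "mirror \<alpha> s r \<Longrightarrow> j \<in> {1..6} \<Longrightarrow>
     weight_coord r j = weight_coord s j + (- pairing \<alpha> s) * root_weight \<alpha> j"
  by (simp add: mirror_def)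

lemma mirror_link:
  assumes "length \<alpha> = 6" "length \<beta> = 6" "link \<beta> p r" "mirror \<alpha> p p'" "mirror \<alpha> r r'"
  shows "link (reflect \<alpha> \<beta>) p' r'"
proof -
  have "weight_coord r' j = weight_coord p' j + root_weight (reflect \<alpha> \<beta>) j" if "j \<in> {1..6}" for j
    using link_coord[OF assms(3) that] mirror_coord[OF assms(4) that] mirror_coord[OF assms(5) that]
      link_pairing[OF assms(3), of \<alpha>] assms(1,2)
    by (simp add: root_weight_reflect algebra_simps)
  then show ?thesis using assms by (simp add: mirror_def link_def)
qed

lemma mult_entry:
  assumes "A \<in> carrier_mat 27 27" "B \<in> carrier_mat 27 27" "r < 27" "s < 27"
  shows "(A * B) $$ (r, s) = (\<Sum>p<27. A $$ (r, p) * B $$ (p, s))"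
  using assms by (simp add: scalar_prod_def atLeast0LessThan)

lemma mult_entry_single:
  assumes "A \<in> carrier_mat 27 27" "B \<in> carrier_mat 27 27" "r < 27" "s < 27" "q < 27"
    and "\<And>p. p < 27 \<Longrightarrow> p \<noteq> q \<Longrightarrow> A $$ (r, p) = 0 \<or> B $$ (p, s) = (0::'a::field)"
  shows "(A * B) $$ (r, s) = A $$ (r, q) * B $$ (q, s)"
proof -
  have "(\<Sum>p<27. A $$ (r, p) * B $$ (p, s)) = (\<Sum>p\<in>{q}. A $$ (r, p) * B $$ (p, s))"
    using assms(5,6) by (intro sum.mono_neutral_right) auto
  then show ?thesis by (simp add: mult_entry[OF assms(1-4)])
qed

lemma mult_entry_pair:
  assumes "A \<in> carrier_mat 27 27" "B \<in> carrier_mat 27 27" "r < 27" "s < 27" "q < 27" "q' < 27" "q \<noteq> q'"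
    and "\<And>p. p < 27 \<Longrightarrow> p \<noteq> q \<Longrightarrow> p \<noteq> q' \<Longrightarrow> A $$ (r, p) = 0 \<or> B $$ (p, s) = (0::'a::field)"
  shows "(A * B) $$ (r, s) = A $$ (r, q) * B $$ (q, s) + A $$ (r, q') * B $$ (q', s)"
proof -
  have "(\<Sum>p<27. A $$ (r, p) * B $$ (p, s)) = (\<Sum>p\<in>{q, q'}. A $$ (r, p) * B $$ (p, s))"
    using assms(5,6,8) by (intro sum.mono_neutral_right) auto
  then show ?thesis using assms(7) by (simp add: mult_entry[OF assms(1-4)])
qed

lemma mat27_eqI:
  assumes "A \<in> carrier_mat 27 27" "B \<in> carrier_mat 27 27"
    "\<And>r s. r < 27 \<Longrightarrow> s < 27 \<Longrightarrow> A $$ (r, s) = B $$ (r, s)"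
  shows "A = B"
  using assms by (intro eq_matI) auto

locale chevalley =
  fixes x :: "int list \<Rightarrow> 'a::field_char_0 \<Rightarrow> 'a mat"
  assumes chevalley: "chevalley_system x"
begin

definition entry :: "int list \<Rightarrow> nat \<Rightarrow> nat \<Rightarrow> 'a" where
  "entry \<beta> r s = x \<beta> 1 $$ (r, s)"

text \<open>
  Left multiplication by \<open>x \<beta> t\<close> adds \<open>\<plusminus> t\<close> times row \<open>s\<close> to row \<open>r\<close> for every link from \<open>s\<close> to
  \<open>r\<close>. The signs are those of the Chevalley system.
\<close>
definition row_operation :: "int list \<Rightarrow> bool" where
  "row_operation \<beta> \<longleftrightarrow>
     (\<forall>t. x \<beta> t \<in> carrier_mat 27 27 \<and> (\<forall>r<27. \<forall>s<27. x \<beta> t $$ (r, s) =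
        (if r = s then 1 else if link \<beta> s r then t * entry \<beta> r s else 0))) \<and>
     (\<forall>s r. link \<beta> s r \<longrightarrow> entry \<beta> r s = 1 \<or> entry \<beta> r s = - 1)"

abbreviation w :: "int list \<Rightarrow> 'a mat" where "w \<equiv> weyl_rep x"

lemma x_simple: "i \<in> {1..6} \<Longrightarrow> x (simple_root i) t = 1\<^sub>m 27 + t \<cdot>\<^sub>m raising i"
  and x_neg_simple: "i \<in> {1..6} \<Longrightarrow> x (neg_root (simple_root i)) t = 1\<^sub>m 27 + t \<cdot>\<^sub>m lowering i"
  using chevalley unfolding chevalley_system_def by blast+

lemma weyl_axiom:
  assumes "\<alpha> \<in> roots" "\<beta> \<in> roots"
  shows "\<exists>\<epsilon>. (\<epsilon> = 1 \<or> \<epsilon> = - 1) \<and> (\<forall>t. w \<alpha> * x \<beta> t = x (reflect \<alpha> \<beta>) (\<epsilon> * t) * w \<alpha>)"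
proof -
  have "\<forall>\<alpha>\<in>roots. \<forall>\<beta>\<in>roots. \<exists>\<epsilon>\<in>{1, - 1}. \<forall>t.
      w \<alpha> * x \<beta> t = x (reflect \<alpha> \<beta>) (\<epsilon> * t) * w \<alpha>"
    using chevalley unfolding chevalley_system_def by (elim conjE)
  from bspec[OF bspec[OF this assms(1)] assms(2)] obtain \<epsilon> where "\<epsilon> \<in> {1, - 1}"
    "\<forall>t. w \<alpha> * x \<beta> t = x (reflect \<alpha> \<beta>) (\<epsilon> * t) * w \<alpha>" ..
  then show ?thesis by (intro exI[of _ \<epsilon>]) simp
qed

text \<open>
  For simple roots the size of the matrices is part of the definition of a Chevalley system. The
  conjugation axiom for a simple \<open>\<alpha>\<close> compares row numbers for \<open>s\<^sub>\<alpha> \<beta>\<close> and column numbers for \<open>\<beta>\<close>.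
\<close>
lemma x_carrier:
  assumes \<beta>: "\<beta> \<in> roots" shows "x \<beta> t \<in> carrier_mat 27 27"
proof -
  define \<sigma> where "\<sigma> = simple_root 1"
  have \<sigma>: "\<sigma> \<in> roots" unfolding \<sigma>_def by (rule roots.simple) simp
  have "(1::nat) \<in> {1..6}" by simp
  note simples = x_simple[OF this, folded \<sigma>_def] x_neg_simple[OF this, folded \<sigma>_def]
  have dim: "dim_row (w \<sigma>) = 27" "dim_col (w \<sigma>) = 27"
    unfolding weyl_rep_def simples by (simp_all add: raising_def lowering_def)
  have row: "dim_row (x (reflect \<sigma> \<gamma>) s) = 27" if \<gamma>: "\<gamma> \<in> roots" for \<gamma> s
  proof -
    obtain \<epsilon> where \<epsilon>: "(\<epsilon> = 1 \<or> \<epsilon> = - 1) \<and> (\<forall>t. w \<sigma> * x \<gamma> t = x (reflect \<sigma> \<gamma>) (\<epsilon> * t) * w \<sigma>)"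
      using weyl_axiom[OF \<sigma> \<gamma>] ..
    have s: "\<epsilon> * (\<epsilon> * s) = s" using conjunct1[OF \<epsilon>] by auto
    have "w \<sigma> * x \<gamma> (\<epsilon> * s) = x (reflect \<sigma> \<gamma>) s * w \<sigma>"
      using spec[OF conjunct2[OF \<epsilon>], of "\<epsilon> * s"] unfolding s .
    from arg_cong[OF this, of dim_row] show ?thesis using dim by simp
  qed
  obtain \<epsilon> where \<epsilon>: "(\<epsilon> = 1 \<or> \<epsilon> = - 1) \<and> (\<forall>t. w \<sigma> * x \<beta> t = x (reflect \<sigma> \<beta>) (\<epsilon> * t) * w \<sigma>)"
    using weyl_axiom[OF \<sigma> \<beta>] ..
  from arg_cong[OF spec[OF conjunct2[OF this], of t], of dim_col]
  have "dim_col (x \<beta> t) = 27" using dim by simp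
  moreover have "reflect \<sigma> (reflect \<sigma> \<beta>) = \<beta>"
    using roots_length[OF \<sigma>] roots_length[OF \<beta>] roots_norm[OF \<sigma>] by (rule reflect_reflect)
  then have "dim_row (x \<beta> t) = 27" using row[OF roots.reflect[OF \<sigma> \<beta>], of t] by simp
  ultimately show ?thesis by (intro carrier_matI)
qed

lemma weyl_carrier:
  assumes "\<alpha> \<in> roots" shows "w \<alpha> \<in> carrier_mat 27 27"
  unfolding weyl_rep_def
  using mult_carrier_mat[OF mult_carrier_mat[OF x_carrier[OF assms] x_carrier[OF neg_root_roots[OF assms]]]
      x_carrier[OF assms]] .

lemma entry_sign: "row_operation \<beta> \<Longrightarrow> link \<beta> s r \<Longrightarrow> entry \<beta> r s = 1 \<or> entry \<beta> r s = - 1"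
  by (auto simp: row_operation_def)

lemma x_entry:
  "row_operation \<beta> \<Longrightarrow> r < 27 \<Longrightarrow> s < 27 \<Longrightarrow>
    x \<beta> t $$ (r, s) = (if r = s then 1 else if link \<beta> s r then t * entry \<beta> r s else 0)"
  by (simp add: row_operation_def)

lemma x_mult_link:
  assumes g: "row_operation \<beta>" and \<beta>: "\<beta> \<in> roots" and l: "link \<beta> q r"
    and X: "X \<in> carrier_mat 27 27" and s: "s < 27"
  shows "(x \<beta> t * X) $$ (r, s) = X $$ (r, s) + t * entry \<beta> r q * X $$ (q, s)"
proof -
  have b: "q < 27" "r < 27" using link_bound[OF l] by simp_all
  have ne: "r \<noteq> q" using l \<beta> link_irrefl by blast
  have "x \<beta> t $$ (r, p) = 0" if "p < 27" "p \<noteq> r" "p \<noteq> q" for p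
    using that b link_source_unique[OF l, of p] x_entry[OF g b(2) that(1)] by auto
  then have "(x \<beta> t * X) $$ (r, s) = x \<beta> t $$ (r, r) * X $$ (r, s) + x \<beta> t $$ (r, q) * X $$ (q, s)"
    using mult_entry_pair[OF x_carrier[OF \<beta>] X b(2) s b(2) b(1) ne] by blast
  then show ?thesis using x_entry[OF g b(2) b(2)] x_entry[OF g b(2) b(1)] ne l by simp
qed

lemma x_mult_other:
  assumes g: "row_operation \<beta>" and \<beta>: "\<beta> \<in> roots" and p: "pairing \<beta> r \<noteq> 1"
    and X: "X \<in> carrier_mat 27 27" and b: "r < 27" "s < 27"
  shows "(x \<beta> t * X) $$ (r, s) = X $$ (r, s)"
proof -
  have "x \<beta> t $$ (r, q) = 0" if "q < 27" "q \<noteq> r" for q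
    using that link_pairing_target[OF \<beta>, of q r] p x_entry[OF g b(1) that(1)] by auto
  then have "(x \<beta> t * X) $$ (r, s) = x \<beta> t $$ (r, r) * X $$ (r, s)"
    using mult_entry_single[OF x_carrier[OF \<beta>] X b b(1)] by blast
  then show ?thesis using x_entry[OF g b(1) b(1)] by simp
qed

lemma row_operation_simple:
  assumes i: "i \<in> {1..6}"
  shows "row_operation (simple_root i)" "row_operation (neg_root (simple_root i))"
proof -
  have add: "minuscule_weights ! r = add_simple k i (minuscule_weights ! s) \<longleftrightarrow>
      (\<forall>j\<in>{1..6}. weight_coord r j = weight_coord s j + k * cartan i j)" if "r < 27" for r s k
  proof
    assume e: "minuscule_weights ! r = add_simple k i (minuscule_weights ! s)"
    show "\<forall>j\<in>{1..6}. weight_coord r j = weight_coord s j + k * cartan i j"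
    proof
      fix j :: nat assume "j \<in> {1..6}"
      moreover from this have "[1..<7] ! (j - 1) = j" by (subst nth_upt) auto
      ultimately show "weight_coord r j = weight_coord s j + k * cartan i j"
        by (auto simp: weight_coord_def e add_simple_def nth_map simp del: upt_rec_numeral)
    qed
  next
    assume e: "\<forall>j\<in>{1..6}. weight_coord r j = weight_coord s j + k * cartan i j"
    show "minuscule_weights ! r = add_simple k i (minuscule_weights ! s)"
    proof (rule nth_equalityI)
      show "length (minuscule_weights ! r) = length (add_simple k i (minuscule_weights ! s))"
        using that by (simp add: length_weight add_simple_def)
      fix j assume "j < length (minuscule_weights ! r)"
      then have j: "j < 6" using that by (simp add: length_weight)
      then have "[1..<7] ! j = Suc j" by (subst nth_upt) auto
      then show "minuscule_weights ! r ! j = add_simple k i (minuscule_weights ! s) ! j"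
        using bspec[OF e, of "Suc j"] j
        by (simp add: weight_coord_def add_simple_def nth_map del: upt_rec_numeral)
    qed
  qed
  have up: "minuscule_weights ! r = add_simple 1 i (minuscule_weights ! s) \<longleftrightarrow> link (simple_root i) s r"
    and down: "minuscule_weights ! r = add_simple (- 1) i (minuscule_weights ! s)
        \<longleftrightarrow> link (neg_root (simple_root i)) s r"
    if "r < 27" "s < 27" for r s
    using add[OF that(1)] that i
    by (auto simp: link_def root_weight_simple root_weight_neg simp del: atLeastAtMost_iff)
  have s: "simple_root i \<in> roots" "neg_root (simple_root i) \<in> roots"
    using roots.simple[OF i] neg_root_roots by auto
  show "row_operation (simple_root i)"
    using i s link_irrefl[OF s(1)]
    by (auto simp: row_operation_def x_simple entry_def raising_def up link_bound)
  show "row_operation (neg_root (simple_root i))"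
    using i s link_irrefl[OF s(2)]
    by (auto simp: row_operation_def x_neg_simple entry_def lowering_def down link_bound)
qed

lemma mult_assoc27:
  "A \<in> carrier_mat 27 27 \<Longrightarrow> B \<in> carrier_mat 27 27 \<Longrightarrow> C \<in> carrier_mat 27 27 \<Longrightarrow>
    (A * B) * C = A * (B * C :: 'a mat)"
  by (rule assoc_mult_mat)

lemma mult_carrier27:
  "A \<in> carrier_mat 27 27 \<Longrightarrow> B \<in> carrier_mat 27 27 \<Longrightarrow> A * B \<in> carrier_mat 27 27"
  by (rule mult_carrier_mat)

lemma weyl_product:
  assumes "\<alpha> \<in> roots" "X \<in> carrier_mat 27 27"
  shows "w \<alpha> * X = x \<alpha> 1 * (x (neg_root \<alpha>) (- 1) * (x \<alpha> 1 * X))"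
  unfolding weyl_rep_def
  using assms x_carrier[OF assms(1)] x_carrier[OF neg_root_roots[OF assms(1)]]
  by (simp add: mult_assoc27 mult_carrier27 del: assoc_mult_mat)

text \<open>
  Let \<open>a\<close> and \<open>a'\<close> be the two entries. On the linked pair of basis vectors, the relation
  \<open>w(\<alpha>) x\<^sub>\<alpha>(1) = x\<^sub>-\<^sub>\<alpha>(\<plusminus>1) w(\<alpha>)\<close> gives \<open>a (1 - a a') = 0\<close>. For \<open>a a' = -1\<close> the element \<open>w(\<alpha>)\<close> would
  not be monomial.
\<close>
lemma entry_neg_prod:
  assumes \<alpha>: "\<alpha> \<in> roots" and g: "row_operation \<alpha>" "row_operation (neg_root \<alpha>)" and l: "link \<alpha> q r"
  shows "entry \<alpha> r q * entry (neg_root \<alpha>) q r = 1"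
proof -
  let ?n = "neg_root \<alpha>"
  have n: "?n \<in> roots" using neg_root_roots[OF \<alpha>] .
  have ln: "link ?n r q" using l link_neg[OF roots_length[OF \<alpha>]] by simp
  have b: "q < 27" "r < 27" using link_bound[OF l] by auto
  have p: "pairing \<alpha> q = - 1" "pairing \<alpha> r = 1" "pairing ?n r = - 1"
    using l link_pairing_source[OF \<alpha> l] link_pairing_target[OF \<alpha> l] roots_length[OF \<alpha>]
    by (simp_all add: pairing_neg)
  note c = x_carrier[OF \<alpha>] x_carrier[OF n] mult_carrier27
  have row: "(w \<alpha> * X) $$ (r, q) = X $$ (r, q) + entry \<alpha> r q * X $$ (q, q)
      + entry \<alpha> r q * (X $$ (q, q) - entry ?n q r * (X $$ (r, q) + entry \<alpha> r q * X $$ (q, q)))"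
    if X: "X \<in> carrier_mat 27 27" for X
    unfolding weyl_product[OF \<alpha> X] using b X
    by (simp add: x_mult_link[OF g(1) \<alpha> l] x_mult_link[OF g(2) n ln] x_mult_other[OF g(2) n]
        x_mult_other[OF g(1) \<alpha>] p c)
  obtain \<epsilon> where "(\<epsilon> = 1 \<or> \<epsilon> = - 1) \<and> (\<forall>t. w \<alpha> * x \<alpha> t = x (reflect \<alpha> \<alpha>) (\<epsilon> * t) * w \<alpha>)"
    using weyl_axiom[OF \<alpha> \<alpha>] ..
  then have e: "w \<alpha> * x \<alpha> 1 = x ?n \<epsilon> * w \<alpha>"
    using reflect_self[OF roots_length[OF \<alpha>] roots_norm[OF \<alpha>]] by simp
  have one: "1\<^sub>m 27 \<in> carrier_mat 27 27" by simp
  have "(w \<alpha> * x \<alpha> 1) $$ (r, q) = (w \<alpha> * 1\<^sub>m 27) $$ (r, q)"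
    unfolding e using x_mult_other[OF g(2) n, of r "w \<alpha>" q \<epsilon>] p b weyl_carrier[OF \<alpha>] by simp
  moreover have "x \<alpha> 1 $$ (r, q) = entry \<alpha> r q" "x \<alpha> 1 $$ (q, q) = 1" "r \<noteq> q"
    using l b link_irrefl[OF \<alpha>] by (auto simp: x_entry[OF g(1)])
  ultimately have "entry \<alpha> r q = entry \<alpha> r q * (entry ?n q r * entry \<alpha> r q)"
    using row[OF x_carrier[OF \<alpha>], of 1] row[OF one] b
    by (simp add: algebra_simps)
  moreover have "entry \<alpha> r q \<noteq> 0" using entry_sign[OF g(1) l] by auto
  ultimately show ?thesis by (simp add: mult.commute)
qed

lemma entry_neg:
  assumes "\<alpha> \<in> roots" "row_operation \<alpha>" "row_operation (neg_root \<alpha>)" "link \<alpha> q r"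
  shows "entry (neg_root \<alpha>) q r = entry \<alpha> r q"
  using entry_neg_prod[OF assms] entry_sign[OF assms(2,4)] by (auto simp: minus_equation_iff)

text \<open>
  The nonzero entries of \<open>w(\<alpha>)\<close>, which is a signed permutation matrix for the reflection in \<open>\<alpha>\<close>.
\<close>
definition weyl_entry :: "int list \<Rightarrow> nat \<Rightarrow> nat \<Rightarrow> 'a" where
  "weyl_entry \<alpha> r s =
     (if link \<alpha> s r then entry \<alpha> r s else if link \<alpha> r s then - entry \<alpha> s r else 1)"

text \<open>
  On a linked pair of rows this is a product of three unitriangular 2 by 2 matrices, in which the
  entries of \<open>\<alpha>\<close> and \<open>-\<alpha>\<close> are the same sign.
\<close>
lemma weyl_row:
  assumes \<alpha>: "\<alpha> \<in> roots" and g: "row_operation \<alpha>" "row_operation (neg_root \<alpha>)"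
    and m: "mirror \<alpha> r q" and X: "X \<in> carrier_mat 27 27" and s: "s < 27"
  shows "(w \<alpha> * X) $$ (r, s) = weyl_entry \<alpha> r q * X $$ (q, s)"
proof -
  let ?n = "neg_root \<alpha>"
  have n: "?n \<in> roots" using neg_root_roots[OF \<alpha>] .
  note c = x_carrier[OF \<alpha>] x_carrier[OF n] mult_carrier27
  have pn: "pairing ?n i = - pairing \<alpha> i" for i using pairing_neg roots_length[OF \<alpha>] by simp
  have linked: "(w \<alpha> * X) $$ (j, s) = entry \<alpha> j i * X $$ (i, s)"
      "(w \<alpha> * X) $$ (i, s) = - entry \<alpha> j i * X $$ (j, s)" if l: "link \<alpha> i j" for i j
  proof -
    have ln: "link ?n j i" using l link_neg roots_length[OF \<alpha>] by simp
    have b: "i < 27" "j < 27" using link_bound[OF l] by auto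
    have p: "pairing \<alpha> i = - 1" "pairing \<alpha> j = 1"
      using link_pairing_source[OF \<alpha> l] link_pairing_target[OF \<alpha> l] by auto
    have sq: "entry \<alpha> j i * entry \<alpha> j i = 1"
      using entry_sign[OF g(1) l] by auto
    note rows = x_mult_link[OF g(1) \<alpha> l] x_mult_link[OF g(2) n ln] x_mult_other[OF g(2) n]
        x_mult_other[OF g(1) \<alpha>]
    show "(w \<alpha> * X) $$ (j, s) = entry \<alpha> j i * X $$ (i, s)"
      unfolding weyl_product[OF \<alpha> X] using b s X
      by (simp add: rows pn p c entry_neg[OF \<alpha> g l] algebra_simps sq)
    show "(w \<alpha> * X) $$ (i, s) = - entry \<alpha> j i * X $$ (j, s)"
      unfolding weyl_product[OF \<alpha> X] using b s X
      by (simp add: rows pn p c entry_neg[OF \<alpha> g l] algebra_simps sq)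
  qed
  from \<alpha> m show ?thesis
  proof (cases rule: mirror_cases)
    case 1
    then show ?thesis using linked(2)[of r q] link_asym[OF \<alpha>, of r q] by (simp add: weyl_entry_def)
  next
    case 2
    have "r < 27" using m by (simp add: mirror_def)
    with 2 have "(w \<alpha> * X) $$ (r, s) = X $$ (r, s)"
      unfolding weyl_product[OF \<alpha> X] using s X
      by (simp add: x_mult_other[OF g(2) n] x_mult_other[OF g(1) \<alpha>] pn c)
    then show ?thesis using 2 link_irrefl[OF \<alpha>] by (simp add: weyl_entry_def)
  next
    case 3
    then show ?thesis using linked(1)[of q r] by (simp add: weyl_entry_def)
  qed
qed

lemma weyl_matrix:
  assumes \<alpha>: "\<alpha> \<in> roots" and g: "row_operation \<alpha>" "row_operation (neg_root \<alpha>)"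
    and b: "r < 27" "s < 27"
  shows "w \<alpha> $$ (r, s) = (if mirror \<alpha> r s then weyl_entry \<alpha> r s else 0)"
proof -
  obtain q where q: "mirror \<alpha> r q" using mirror_ex[OF \<alpha> b(1)] ..
  then have "q < 27" by (simp add: mirror_def)
  then have "w \<alpha> $$ (r, s) = weyl_entry \<alpha> r q * 1\<^sub>m 27 $$ (q, s)"
    using weyl_row[OF \<alpha> g q, of "1\<^sub>m 27" s] weyl_carrier[OF \<alpha>] b by simp
  moreover have "mirror \<alpha> r s \<longleftrightarrow> s = q" using q mirror_unique by blast
  ultimately show ?thesis using \<open>q < 27\<close> b by simp
qed

lemma weyl_column:
  assumes \<alpha>: "\<alpha> \<in> roots" and g: "row_operation \<alpha>" "row_operation (neg_root \<alpha>)"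
    and m: "mirror \<alpha> q s" and X: "X \<in> carrier_mat 27 27" and r: "r < 27"
  shows "(X * w \<alpha>) $$ (r, s) = X $$ (r, q) * weyl_entry \<alpha> q s"
proof -
  have b: "q < 27" "s < 27" using m by (auto simp: mirror_def)
  have "w \<alpha> $$ (p, s) = 0" if "p < 27" "p \<noteq> q" for p
  proof -
    have "\<not> mirror \<alpha> p s"
      using mirror_unique[OF mirror_sym[OF \<alpha> m]] mirror_sym[OF \<alpha>, of p s] that(2) by blast
    then show ?thesis using weyl_matrix[OF \<alpha> g that(1) b(2)] by simp
  qed
  then have "(X * w \<alpha>) $$ (r, s) = X $$ (r, q) * w \<alpha> $$ (q, s)"
    using mult_entry_single[OF X weyl_carrier[OF \<alpha>] r b(2) b(1)] by blast
  then show ?thesis using weyl_matrix[OF \<alpha> g b] m by simp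
qed

lemma weyl_entry_sign:
  assumes "\<alpha> \<in> roots" "row_operation \<alpha>"
  shows "weyl_entry \<alpha> r s = 1 \<or> weyl_entry \<alpha> r s = - 1"
  using entry_sign[OF assms(2), of s r] entry_sign[OF assms(2), of r s]
  by (auto simp: weyl_entry_def minus_equation_iff)

lemma weyl_conjugate_entry:
  assumes \<alpha>: "\<alpha> \<in> roots" and \<beta>: "\<beta> \<in> roots"
    and g: "row_operation \<alpha>" "row_operation (neg_root \<alpha>)"
    and eq: "w \<alpha> * x \<beta> t = X * w \<alpha>" and X: "X \<in> carrier_mat 27 27"
    and m: "mirror \<alpha> p p'" "mirror \<alpha> r r'"
  shows "X $$ (r', p') = weyl_entry \<alpha> r' r * x \<beta> t $$ (r, p) * weyl_entry \<alpha> p' p"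
proof -
  have b: "p < 27" "p' < 27" "r' < 27" using m by (auto simp: mirror_def)
  have "X $$ (r', p') * weyl_entry \<alpha> p' p = (X * w \<alpha>) $$ (r', p)"
    using weyl_column[OF \<alpha> g mirror_sym[OF \<alpha> m(1)] X b(3)] by simp
  also have "\<dots> = weyl_entry \<alpha> r' r * x \<beta> t $$ (r, p)"
    unfolding eq[symmetric] using weyl_row[OF \<alpha> g mirror_sym[OF \<alpha> m(2)] x_carrier[OF \<beta>] b(1)] by simp
  finally have "X $$ (r', p') * (weyl_entry \<alpha> p' p * weyl_entry \<alpha> p' p)
      = weyl_entry \<alpha> r' r * x \<beta> t $$ (r, p) * weyl_entry \<alpha> p' p"
    by (simp add: mult.assoc[symmetric])
  moreover have "weyl_entry \<alpha> p' p * weyl_entry \<alpha> p' p = 1"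
    using weyl_entry_sign[OF \<alpha> g(1), of p' p] by auto
  ultimately show ?thesis by simp
qed

text \<open>
  Conjugation by a signed permutation matrix only moves and changes the signs of the entries.
\<close>
lemma row_operation_reflect:
  assumes \<alpha>: "\<alpha> \<in> roots" and \<beta>: "\<beta> \<in> roots"
    and g: "row_operation \<alpha>" "row_operation (neg_root \<alpha>)" "row_operation \<beta>"
  shows "row_operation (reflect \<alpha> \<beta>)"
proof -
  let ?\<gamma> = "reflect \<alpha> \<beta>"
  note l = roots_length[OF \<alpha>] roots_length[OF \<beta>]
  have \<gamma>: "?\<gamma> \<in> roots" using \<alpha> \<beta> by (rule roots.reflect)
  obtain \<epsilon> where e: "(\<epsilon> = 1 \<or> \<epsilon> = - 1) \<and> (\<forall>t. w \<alpha> * x \<beta> t = x ?\<gamma> (\<epsilon> * t) * w \<alpha>)"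
    using weyl_axiom[OF \<alpha> \<beta>] ..
    note \<epsilon> = conjunct1[OF e] spec[OF conjunct2[OF e]]
  have "\<epsilon> * (\<epsilon> * t) = t" for t using \<epsilon>(1) by auto
  then have "w \<alpha> * x \<beta> (\<epsilon> * t) = x ?\<gamma> t * w \<alpha>" for t by (simp only: \<epsilon>(2))
  note en = weyl_conjugate_entry[OF \<alpha> \<beta> g(1,2) this x_carrier[OF \<gamma>]]
  note sgn = weyl_entry_sign[OF \<alpha> g(1)]
  have diag: "x ?\<gamma> t $$ (r', r') = 1" if r': "r' < 27" for r' t
  proof -
    obtain r where "mirror \<alpha> r' r" using mirror_ex[OF \<alpha> r'] ..
    then have m: "mirror \<alpha> r r'" "r < 27" using mirror_sym[OF \<alpha>] by (auto simp: mirror_def)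
    show ?thesis using en[OF m(1) m(1)] sgn[of r' r] m(2) g(3) by (auto simp: x_entry)
  qed
  have on: "x ?\<gamma> t $$ (r', p') = t * entry ?\<gamma> r' p' \<and> (entry ?\<gamma> r' p' = 1 \<or> entry ?\<gamma> r' p' = - 1)"
    if lk: "link ?\<gamma> p' r'" for r' p' t
  proof -
    obtain r p where "mirror \<alpha> r' r" "mirror \<alpha> p' p"
      using mirror_ex[OF \<alpha>] link_bound[OF lk] by metis
    then have m: "mirror \<alpha> r r'" "mirror \<alpha> p p'" "mirror \<alpha> r' r" "mirror \<alpha> p' p" "r < 27" "p < 27"
      using mirror_sym[OF \<alpha>] by (auto simp: mirror_def)
    have lk': "link \<beta> p r"
      using mirror_link[OF l(1) _ lk m(4) m(3)] l by (simp add: reflect_reflect roots_norm[OF \<alpha>])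
    then have "r \<noteq> p" using link_irrefl[OF \<beta>] by auto
    then have *: "x ?\<gamma> t $$ (r', p')
        = weyl_entry \<alpha> r' r * (\<epsilon> * t * entry \<beta> r p) * weyl_entry \<alpha> p' p" for t
      using en[OF m(2) m(1)] lk' m g(3) by (simp add: x_entry)
    from *[of 1] have "entry ?\<gamma> r' p' = weyl_entry \<alpha> r' r * (\<epsilon> * entry \<beta> r p) * weyl_entry \<alpha> p' p"
      by (simp add: entry_def)
    then show ?thesis
      using *[of t] sgn[of r' r] sgn[of p' p] \<epsilon>(1) entry_sign[OF g(3) lk'] by auto
  qed
  have off: "x ?\<gamma> t $$ (r', p') = 0" if lk: "\<not> link ?\<gamma> p' r'" and b: "r' < 27" "p' < 27" "r' \<noteq> p'" for r' p' t
  proof -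
    obtain r p where "mirror \<alpha> r' r" "mirror \<alpha> p' p"
      using mirror_ex[OF \<alpha>] b by metis
    then have m: "mirror \<alpha> r r'" "mirror \<alpha> p p'" "r < 27" "p < 27"
      using mirror_sym[OF \<alpha>] by (auto simp: mirror_def)
    have "\<not> link \<beta> p r" using mirror_link[OF l _ m(2,1)] lk by blast
    moreover have "r \<noteq> p" using m(1,2) b(3) mirror_unique by blast
    ultimately show ?thesis using en[OF m(2) m(1)] m g(3) by (simp add: x_entry)
  qed
  show ?thesis
    unfolding row_operation_def using x_carrier[OF \<gamma>] diag on off by auto
qed

lemma row_operation_roots:
  assumes "\<beta> \<in> roots" shows "row_operation \<beta>"
proof -
  have "row_operation \<beta> \<and> row_operation (neg_root \<beta>)"
    using assms
  proof induction
    case (simple i)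
    then show ?case using row_operation_simple by blast
  next
    case (reflect \<alpha> \<beta>)
    then show ?case
      using row_operation_reflect[of \<alpha> \<beta>] row_operation_reflect[of \<alpha> "neg_root \<beta>"] neg_root_roots[of \<beta>]
      by (simp add: reflect_neg roots_length)
  qed
  then show ?thesis ..
qed

end

section \<open>Relations between root subgroups\<close>

text \<open>
  The value at \<open>u\<close> of the coroot of \<open>\<beta>\<close>, a diagonal matrix in the basis of weight vectors.
\<close>
definition coroot :: "int list \<Rightarrow> 'a::field \<Rightarrow> 'a mat" where
  "coroot \<beta> u = mat 27 27 (\<lambda>(r, s). if r = s then u powi pairing \<beta> r else 0)"

lemma coroot_carrier [simp]: "coroot \<beta> u \<in> carrier_mat 27 27"
  by (simp add: coroot_def)

lemma cm_carrier:
  "X \<in> carrier_mat 27 27 \<Longrightarrow> coroot \<beta> u * X \<in> carrier_mat 27 27"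
  by (rule mult_carrier_mat[OF coroot_carrier])

lemma coroot_row:
  assumes "X \<in> carrier_mat 27 27" "r < 27" "s < 27"
  shows "(coroot \<beta> u * X) $$ (r, s) = u powi pairing \<beta> r * X $$ (r, s)"
proof -
  have "(coroot \<beta> u * X) $$ (r, s) = coroot \<beta> u $$ (r, r) * X $$ (r, s)"
    by (rule mult_entry_single[OF coroot_carrier assms assms(2)]) (simp add: coroot_def assms)
  then show ?thesis using assms by (simp add: coroot_def)
qed

lemma coroot_one: "coroot \<beta> 1 = 1\<^sub>m 27"
  by (rule mat27_eqI) (simp_all add: coroot_def)

lemma coroot_mult:
  assumes "u \<noteq> 0" "v \<noteq> 0" and X: "X \<in> carrier_mat 27 27"
  shows "coroot \<beta> u * (coroot \<beta> v * X) = coroot \<beta> (u * v) * X"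
proof (rule mat27_eqI)
  fix r s :: nat assume b: "r < 27" "s < 27"
  have "coroot \<beta> v * X \<in> carrier_mat 27 27" using mult_carrier_mat[OF coroot_carrier X] .
  then show "(coroot \<beta> u * (coroot \<beta> v * X)) $$ (r, s) = (coroot \<beta> (u * v) * X) $$ (r, s)"
    using b X by (simp add: coroot_row power_int_mult_distrib)
qed (simp_all add: cm_carrier X)

lemma simple_coroot_eq: "i \<in> {1..6} \<Longrightarrow> simple_coroot i u = coroot (simple_root i) u"
  by (rule mat27_eqI)
     (auto simp: simple_coroot_def coroot_def pairing_simple weight_coord_def simp del: atLeastAtMost_iff)

context chevalley
begin

lemmas x_row_link = x_mult_link[OF row_operation_roots]
lemmas x_row_other = x_mult_other[OF row_operation_roots]
lemmas weyl_row_mirror = weyl_row[OF _ row_operation_roots row_operation_roots[OF neg_root_roots]]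
lemmas entry_sign_roots = entry_sign[OF row_operation_roots]

lemma entry_square: "\<beta> \<in> roots \<Longrightarrow> link \<beta> s r \<Longrightarrow> entry \<beta> r s * entry \<beta> r s = 1"
  using entry_sign_roots[of \<beta> s r] by auto

lemma xm_carrier: "\<beta> \<in> roots \<Longrightarrow> X \<in> carrier_mat 27 27 \<Longrightarrow> x \<beta> t * X \<in> carrier_mat 27 27"
  using x_carrier mult_carrier27 by blast

lemma wm_carrier: "\<beta> \<in> roots \<Longrightarrow> X \<in> carrier_mat 27 27 \<Longrightarrow> w \<beta> * X \<in> carrier_mat 27 27"
  using weyl_carrier mult_carrier27 by blast

lemma x_add:
  assumes \<beta>: "\<beta> \<in> roots" and X: "X \<in> carrier_mat 27 27"
  shows "x \<beta> s * (x \<beta> t * X) = x \<beta> (s + t) * X"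
proof (rule mat27_eqI)
  fix r c :: nat assume b: "r < 27" "c < 27"
  show "(x \<beta> s * (x \<beta> t * X)) $$ (r, c) = (x \<beta> (s + t) * X) $$ (r, c)"
  proof (cases "pairing \<beta> r = 1")
    case True
    then obtain q where l: "link \<beta> q r" using link_to[OF \<beta> b(1)] by blast
    have q: "q < 27" "pairing \<beta> q = - 1" using link_bound[OF l] link_pairing_source[OF \<beta> l] by auto
    show ?thesis
      using b q X by (simp add: x_row_link[OF \<beta> \<beta> l] x_row_other[OF \<beta> \<beta>] xm_carrier[OF \<beta>] algebra_simps)
  next
    case False
    then show ?thesis using b X by (simp add: x_row_other[OF \<beta> \<beta>] xm_carrier[OF \<beta>])
  qed
qed (use \<beta> X xm_carrier in auto)

lemma x_zero: "\<beta> \<in> roots \<Longrightarrow> x \<beta> 0 = 1\<^sub>m 27"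
  by (rule mat27_eqI) (auto simp: x_carrier x_entry[OF row_operation_roots])

text \<open>
  The conjugation axiom on entries. The point is that one and the same sign \<open>\<epsilon>\<close> serves all links.
\<close>
lemma weyl_conjugate_entry_sign:
  assumes \<alpha>: "\<alpha> \<in> roots" and \<beta>: "\<beta> \<in> roots"
    and eq: "w \<alpha> * x \<beta> 1 = x (reflect \<alpha> \<beta>) \<epsilon> * w \<alpha>"
    and l: "link \<beta> p r" and m: "mirror \<alpha> p p'" "mirror \<alpha> r r'"
  shows "\<epsilon> * entry (reflect \<alpha> \<beta>) r' p' = weyl_entry \<alpha> r' r * entry \<beta> r p * weyl_entry \<alpha> p' p"
proof -
  let ?\<gamma> = "reflect \<alpha> \<beta>"
  have \<gamma>: "?\<gamma> \<in> roots" using \<alpha> \<beta> by (rule roots.reflect)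
  have l': "link ?\<gamma> p' r'" using mirror_link[OF roots_length[OF \<alpha>] roots_length[OF \<beta>] l m] .
  then have ne: "r' \<noteq> p'" using link_irrefl[OF \<gamma>] by blast
  have "x ?\<gamma> \<epsilon> $$ (r', p') = weyl_entry \<alpha> r' r * x \<beta> 1 $$ (r, p) * weyl_entry \<alpha> p' p"
    using weyl_conjugate_entry[OF \<alpha> \<beta> row_operation_roots[OF \<alpha>] row_operation_roots[OF neg_root_roots[OF \<alpha>]]
        eq x_carrier[OF \<gamma>] m] .
  then show ?thesis
    using l' ne link_bound[OF l'] by (simp add: x_entry[OF row_operation_roots[OF \<gamma>]] entry_def[symmetric])
qed

lemma weyl_conjugate_sign:
  assumes \<alpha>: "\<alpha> \<in> roots" and \<beta>: "\<beta> \<in> roots"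
  shows "\<exists>\<epsilon>. (\<epsilon> = 1 \<or> \<epsilon> = - 1) \<and> (\<forall>p r p' r'. link \<beta> p r \<longrightarrow> mirror \<alpha> p p' \<longrightarrow> mirror \<alpha> r r' \<longrightarrow>
      \<epsilon> * entry (reflect \<alpha> \<beta>) r' p' = weyl_entry \<alpha> r' r * entry \<beta> r p * weyl_entry \<alpha> p' p)"
proof -
  obtain \<epsilon> where e: "(\<epsilon> = 1 \<or> \<epsilon> = - 1) \<and> (\<forall>t. w \<alpha> * x \<beta> t = x (reflect \<alpha> \<beta>) (\<epsilon> * t) * w \<alpha>)"
    using weyl_axiom[OF \<alpha> \<beta>] ..
  have "w \<alpha> * x \<beta> 1 = x (reflect \<alpha> \<beta>) \<epsilon> * w \<alpha>" using spec[OF conjunct2[OF e], of 1] by simp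
  note weyl_conjugate_entry_sign[OF \<alpha> \<beta> this]
  then show ?thesis by (intro exI[of _ \<epsilon>] conjI conjunct1[OF e] allI impI)
qed

lemma mirror_fixed: "r < 27 \<Longrightarrow> pairing \<alpha> r = 0 \<Longrightarrow> mirror \<alpha> r r"
  by (simp add: mirror_def)

lemma mirror_of_link:
  assumes "\<alpha> \<in> roots" "link \<alpha> s r"
  shows "mirror \<alpha> s r" "mirror \<alpha> r s"
proof -
  show "mirror \<alpha> s r"
    using assms(2) link_pairing_source[OF assms] by (simp add: mirror_def link_def)
  then show "mirror \<alpha> r s" by (rule mirror_sym[OF assms(1)])
qed

lemma weyl_entry_simps:
  assumes "\<alpha> \<in> roots"
  shows "link \<alpha> s r \<Longrightarrow> weyl_entry \<alpha> r s = entry \<alpha> r s"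
    and "link \<alpha> r s \<Longrightarrow> weyl_entry \<alpha> r s = - entry \<alpha> s r"
    and "weyl_entry \<alpha> r r = 1"
  using link_asym[OF assms] link_irrefl[OF assms] by (auto simp: weyl_entry_def)

text \<open>
  Here \<open>s\<^sub>\<alpha>\<close> fixes \<open>\<beta>\<close>, so \<open>w(\<alpha>)\<close> conjugates the root vector of \<open>\<beta>\<close> to \<open>\<epsilon>\<close> times itself. A link of
  \<open>\<beta>\<close> between weights that \<open>s\<^sub>\<alpha>\<close> fixes shows \<open>\<epsilon> = 1\<close>; the links between weights that it moves then
  give the claim.
\<close>
lemma entry_orthogonal:
  assumes \<alpha>: "\<alpha> \<in> roots" and \<beta>: "\<beta> \<in> roots" and orth: "root_form \<alpha> \<beta> = 0"
    and l: "link \<alpha> q r" "link \<beta> s q" "link \<beta> q' r" "link \<alpha> s q'"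
  shows "entry \<alpha> r q * entry \<beta> q s = entry \<beta> r q' * entry \<alpha> q' s"
proof -
  have orth': "root_form \<beta> \<alpha> = 0" using orth by (simp add: root_form_sym)
  have fix\<beta>: "reflect \<alpha> \<beta> = \<beta>"
    using roots_length[OF \<alpha>] roots_length[OF \<beta>] orth' by (rule reflect_orthogonal)
  obtain \<epsilon> where \<epsilon>e: "(\<epsilon> = 1 \<or> \<epsilon> = - 1) \<and> (\<forall>p r p' r'. link \<beta> p r \<longrightarrow> mirror \<alpha> p p' \<longrightarrow> mirror \<alpha> r r' \<longrightarrow>
      \<epsilon> * entry \<beta> r' p' = weyl_entry \<alpha> r' r * entry \<beta> r p * weyl_entry \<alpha> p' p)"
    using weyl_conjugate_sign[OF \<alpha> \<beta>] unfolding fix\<beta> ..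
  note \<epsilon> = conjunct1[OF \<epsilon>e] and e = conjunct2[OF \<epsilon>e, rule_format]
  note we = weyl_entry_simps[OF \<alpha>]
  have "\<epsilon> = 1"
  proof -
    obtain p where p: "p < 27" "pairing \<beta> p = - 1" "pairing \<alpha> p = 0"
      using orthogonal_witness[OF \<beta>] \<alpha> orth by blast
    obtain p2 where l2: "link \<beta> p p2" using link_from[OF \<beta> p(1,2)] ..
    have "pairing \<alpha> p2 = 0" using link_pairing[OF l2, of \<alpha>] p orth' by simp
    then have "\<epsilon> * entry \<beta> p2 p = entry \<beta> p2 p"
      using e[OF l2 mirror_fixed[OF p(1,3)] mirror_fixed] link_bound[OF l2] we(3) by simp
    then show ?thesis using entry_sign_roots[OF \<beta> l2] by auto
  qed
  then have "entry \<beta> r q' = entry \<alpha> r q * entry \<beta> q s * entry \<alpha> q' s"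
    using e[OF l(2) mirror_of_link(1)[OF \<alpha> l(4)] mirror_of_link(1)[OF \<alpha> l(1)]]
      we(1)[OF l(1)] we(1)[OF l(4)] by simp
  then have "entry \<beta> r q' * entry \<alpha> q' s
      = entry \<alpha> r q * entry \<beta> q s * (entry \<alpha> q' s * entry \<alpha> q' s)" by simp
  then show ?thesis by (simp add: entry_square[OF \<alpha> l(4)])
qed

text \<open>
  For product 1 no weight admits both steps one after the other, so the row operations do not
  interact. For product 0 the two orders meet in the same row, with the same sign by
  \<open>entry_orthogonal\<close>.
\<close>
lemma x_commute:
  assumes \<alpha>: "\<alpha> \<in> roots" and \<beta>: "\<beta> \<in> roots" and f: "root_form \<alpha> \<beta> \<in> {0, 1}"
    and X: "X \<in> carrier_mat 27 27"
  shows "x \<alpha> s * (x \<beta> t * X) = x \<beta> t * (x \<alpha> s * X)"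
proof (rule mat27_eqI)
  have f': "root_form \<beta> \<alpha> = root_form \<alpha> \<beta>" by (simp add: root_form_sym)
  note rows = x_row_other[OF \<alpha> \<alpha>] x_row_other[OF \<beta> \<beta>] xm_carrier[OF \<alpha>] xm_carrier[OF \<beta>]
  have one: "(x \<alpha> s * (x \<beta> t * X)) $$ (r, c) = (x \<beta> t * (x \<alpha> s * X)) $$ (r, c)"
    if \<alpha>: "\<alpha> \<in> roots" and \<beta>: "\<beta> \<in> roots" and f: "root_form \<alpha> \<beta> \<in> {0, 1}"
      and b: "r < 27" "c < 27" and p: "pairing \<alpha> r = 1" "pairing \<beta> r \<noteq> 1" for r c \<alpha> \<beta> s t
  proof -
    note rows = x_row_other[OF \<alpha> \<alpha>] x_row_other[OF \<beta> \<beta>] xm_carrier[OF \<alpha>] xm_carrier[OF \<beta>]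
    obtain q where l: "link \<alpha> q r" using link_to[OF \<alpha> b(1) p(1)] ..
    have "pairing \<beta> r \<le> 0" using p(2) pairing_cases[OF \<beta> b(1)] by force
    then have "pairing \<beta> q \<noteq> 1" "q < 27" using link_pairing[OF l, of \<beta>] link_bound[OF l] f by auto
    then show ?thesis using b p X by (simp add: x_row_link[OF \<alpha> \<alpha> l] rows)
  qed
  fix r c :: nat assume b: "r < 27" "c < 27"
  show "(x \<alpha> s * (x \<beta> t * X)) $$ (r, c) = (x \<beta> t * (x \<alpha> s * X)) $$ (r, c)"
  proof (cases "pairing \<alpha> r = 1")
    case pa: True
    show ?thesis
    proof (cases "pairing \<beta> r = 1")
      case pb: True
      obtain q where l: "link \<alpha> q r" using link_to[OF \<alpha> b(1) pa] ..
      obtain q' where l': "link \<beta> q' r" using link_to[OF \<beta> b(1) pb] ..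
      have bq: "q < 27" "q' < 27" using link_bound[OF l] link_bound[OF l'] by auto
      have pq: "pairing \<beta> q = 1 - root_form \<alpha> \<beta>" "pairing \<alpha> q' = 1 - root_form \<alpha> \<beta>"
        using link_pairing[OF l, of \<beta>] link_pairing[OF l', of \<alpha>] pa pb f' by auto
      show ?thesis
      proof (cases "root_form \<alpha> \<beta> = 1")
        case True
        then show ?thesis using b bq pq X
          by (simp add: x_row_link[OF \<alpha> \<alpha> l] x_row_link[OF \<beta> \<beta> l'] rows)
      next
        case False
        then have orth: "root_form \<alpha> \<beta> = 0" using f by simp
        then obtain q2 where l2: "link \<beta> q2 q" using link_to[OF \<beta> bq(1)] pq by auto
        have l3: "link \<alpha> q2 q'"
          using l l' l2 by (simp add: link_def) 
        have bq2: "q2 < 27" using link_bound[OF l2] by auto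
        show ?thesis using b bq bq2 X entry_orthogonal[OF \<alpha> \<beta> orth l l2 l' l3]
          by (simp add: x_row_link[OF \<alpha> \<alpha> l] x_row_link[OF \<beta> \<beta> l'] x_row_link[OF \<alpha> \<alpha> l3]
              x_row_link[OF \<beta> \<beta> l2] rows algebra_simps)
      qed
    next
      case False
      then show ?thesis using one[OF \<alpha> \<beta> f b pa] by simp
    qed
  next
    case pa: False
    show ?thesis
    proof (cases "pairing \<beta> r = 1")
      case True
      then show ?thesis using one[OF \<beta> \<alpha> _ b True pa] f f' by simp
    next
      case False
      then show ?thesis using b X pa by (simp add: rows)
    qed
  qed
qed (use \<alpha> \<beta> X xm_carrier in auto)

text \<open>
  Here \<open>s\<^sub>\<alpha> \<beta> = \<alpha> + \<beta>\<close>. A link of \<open>\<alpha> + \<beta>\<close> splits in exactly one of the two orders, according to the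
  pairing of its source with \<open>\<alpha>\<close>. The conjugation axiom for \<open>w(\<alpha>)\<close> treats both kinds, with the same
  \<open>\<epsilon>\<close>, and the sign of a descending entry of \<open>w(\<alpha>)\<close> accounts for the minus sign. So the commutator of
  the root vectors is \<open>\<epsilon>\<close> times the root vector of \<open>\<alpha> + \<beta>\<close>.
\<close>
lemma entry_commutator:
  assumes \<alpha>: "\<alpha> \<in> roots" and \<beta>: "\<beta> \<in> roots" and f: "root_form \<alpha> \<beta> = - 1"
  shows "\<exists>\<epsilon>. (\<epsilon> = 1 \<or> \<epsilon> = - 1) \<and>
    (\<forall>s q r. link \<beta> s q \<longrightarrow> link \<alpha> q r \<longrightarrow>
        entry \<alpha> r q * entry \<beta> q s = \<epsilon> * entry (reflect \<alpha> \<beta>) r s) \<and>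
    (\<forall>s q r. link \<alpha> s q \<longrightarrow> link \<beta> q r \<longrightarrow>
        entry \<beta> r q * entry \<alpha> q s = - \<epsilon> * entry (reflect \<alpha> \<beta>) r s)"
proof -
  obtain \<epsilon> where \<epsilon>e: "(\<epsilon> = 1 \<or> \<epsilon> = - 1) \<and> (\<forall>p r p' r'. link \<beta> p r \<longrightarrow> mirror \<alpha> p p' \<longrightarrow> mirror \<alpha> r r' \<longrightarrow>
      \<epsilon> * entry (reflect \<alpha> \<beta>) r' p' = weyl_entry \<alpha> r' r * entry \<beta> r p * weyl_entry \<alpha> p' p)"
    using weyl_conjugate_sign[OF \<alpha> \<beta>] ..
  note \<epsilon> = conjunct1[OF \<epsilon>e] and e = conjunct2[OF \<epsilon>e, rule_format]
  note we = weyl_entry_simps[OF \<alpha>]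
  have f': "root_form \<beta> \<alpha> = - 1" using f by (simp add: root_form_sym)
  have 1: "entry \<alpha> r q * entry \<beta> q s = \<epsilon> * entry (reflect \<alpha> \<beta>) r s"
    if l: "link \<beta> s q" "link \<alpha> q r" for s q r
  proof -
    have "pairing \<alpha> s = 0"
      using link_pairing[OF l(1), of \<alpha>] link_pairing_source[OF \<alpha> l(2)] f' by simp
    then show ?thesis
      using e[OF l(1) mirror_fixed mirror_of_link(1)[OF \<alpha> l(2)]] link_bound[OF l(1)] we(1)[OF l(2)] we(3)
      by simp
  qed
  have 2: "entry \<beta> r q * entry \<alpha> q s = - \<epsilon> * entry (reflect \<alpha> \<beta>) r s"
    if l: "link \<alpha> s q" "link \<beta> q r" for s q r
  proof -
    have "pairing \<alpha> r = 0"
      using link_pairing[OF l(2), of \<alpha>] link_pairing_target[OF \<alpha> l(1)] f' by simp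
    then have "\<epsilon> * entry (reflect \<alpha> \<beta>) r s = - (entry \<beta> r q * entry \<alpha> q s)"
      using e[OF l(2) mirror_of_link(2)[OF \<alpha> l(1)] mirror_fixed] link_bound[OF l(2)] we(2)[OF l(1)] we(3)
      by simp
    then show ?thesis by simp
  qed
  show ?thesis using 1 2 by (intro exI[of _ \<epsilon>] conjI \<epsilon> allI impI)
qed

text \<open>
  The trailing factor \<open>X\<close> allows the relation to be used inside a longer product.
\<close>
lemma x_commutator:
  assumes \<alpha>: "\<alpha> \<in> roots" and \<beta>: "\<beta> \<in> roots" and f: "root_form \<alpha> \<beta> = - 1"
  shows "\<exists>\<epsilon>. (\<epsilon> = 1 \<or> \<epsilon> = - 1) \<and> (\<forall>s t. \<forall>X\<in>carrier_mat 27 27.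
      x \<alpha> s * (x \<beta> t * X) = x \<beta> t * (x (reflect \<alpha> \<beta>) (\<epsilon> * s * t) * (x \<alpha> s * X)))"
proof -
  let ?\<gamma> = "reflect \<alpha> \<beta>"
  have \<gamma>: "?\<gamma> \<in> roots" using \<alpha> \<beta> by (rule roots.reflect)
  note len = roots_length[OF \<alpha>] roots_length[OF \<beta>]
  have f': "root_form \<beta> \<alpha> = - 1" using f by (simp add: root_form_sym)
  have p\<gamma>: "pairing ?\<gamma> r = pairing \<alpha> r + pairing \<beta> r" for r
    using pairing_reflect[OF len] f' by simp
  obtain \<epsilon> where \<epsilon>e: "(\<epsilon> = 1 \<or> \<epsilon> = - 1) \<and>
    (\<forall>s q r. link \<beta> s q \<longrightarrow> link \<alpha> q r \<longrightarrow>
        entry \<alpha> r q * entry \<beta> q s = \<epsilon> * entry (reflect \<alpha> \<beta>) r s) \<and>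
    (\<forall>s q r. link \<alpha> s q \<longrightarrow> link \<beta> q r \<longrightarrow>
        entry \<beta> r q * entry \<alpha> q s = - \<epsilon> * entry (reflect \<alpha> \<beta>) r s)"
    using entry_commutator[OF \<alpha> \<beta> f] ..
  note \<epsilon> = conjunct1[OF \<epsilon>e]
    and e1 = conjunct1[OF conjunct2[OF \<epsilon>e], rule_format]
    and e2 = conjunct2[OF conjunct2[OF \<epsilon>e], rule_format]
  note rows = x_row_other[OF \<alpha> \<alpha>] x_row_other[OF \<beta> \<beta>] x_row_other[OF \<gamma> \<gamma>]
    xm_carrier[OF \<alpha>] xm_carrier[OF \<beta>] xm_carrier[OF \<gamma>]
  have "x \<alpha> s * (x \<beta> t * X) = x \<beta> t * (x ?\<gamma> (\<epsilon> * s * t) * (x \<alpha> s * X))"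
    if X: "X \<in> carrier_mat 27 27" for s t X
  proof (rule mat27_eqI)
    fix r c :: nat assume b: "r < 27" "c < 27"
    show "(x \<alpha> s * (x \<beta> t * X)) $$ (r, c)
        = (x \<beta> t * (x ?\<gamma> (\<epsilon> * s * t) * (x \<alpha> s * X))) $$ (r, c)"
    proof (cases "pairing \<alpha> r = 1")
      case pa: True
      obtain q where l: "link \<alpha> q r" using link_to[OF \<alpha> b(1) pa] ..
      have bq: "q < 27" using link_bound[OF l] by auto
      have pq: "pairing \<beta> q = pairing \<beta> r + 1" using link_pairing[OF l, of \<beta>] f by simp
      have "pairing \<beta> r \<noteq> 1" using pq by (cases rule: pairing_cases[OF \<beta> bq]) auto
      then consider "pairing \<beta> r = 0" | "pairing \<beta> r = - 1"
        by (cases rule: pairing_cases[OF \<beta> b(1)]) auto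
      then show ?thesis
      proof cases
        case 1
        then obtain q2 where l2: "link \<beta> q2 q" using link_to[OF \<beta> bq] pq by auto
        have l3: "link ?\<gamma> q2 r" using link_comp(1)[OF len f' l l2] .
        have bq2: "q2 < 27" "pairing \<alpha> q2 = 0"
          using link_bound[OF l2] link_pairing[OF l2, of \<alpha>] link_pairing_source[OF \<alpha> l] f' by auto
        have "entry \<alpha> r q * (entry \<beta> q q2 * y) = \<epsilon> * (entry ?\<gamma> r q2 * y)" for y
          using e1[OF l2 l] by (simp add: mult.assoc[symmetric])
        then show ?thesis using b bq bq2 1 X
          by (simp add: x_row_link[OF \<alpha> \<alpha> l] x_row_link[OF \<beta> \<beta> l2] x_row_link[OF \<gamma> \<gamma> l3] rows algebra_simps)
      next
        case 2
        then show ?thesis using b bq X pa pq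
          by (simp add: x_row_link[OF \<alpha> \<alpha> l] rows p\<gamma>)
      qed
    next
      case pa: False
      show ?thesis
      proof (cases "pairing \<beta> r = 1")
        case pb: True
        obtain q where l: "link \<beta> q r" using link_to[OF \<beta> b(1) pb] ..
        have bq: "q < 27" using link_bound[OF l] by auto
        have pq: "pairing \<alpha> q = pairing \<alpha> r + 1" "pairing \<beta> q = - 1"
          using link_pairing[OF l, of \<alpha>] link_pairing_source[OF \<beta> l] f' by simp_all
        from pa consider "pairing \<alpha> r = 0" | "pairing \<alpha> r = - 1"
          by (cases rule: pairing_cases[OF \<alpha> b(1)]) auto
        then show ?thesis
        proof cases
          case 1
          then obtain q2 where l2: "link \<alpha> q2 q" using link_to[OF \<alpha> bq] pq by auto
          have l3: "link ?\<gamma> q2 r" using link_comp(2)[OF len f' l l2] .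
          have bq2: "q2 < 27" "pairing \<alpha> q2 = - 1"
            using link_bound[OF l2] link_pairing_source[OF \<alpha> l2] by auto
          have "entry \<beta> r q * (entry \<alpha> q q2 * y) = - (\<epsilon> * (entry ?\<gamma> r q2 * y))" for y
            using e2[OF l2 l] by (simp add: mult.assoc[symmetric])
          then show ?thesis using b bq bq2 1 X pq pb
            by (simp add: x_row_link[OF \<alpha> \<alpha> l2] x_row_link[OF \<beta> \<beta> l] x_row_link[OF \<gamma> \<gamma> l3]
                rows p\<gamma> algebra_simps)
        next
          case 2
          then show ?thesis using b bq X pq pb
            by (simp add: x_row_link[OF \<beta> \<beta> l] rows p\<gamma>)
        qed
      next
        case False
        have "pairing ?\<gamma> r \<noteq> 1"
          using pa False unfolding p\<gamma>
          by (cases rule: pairing_cases[OF \<alpha> b(1)]; cases rule: pairing_cases[OF \<beta> b(1)]) auto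
        then show ?thesis using b X pa False by (simp add: rows)
      qed
    qed
  qed (use \<alpha> \<beta> \<gamma> X xm_carrier in auto)
  then show ?thesis by (intro exI[of _ \<epsilon>] conjI \<epsilon> allI ballI)
qed

lemma link_rows:
  assumes \<alpha>: "\<alpha> \<in> roots" and l: "link \<alpha> i j"
  shows "link (neg_root \<alpha>) j i" "i < 27" "j < 27" "pairing \<alpha> i = - 1" "pairing \<alpha> j = 1"
    "pairing (neg_root \<alpha>) i = 1" "pairing (neg_root \<alpha>) j = - 1"
    "entry (neg_root \<alpha>) i j = entry \<alpha> j i"
  using l link_neg[of \<alpha> j i] roots_length[OF \<alpha>] link_bound[OF l] link_pairing_source[OF \<alpha> l]
    link_pairing_target[OF \<alpha> l] pairing_neg[of \<alpha>]
    entry_neg[OF \<alpha> row_operation_roots[OF \<alpha>] row_operation_roots[OF neg_root_roots[OF \<alpha>]] l]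
  by simp_all

text \<open>
  To compare products in the rank one group of \<open>\<alpha>\<close>: such elements act on the pairs of rows linked by
  \<open>\<alpha>\<close> as 2 by 2 matrices, and fix all other rows.
\<close>
lemma rank_one_eqI:
  assumes \<alpha>: "\<alpha> \<in> roots" and A: "A \<in> carrier_mat 27 27" and B: "B \<in> carrier_mat 27 27"
    and linked: "\<And>i j c. link \<alpha> i j \<Longrightarrow> c < 27 \<Longrightarrow> A $$ (i, c) = B $$ (i, c) \<and> A $$ (j, c) = B $$ (j, c)"
    and fixed: "\<And>r c. r < 27 \<Longrightarrow> pairing \<alpha> r = 0 \<Longrightarrow> c < 27 \<Longrightarrow> A $$ (r, c) = B $$ (r, c)"
  shows "A = B"
proof (rule mat27_eqI[OF A B])
  fix r c :: nat assume b: "r < 27" "c < 27"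
  from \<alpha> b(1) show "A $$ (r, c) = B $$ (r, c)"
  proof (cases rule: pairing_cases)
    case 1
    then obtain j where "link \<alpha> r j" using link_from[OF \<alpha> b(1)] by auto
    then show ?thesis using linked b by blast
  next
    case 2
    then show ?thesis using fixed b by blast
  next
    case 3
    then obtain i where "link \<alpha> i r" using link_to[OF \<alpha> b(1)] by auto
    then show ?thesis using linked b by blast
  qed
qed

text \<open>
  The entries of the SL2 identities behind \<open>sl2_swap\<close> and \<open>weyl_x\<close>, for root vectors with entry \<open>a\<close>.
\<close>
lemma sl2_identities:
  fixes a u s t c y z :: 'a
  shows "u * (1 + s * t) = 1 \<Longrightarrow> a * a = 1 \<Longrightarrow>
      y + s * a * (z + t * a * y) = (1 + s * t) * (y + s * u * a * z)"
    and "u * (1 + s * t) = 1 \<Longrightarrow> a * a = 1 \<Longrightarrow>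
      z + t * a * y = u * z + t * u * a * ((1 + s * t) * (y + s * u * a * z))"
    and "u * c = 1 \<Longrightarrow> a * a = 1 \<Longrightarrow> - a * (u * z - u * a * (c * (y + u * a * z))) = y"
    and "u * c = 1 \<Longrightarrow> a * a = 1 \<Longrightarrow> a * (c * (y + u * a * z)) = z + c * a * y"
proof -
  assume sq: "a * a = 1"
  {
    assume u: "u * (1 + s * t) = 1"
    have "y + s * a * (z + t * a * y) = y + s * a * z + s * t * (a * a) * y"
      "(1 + s * t) * (y + s * u * a * z) = y + s * t * y + s * a * (u * (1 + s * t)) * z"
      by (simp_all add: algebra_simps)
    then show "y + s * a * (z + t * a * y) = (1 + s * t) * (y + s * u * a * z)"
      by (simp only: u sq) simp
    have "u * z + t * u * a * ((1 + s * t) * (y + s * u * a * z))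
        = u * z + t * (u * (1 + s * t)) * a * y + t * s * u * (a * a) * (u * (1 + s * t)) * z"
      by (simp add: algebra_simps)
    also have "\<dots> = (u * z + t * s * u * z) + t * a * y"
      unfolding u sq by simp
    also have "u * z + t * s * u * z = (u * (1 + s * t)) * z"
      by (simp add: algebra_simps)
    also have "\<dots> + t * a * y = z + t * a * y" unfolding u by simp
    finally show "z + t * a * y = u * z + t * u * a * ((1 + s * t) * (y + s * u * a * z))" ..
  next
    assume u: "u * c = 1"
    have "- a * (u * z - u * a * (c * (y + u * a * z)))
        = - (a * u * z) + (u * c) * (a * a) * y + (u * c) * (a * a) * (a * u * z)"
      by (simp add: algebra_simps)
    then show "- a * (u * z - u * a * (c * (y + u * a * z))) = y"
      unfolding u sq by simp
    have "a * (c * (y + u * a * z)) = c * a * y + (u * c) * (a * a) * z"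
      by (simp add: algebra_simps)
    then show "a * (c * (y + u * a * z)) = z + c * a * y"
      unfolding u sq by simp
  }
qed

text \<open>
  In SL2: a lower times an upper unitriangular matrix, rewritten as upper times diagonal times lower
  where the leading minor \<open>1 + s t\<close> is invertible.
\<close>
lemma sl2_swap:
  assumes \<alpha>: "\<alpha> \<in> roots" and u: "u * (1 + s * t) = 1" and X: "X \<in> carrier_mat 27 27"
  shows "x (neg_root \<alpha>) s * (x \<alpha> t * X)
    = x \<alpha> (t * u) * (coroot \<alpha> u * (x (neg_root \<alpha>) (s * u) * X))" (is "?L = ?R")
proof -
  let ?n = "neg_root \<alpha>"
  have n: "?n \<in> roots" using neg_root_roots[OF \<alpha>] .
  have pn: "pairing ?n i = - pairing \<alpha> i" for i using pairing_neg roots_length[OF \<alpha>] by simp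
  have iu: "inverse u = 1 + s * t" using u by (rule inverse_unique)
  note rows = x_row_other[OF \<alpha> \<alpha>] x_row_other[OF n n] coroot_row xm_carrier[OF \<alpha>] xm_carrier[OF n] cm_carrier
  show ?thesis
  proof (rule rank_one_eqI[OF \<alpha>])
    fix i j c :: nat assume l: "link \<alpha> i j" and c: "c < 27"
    note lr = link_rows[OF \<alpha> l]
    let ?a = "entry \<alpha> j i" and ?y = "X $$ (i, c)" and ?z = "X $$ (j, c)"
    note sq = entry_square[OF \<alpha> l]
    have "?L $$ (i, c) = ?y + s * ?a * (?z + t * ?a * ?y)" "?L $$ (j, c) = ?z + t * ?a * ?y"
      using c X lr by (simp_all add: x_row_link[OF \<alpha> \<alpha> l] x_row_link[OF n n lr(1)] rows)
    moreover have "?R $$ (i, c) = inverse u * (?y + s * u * ?a * ?z)"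
      "?R $$ (j, c) = u * ?z + t * u * ?a * (inverse u * (?y + s * u * ?a * ?z))"
      using c X lr by (simp_all add: x_row_link[OF \<alpha> \<alpha> l] x_row_link[OF n n lr(1)] rows power_int_minus)
    moreover have "?y + s * ?a * (?z + t * ?a * ?y) = (1 + s * t) * (?y + s * u * ?a * ?z)"
      by (rule sl2_identities(1)[OF u sq])
    moreover have "?z + t * ?a * ?y = u * ?z + t * u * ?a * ((1 + s * t) * (?y + s * u * ?a * ?z))"
      by (rule sl2_identities(2)[OF u sq])
    ultimately show "?L $$ (i, c) = ?R $$ (i, c) \<and> ?L $$ (j, c) = ?R $$ (j, c)"
      by (simp only: iu)
  next
    fix r c :: nat assume "r < 27" "pairing \<alpha> r = 0" "c < 27"
    then show "?L $$ (r, c) = ?R $$ (r, c)"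
      using X by (simp add: rows pn)
  qed (use X in \<open>simp_all add: rows\<close>)
qed

text \<open>
  In SL2, \<open>w\<inverse> x(c)\<close> has lower right entry \<open>c\<close> and so lies in the big cell for \<open>c \<noteq> 0\<close>.
\<close>
lemma weyl_x:
  assumes \<alpha>: "\<alpha> \<in> roots" and u: "u * c = 1" and X: "X \<in> carrier_mat 27 27"
  shows "w \<alpha> * (x \<alpha> (- u) * (coroot \<alpha> u * (x (neg_root \<alpha>) u * X))) = x \<alpha> c * X" (is "?L = ?R")
proof -
  let ?n = "neg_root \<alpha>"
  have n: "?n \<in> roots" using neg_root_roots[OF \<alpha>] .
  have pn: "pairing ?n i = - pairing \<alpha> i" for i using pairing_neg roots_length[OF \<alpha>] by simp
  have iu: "inverse u = c" using u by (rule inverse_unique)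
  note rows = x_row_other[OF \<alpha> \<alpha>] x_row_other[OF n n] coroot_row xm_carrier[OF \<alpha>] xm_carrier[OF n] cm_carrier
    wm_carrier[OF \<alpha>]
  show ?thesis
  proof (rule rank_one_eqI[OF \<alpha>])
    fix i j k :: nat assume l: "link \<alpha> i j" and k: "k < 27"
    note lr = link_rows[OF \<alpha> l]
    let ?a = "entry \<alpha> j i" and ?y = "X $$ (i, k)" and ?z = "X $$ (j, k)"
    note sq = entry_square[OF \<alpha> l]
    note wr = weyl_row_mirror[OF \<alpha> \<alpha> \<alpha> mirror_of_link(1)[OF \<alpha> l]]
        weyl_row_mirror[OF \<alpha> \<alpha> \<alpha> mirror_of_link(2)[OF \<alpha> l]]
      weyl_entry_simps(1)[OF \<alpha> l] weyl_entry_simps(2)[OF \<alpha> l]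
    have "?L $$ (i, k) = - ?a * (u * ?z - u * ?a * (inverse u * (?y + u * ?a * ?z)))"
      "?L $$ (j, k) = ?a * (inverse u * (?y + u * ?a * ?z))"
      using k X lr
      by (simp_all add: wr x_row_link[OF \<alpha> \<alpha> l] x_row_link[OF n n lr(1)] rows power_int_minus)
    moreover have "?R $$ (i, k) = ?y" "?R $$ (j, k) = ?z + c * ?a * ?y"
      using k X lr by (simp_all add: x_row_link[OF \<alpha> \<alpha> l] rows)
    moreover have "- ?a * (u * ?z - u * ?a * (c * (?y + u * ?a * ?z))) = ?y"
      by (rule sl2_identities(3)[OF u sq])
    moreover have "?a * (c * (?y + u * ?a * ?z)) = ?z + c * ?a * ?y"
      by (rule sl2_identities(4)[OF u sq])
    ultimately show "?L $$ (i, k) = ?R $$ (i, k) \<and> ?L $$ (j, k) = ?R $$ (j, k)"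
      by (simp only: iu)
  next
    fix r k :: nat assume r: "r < 27" "pairing \<alpha> r = 0" and k: "k < 27"
    show "?L $$ (r, k) = ?R $$ (r, k)"
      using r k X weyl_row_mirror[OF \<alpha> \<alpha> \<alpha> mirror_fixed[OF r]] weyl_entry_simps(3)[OF \<alpha>]
      by (simp add: rows pn)
  qed (use X in \<open>simp_all add: rows\<close>)
qed

lemma weyl_square:
  assumes \<alpha>: "\<alpha> \<in> roots" and X: "X \<in> carrier_mat 27 27"
  shows "w \<alpha> * (w \<alpha> * X) = coroot \<alpha> (- 1) * X"
proof -
  note rows = coroot_row cm_carrier wm_carrier[OF \<alpha>]
  show ?thesis
  proof (rule rank_one_eqI[OF \<alpha>])
    fix i j k :: nat assume l: "link \<alpha> i j" and k: "k < 27"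
    note lr = link_rows[OF \<alpha> l]
    have sq: "entry \<alpha> j i * (entry \<alpha> j i * y) = y" for y
      using entry_square[OF \<alpha> l] by (simp add: mult.assoc[symmetric])
    note wr = weyl_row_mirror[OF \<alpha> \<alpha> \<alpha> mirror_of_link(1)[OF \<alpha> l]]
        weyl_row_mirror[OF \<alpha> \<alpha> \<alpha> mirror_of_link(2)[OF \<alpha> l]]
      weyl_entry_simps(1)[OF \<alpha> l] weyl_entry_simps(2)[OF \<alpha> l]
    show "(w \<alpha> * (w \<alpha> * X)) $$ (i, k) = (coroot \<alpha> (- 1) * X) $$ (i, k)
      \<and> (w \<alpha> * (w \<alpha> * X)) $$ (j, k) = (coroot \<alpha> (- 1) * X) $$ (j, k)"
      using k X lr by (simp add: wr rows sq)
  next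
    fix r k :: nat assume r: "r < 27" "pairing \<alpha> r = 0" and k: "k < 27"
    show "(w \<alpha> * (w \<alpha> * X)) $$ (r, k) = (coroot \<alpha> (- 1) * X) $$ (r, k)"
      using r k X weyl_row_mirror[OF \<alpha> \<alpha> \<alpha> mirror_fixed[OF r]] weyl_entry_simps(3)[OF \<alpha>]
      by (simp add: rows)
  qed (use X in \<open>simp_all add: rows\<close>)
qed

lemma coroot_x:
  assumes \<gamma>: "\<gamma> \<in> roots" and u: "u \<noteq> 0" and X: "X \<in> carrier_mat 27 27"
  shows "coroot \<beta> u * (x \<gamma> t * X) = x \<gamma> (u powi root_form \<gamma> \<beta> * t) * (coroot \<beta> u * X)"
proof -
  note rows = x_row_other[OF \<gamma> \<gamma>] coroot_row xm_carrier[OF \<gamma>] cm_carrier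
  show ?thesis
  proof (rule rank_one_eqI[OF \<gamma>])
    fix i j k :: nat assume l: "link \<gamma> i j" and k: "k < 27"
    note lr = link_rows[OF \<gamma> l]
    have "u powi pairing \<beta> j = u powi pairing \<beta> i * u powi root_form \<gamma> \<beta>"
      using link_pairing[OF l, of \<beta>] u by (simp add: power_int_add)
    then show "(coroot \<beta> u * (x \<gamma> t * X)) $$ (i, k) = (x \<gamma> (u powi root_form \<gamma> \<beta> * t) *
        (coroot \<beta> u * X)) $$ (i, k)
      \<and> (coroot \<beta> u * (x \<gamma> t * X)) $$ (j, k) = (x \<gamma> (u powi root_form \<gamma> \<beta> * t) * (coroot \<beta> u * X)) $$ (j, k)"
      using k X lr by (simp add: x_row_link[OF \<gamma> \<gamma> l] rows algebra_simps)
  next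
    fix r k :: nat assume r: "r < 27" "pairing \<gamma> r = 0" and k: "k < 27"
    then show "(coroot \<beta> u * (x \<gamma> t * X)) $$ (r, k) = (x \<gamma> (u powi root_form \<gamma> \<beta> * t) *
        (coroot \<beta> u * X)) $$ (r, k)"
      using X by (simp add: rows)
  qed (use X in \<open>simp_all add: rows\<close>)
qed

lemma weyl_coroot:
  assumes \<alpha>: "\<alpha> \<in> roots" and \<beta>: "\<beta> \<in> roots" and X: "X \<in> carrier_mat 27 27"
  shows "w \<alpha> * (coroot \<beta> u * X) = coroot (reflect \<alpha> \<beta>) u * (w \<alpha> * X)"
proof (rule mat27_eqI)
  fix r c :: nat assume b: "r < 27" "c < 27"
  obtain q where m: "mirror \<alpha> r q" using mirror_ex[OF \<alpha> b(1)] ..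
  then have "q < 27" by (simp add: mirror_def)
  moreover have "pairing \<beta> q = pairing (reflect \<alpha> \<beta>) r"
    using mirror_pairing[OF m roots_length[OF \<alpha>] roots_length[OF \<beta>]] .
  ultimately show "(w \<alpha> * (coroot \<beta> u * X)) $$ (r, c) = (coroot (reflect \<alpha> \<beta>) u * (w \<alpha> * X)) $$ (r, c)"
    using b X by (simp add: weyl_row_mirror[OF \<alpha> \<alpha> \<alpha> m] coroot_row cm_carrier wm_carrier[OF \<alpha>])
qed (use X \<alpha> in \<open>simp_all add: cm_carrier wm_carrier\<close>)

end

section \<open>The Levi factor and the two unipotent radicals\<close>

fun weight_list :: "int list \<Rightarrow> int list" where
  "weight_list [a, b, c, d, e, f] =
     [2 * a - c, 2 * b - d, 2 * c - a - d, 2 * d - b - c - e, 2 * e - d - f, 2 * f - e]"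
| "weight_list _ = []"

lemma positive_root_forms:
  "\<forall>\<alpha>\<in>set positive_roots. \<forall>\<beta>\<in>set positive_roots.
     \<alpha> = \<beta> \<or> sum_list (map2 (*) (weight_list \<alpha>) \<beta>) \<in> {- 1, 0, 1}"
  by code_simp

lemma root_form_list:
  assumes "length \<alpha> = 6" "length \<beta> = 6"
  shows "root_form \<alpha> \<beta> = sum_list (map2 (*) (weight_list \<alpha>) \<beta>)"
proof -
  obtain a b c d e f where \<alpha>: "\<alpha> = [a, b, c, d, e, f]" using length6_cases[OF assms(1)] .
  obtain a' b' c' d' e' f' where \<beta>: "\<beta> = [a', b', c', d', e', f']" using length6_cases[OF assms(2)] .
  show ?thesis
    unfolding root_form_weight sum_1_6 \<alpha> \<beta> root_weight_explicit by (simp add: coeff_at_def)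
qed

lemma root_form_cases:
  assumes "\<alpha> \<in> roots" "\<beta> \<in> roots" "\<alpha> \<noteq> \<beta>" "\<alpha> \<noteq> neg_root \<beta>"
  shows "root_form \<alpha> \<beta> \<in> {- 1, 0, 1}"
proof -
  note len = roots_length[OF assms(1)] roots_length[OF assms(2)]
  have pos: "root_form \<alpha> \<beta> \<in> {- 1, 0, 1}"
    if "\<alpha> \<in> set positive_roots" "\<beta> \<in> set positive_roots" "\<alpha> \<noteq> \<beta>" for \<alpha> \<beta>
  proof -
    have "length \<alpha> = 6" "length \<beta> = 6" using that positive_roots_nonneg by auto
    then show ?thesis using bspec[OF bspec[OF positive_root_forms that(1)] that(2)] that(3)
      by (simp only: root_form_list) blast
  qed
  have neg: "neg_root \<gamma> \<in> set positive_roots" if "\<gamma> \<in> roots" "\<gamma> \<notin> set positive_roots" for \<gamma>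
    using root_negative[OF that(1)] that(2) by simp
  show ?thesis
  proof (cases "\<alpha> \<in> set positive_roots"; cases "\<beta> \<in> set positive_roots")
    assume "\<alpha> \<in> set positive_roots" "\<beta> \<in> set positive_roots"
    then show ?thesis using pos assms(3) by blast
  next
    assume *: "\<alpha> \<in> set positive_roots" "\<beta> \<notin> set positive_roots"
    from pos[OF *(1) neg[OF assms(2) *(2)] assms(4)] show ?thesis
      using len by (auto simp: root_form_neg_right)
  next
    assume *: "\<alpha> \<notin> set positive_roots" "\<beta> \<in> set positive_roots"
    have "neg_root \<alpha> \<noteq> \<beta>" using assms(4) by auto
    from pos[OF neg[OF assms(1) *(1)] *(2) this] show ?thesis
      using len by (auto simp: root_form_neg_left)
  next
    assume *: "\<alpha> \<notin> set positive_roots" "\<beta> \<notin> set positive_roots"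
    have "neg_root \<alpha> \<noteq> neg_root \<beta>" using assms(3) by (metis neg_neg)
    from pos[OF neg[OF assms(1) *(1)] neg[OF assms(2) *(2)] this] show ?thesis
      using len by (simp add: root_form_neg_left root_form_neg_right)
  qed
qed

lemma GL_mult: "A \<otimes>\<^bsub>GL27\<^esub> B = A * B"
  by (simp add: GL27_def units_of_mult ring_mat_def)

lemma GL_one: "\<one>\<^bsub>GL27\<^esub> = 1\<^sub>m 27"
  by (simp add: GL27_def units_of_one ring_mat_def)

lemma GL_group: "group (GL27 :: 'a::field mat monoid)"
proof -
  interpret ring "ring_mat TYPE('a) 27 ()" by (rule ring_mat)
  show ?thesis unfolding GL27_def by (rule units_group)
qed

lemma GL_carrier_mat: "A \<in> carrier GL27 \<Longrightarrow> A \<in> carrier_mat 27 27"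
  by (simp add: GL27_def units_of_carrier Units_def ring_mat_def)

lemma GL_I:
  assumes "A \<in> carrier_mat 27 27" "B \<in> carrier_mat 27 27" "A * B = 1\<^sub>m 27" "B * A = 1\<^sub>m 27"
  shows "A \<in> carrier GL27" "inv\<^bsub>GL27\<^esub> A = B"
proof -
  show A: "A \<in> carrier GL27"
    using assms by (auto simp: GL27_def units_of_carrier Units_def ring_mat_def)
  have "B \<in> carrier GL27"
    using assms by (auto simp: GL27_def units_of_carrier Units_def ring_mat_def)
  then show "inv\<^bsub>GL27\<^esub> A = B"
    using group.inv_equality[OF GL_group _ A] assms by (simp add: GL_mult GL_one)
qed

lemma GL_inv:
  assumes "A \<in> carrier GL27"
  shows "inv\<^bsub>GL27\<^esub> A \<in> carrier GL27" "A * inv\<^bsub>GL27\<^esub> A = 1\<^sub>m 27" "inv\<^bsub>GL27\<^esub> A * A = 1\<^sub>m 27"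
  using group.inv_closed[OF GL_group assms] group.r_inv[OF GL_group assms] group.l_inv[OF GL_group assms]
  by (simp_all add: GL_mult GL_one)

lemma GL_mult_closed: "A \<in> carrier GL27 \<Longrightarrow> B \<in> carrier GL27 \<Longrightarrow> A * B \<in> carrier GL27"
  using monoid.m_closed[OF group.is_monoid[OF GL_group], of A B] by (simp add: GL_mult)

lemma GL_assoc:
  "A \<in> carrier GL27 \<Longrightarrow> B \<in> carrier GL27 \<Longrightarrow> C \<in> carrier GL27 \<Longrightarrow> (A * B) * C = A * (B * C)"
  using GL_carrier_mat assoc_mult_mat by metis

lemma GL_inv_mult:
  "A \<in> carrier GL27 \<Longrightarrow> B \<in> carrier GL27 \<Longrightarrow>
     inv\<^bsub>GL27\<^esub> (A * B) = inv\<^bsub>GL27\<^esub> B * inv\<^bsub>GL27\<^esub> A"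
  using group.inv_mult_group[OF GL_group, of A B] by (simp add: GL_mult)

lemma generate_mult: "A \<in> generate GL27 H \<Longrightarrow> B \<in> generate GL27 H \<Longrightarrow> A * B \<in> generate GL27 H"
  using generate.eng[of A GL27 H B] by (simp add: GL_mult)

lemma generate_one: "1\<^sub>m 27 \<in> generate GL27 H"
  using generate.one[of GL27 H] by (simp add: GL_one)

lemma generate_inv:
  "H \<subseteq> carrier GL27 \<Longrightarrow> A \<in> generate GL27 H \<Longrightarrow> inv\<^bsub>GL27\<^esub> A \<in> generate GL27 H"
  by (rule group.generate_m_inv_closed[OF GL_group])

lemma generate_carrier: "H \<subseteq> carrier GL27 \<Longrightarrow> A \<in> generate GL27 H \<Longrightarrow> A \<in> carrier GL27"
  by (rule group.generate_in_carrier[OF GL_group])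

text \<open>
  A set of generators that is closed under inverses allows induction on left multiplication by a
  generator, which for root elements is a row operation.
\<close>
lemma generate_induct_left:
  assumes g: "g \<in> generate GL27 H" and H: "H \<subseteq> carrier GL27"
    and inv: "\<And>h. h \<in> H \<Longrightarrow> inv\<^bsub>GL27\<^esub> h \<in> H"
    and one: "P (1\<^sub>m 27)"
    and step: "\<And>h g. h \<in> H \<Longrightarrow> g \<in> generate GL27 H \<Longrightarrow> P g \<Longrightarrow> P (h * g)"
  shows "P g"
proof -
  have "g \<in> generate GL27 H \<and> (\<forall>y\<in>generate GL27 H. P y \<longrightarrow> P (g * y))"
    using g
  proof induction
    case one
    have "1\<^sub>m 27 * y = y" if "y \<in> generate GL27 H" for y
      using that H GL_carrier_mat generate_carrier left_mult_one_mat by metis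
    then show ?case by (simp add: GL_one generate_one)
  next
    case (incl h)
    then show ?case using step by (auto intro: generate.incl)
  next
    case (inv h)
    then show ?case using step assms(3) by (auto intro: generate.inv)
  next
    case (eng h1 h2)
    have "P ((h1 * h2) * y)" if "y \<in> generate GL27 H" "P y" for y
    proof -
      have "h2 * y \<in> generate GL27 H" using generate_mult eng that by blast
      then have "P (h1 * (h2 * y))" using eng that by blast
      then show ?thesis using GL_assoc[of h1 h2 y] generate_carrier[OF H] eng that by simp
    qed
    then show ?case using eng by (auto simp: GL_mult intro: generate_mult)
  qed
  then have "P (g * 1\<^sub>m 27)" using one generate_one by blast
  then show ?thesis using right_mult_one_mat[OF GL_carrier_mat[OF generate_carrier[OF H g]]] by simp
qed

lemma one_carrier27: "1\<^sub>m 27 \<in> carrier_mat 27 27" by simp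

lemma coroot_GL:
  assumes "u \<noteq> 0"
  shows "coroot \<beta> u \<in> carrier GL27" "inv\<^bsub>GL27\<^esub> (coroot \<beta> u) = coroot \<beta> (1 / u)"
proof -
  have "coroot \<beta> a * coroot \<beta> b = 1\<^sub>m 27" if "a * b = 1" for a b :: 'a
  proof -
    have "a \<noteq> 0" "b \<noteq> 0" using that by auto
    from coroot_mult[OF this one_carrier27, of \<beta>] show ?thesis
      by (simp add: that coroot_one right_mult_one_mat[OF coroot_carrier])
  qed
  from this[of u "1 / u"] this[of "1 / u" u] assms
  have "coroot \<beta> u * coroot \<beta> (1 / u) = 1\<^sub>m 27" "coroot \<beta> (1 / u) * coroot \<beta> u = 1\<^sub>m 27"
    by simp_all
  from GL_I[OF coroot_carrier coroot_carrier this]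
  show "coroot \<beta> u \<in> carrier GL27" "inv\<^bsub>GL27\<^esub> (coroot \<beta> u) = coroot \<beta> (1 / u)" .
qed

context chevalley
begin

lemma x_GL:
  assumes \<beta>: "\<beta> \<in> roots"
  shows "x \<beta> t \<in> carrier GL27" "inv\<^bsub>GL27\<^esub> (x \<beta> t) = x \<beta> (- t)"
proof -
  have "x \<beta> a * x \<beta> b = 1\<^sub>m 27" if "a + b = 0" for a b
    using x_add[OF \<beta> one_carrier27, of a b]
    by (simp add: that x_zero[OF \<beta>] right_mult_one_mat[OF x_carrier[OF \<beta>]])
  from this[of t "- t"] this[of "- t" t]
  have "x \<beta> t * x \<beta> (- t) = 1\<^sub>m 27" "x \<beta> (- t) * x \<beta> t = 1\<^sub>m 27" by simp_all
  from GL_I[OF x_carrier[OF \<beta>] x_carrier[OF \<beta>] this]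
  show "x \<beta> t \<in> carrier GL27" "inv\<^bsub>GL27\<^esub> (x \<beta> t) = x \<beta> (- t)" .
qed

definition levi_gens :: "'a mat set" where
  "levi_gens = {simple_coroot i t | i t. i \<in> {1..6} \<and> t \<noteq> 0} \<union>
      {x \<beta> t | \<beta> t. \<beta> \<in> roots \<and> coeff_at \<beta> 2 = 0}"

text \<open>
  The same construction yields the unipotent radical, its opposite and the root elements of the Levi
  factor, by a condition on the coefficient on the second simple root.
\<close>
definition unip_gens :: "(int \<Rightarrow> bool) \<Rightarrow> 'a mat set" where
  "unip_gens P = {x \<beta> t | \<beta> t. \<beta> \<in> roots \<and> P (coeff_at \<beta> 2)}"

definition torus_gens :: "'a mat set" where
  "torus_gens = {simple_coroot i t | i t. i \<in> {1..6} \<and> t \<noteq> 0}"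

abbreviation "M \<equiv> levi_M x"
abbreviation "unip P \<equiv> generate GL27 (unip_gens P)"
abbreviation "torus \<equiv> generate GL27 torus_gens"

lemma M_eq: "M = generate GL27 levi_gens"
  by (simp add: levi_M_def levi_gens_def)

lemma N_eq: "unip_N x = unip (\<lambda>k. k > 0)" and opp_N_eq: "opp_N x = unip (\<lambda>k. k < 0)"
  by (simp_all add: unip_N_def opp_N_def unip_gens_def)

lemma torus_gens_GL: "torus_gens \<subseteq> carrier GL27" "h \<in> torus_gens \<Longrightarrow> inv\<^bsub>GL27\<^esub> h \<in> torus_gens"
proof -
  have *: "h \<in> carrier GL27 \<and> inv\<^bsub>GL27\<^esub> h \<in> torus_gens" if h_gen: "h \<in> torus_gens" for h
  proof -
    obtain i t where h: "h = simple_coroot i t" "i \<in> {1..6}" "t \<noteq> 0"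
      using h_gen unfolding torus_gens_def by blast
    have "inv\<^bsub>GL27\<^esub> h = simple_coroot i (1 / t)" "h \<in> carrier GL27"
      using coroot_GL[OF h(3)] unfolding h(1) simple_coroot_eq[OF h(2)] by simp_all
    then show ?thesis using h(2,3) unfolding torus_gens_def
      by (metis (mono_tags, lifting) divide_eq_0_iff one_neq_zero mem_Collect_eq)
  qed
  show "torus_gens \<subseteq> carrier GL27" "h \<in> torus_gens \<Longrightarrow> inv\<^bsub>GL27\<^esub> h \<in> torus_gens"
    using * by blast+
qed

lemma unip_gens_GL: "unip_gens P \<subseteq> carrier GL27" "h \<in> unip_gens P \<Longrightarrow> inv\<^bsub>GL27\<^esub> h \<in> unip_gens P"
proof -
  show "unip_gens P \<subseteq> carrier GL27" unfolding unip_gens_def using x_GL(1) by blast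
  assume "h \<in> unip_gens P"
  then obtain \<beta> t where \<beta>: "h = x \<beta> t" "\<beta> \<in> roots" "P (coeff_at \<beta> 2)"
    unfolding unip_gens_def by blast
  then have "inv\<^bsub>GL27\<^esub> h = x \<beta> (- t)" using x_GL(2) by simp
  then show "inv\<^bsub>GL27\<^esub> h \<in> unip_gens P" unfolding unip_gens_def using \<beta> by blast
qed

lemma levi_gens_union: "levi_gens = torus_gens \<union> unip_gens (\<lambda>k. k = 0)"
  by (simp add: levi_gens_def torus_gens_def unip_gens_def)

lemma levi_gens_GL: "levi_gens \<subseteq> carrier GL27" "h \<in> levi_gens \<Longrightarrow> inv\<^bsub>GL27\<^esub> h \<in> levi_gens"
  unfolding levi_gens_union using torus_gens_GL unip_gens_GL by blast+

lemma torus_subset_M: "torus \<subseteq> M"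
  unfolding M_eq levi_gens_union by (rule group.mono_generate[OF GL_group]) simp

lemma M_closed: "a \<in> M \<Longrightarrow> b \<in> M \<Longrightarrow> a * b \<in> M" "1\<^sub>m 27 \<in> M" "a \<in> M \<Longrightarrow> inv\<^bsub>GL27\<^esub> a \<in> M"
  and M_GL: "a \<in> M \<Longrightarrow> a \<in> carrier GL27"
  unfolding M_eq
  using generate_mult generate_one generate_inv[OF levi_gens_GL(1)] generate_carrier[OF levi_gens_GL(1)]
  by blast+

lemma unip_GL: "a \<in> unip P \<Longrightarrow> a \<in> carrier GL27"
  using generate_carrier[OF unip_gens_GL(1)] by blast

lemma torus_GL: "a \<in> torus \<Longrightarrow> a \<in> carrier GL27"
  using generate_carrier[OF torus_gens_GL(1)] by blast

lemma x_unip: "\<beta> \<in> roots \<Longrightarrow> P (coeff_at \<beta> 2) \<Longrightarrow> x \<beta> t \<in> unip P"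
  by (rule generate.incl) (auto simp: unip_gens_def)

lemma x_M: "\<beta> \<in> roots \<Longrightarrow> coeff_at \<beta> 2 = 0 \<Longrightarrow> x \<beta> t \<in> M"
  unfolding M_eq by (rule generate.incl) (auto simp: levi_gens_def)

text \<open>
  The exponent, the pairing with \<open>\<beta>\<close>, is a sum over the simple coroots with the coefficients of \<open>\<beta>\<close>.
\<close>
lemma coroot_torus:
  assumes u: "u \<noteq> 0" shows "coroot \<beta> u \<in> torus"
proof -
  define D where "D f = mat 27 27 (\<lambda>(r, s). if r = s then u powi f r else 0)" for f :: "nat \<Rightarrow> int"
  have D: "D f \<in> carrier_mat 27 27" for f by (simp add: D_def)
  have mult: "D f * D g = D (\<lambda>r. f r + g r)" for f g
  proof (rule mat27_eqI)
    fix r s :: nat assume b: "r < 27" "s < 27"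
    have "(D f * D g) $$ (r, s) = D f $$ (r, r) * D g $$ (r, s)"
      by (rule mult_entry_single[OF D D b b(1)]) (simp add: D_def b)
    then show "(D f * D g) $$ (r, s) = D (\<lambda>r. f r + g r) $$ (r, s)"
      using b u by (simp add: D_def power_int_add)
  qed (use D mult_carrier_mat in blast)+
  have "D (\<lambda>r. \<Sum>i=1..k. coeff_at \<beta> i * weight_coord r i) \<in> torus" if "k \<le> 6" for k
    using that
  proof (induction k)
    case 0
    have "D (\<lambda>r. \<Sum>i=1..0. coeff_at \<beta> i * weight_coord r i) = 1\<^sub>m 27"
      by (rule mat27_eqI) (auto simp: D_def)
    then show ?case by (simp add: generate_one)
  next
    case (Suc k)
    have k: "Suc k \<in> {1..6}" using Suc.prems by simp
    have nz: "u powi coeff_at \<beta> (Suc k) \<noteq> 0" using u by simp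
    have "D (\<lambda>r. coeff_at \<beta> (Suc k) * weight_coord r (Suc k))
        = simple_coroot (Suc k) (u powi coeff_at \<beta> (Suc k))"
      by (rule mat27_eqI) (auto simp: D_def simple_coroot_def weight_coord_def power_int_mult)
    also have "\<dots> \<in> torus" by (rule generate.incl) (use k nz in \<open>unfold torus_gens_def, blast\<close>)
    finally have "D (\<lambda>r. \<Sum>i=1..k. coeff_at \<beta> i * weight_coord r i)
        * D (\<lambda>r. coeff_at \<beta> (Suc k) * weight_coord r (Suc k)) \<in> torus"
      using Suc by (intro generate_mult) auto
    then show ?case by (simp add: mult)
  qed
  from this[of 6] have "D (\<lambda>r. pairing \<beta> r) \<in> torus" by (simp add: pairing_def)
  moreover have "D (\<lambda>r. pairing \<beta> r) = coroot \<beta> u" by (simp add: D_def coroot_def)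
  ultimately show ?thesis by simp
qed

lemma coroot_M: "u \<noteq> 0 \<Longrightarrow> coroot \<beta> u \<in> M"
  using coroot_torus torus_subset_M by blast

text \<open>
  Commuting \<open>x \<beta> t\<close> past a root element of \<open>M\<close> produces at most one more root, and it has the same
  coefficient on the second simple root as \<open>\<beta>\<close>.
\<close>
lemma levi_gen_normalizes:
  assumes P: "\<not> P 0" and h: "h \<in> levi_gens" and \<beta>: "\<beta> \<in> roots" "P (coeff_at \<beta> 2)"
  shows "\<exists>y\<in>unip P. h * x \<beta> t = y * h"
proof -
  have y: "x \<beta> s \<in> unip P" for s using x_unip[where P = P, OF \<beta>] .
  have one: "x \<gamma> s * 1\<^sub>m 27 = x \<gamma> s" if "\<gamma> \<in> roots" for \<gamma> s
    using right_mult_one_mat[OF x_carrier[OF that]] .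
  consider (torus) i u where "h = simple_coroot i u" "i \<in> {1..6}" "u \<noteq> 0"
    | (root) \<alpha> s where "h = x \<alpha> s" "\<alpha> \<in> roots" "coeff_at \<alpha> 2 = 0"
    using h by (auto simp: levi_gens_def)
  then show ?thesis
  proof cases
    case torus
    from coroot_x[OF \<beta>(1) torus(3) one_carrier27, of "simple_root i" t] y show ?thesis
      unfolding torus(1) simple_coroot_eq[OF torus(2)]
      by (auto simp: one[OF \<beta>(1)] right_mult_one_mat[OF coroot_carrier])
  next
    case root
    note \<alpha> = root(2)
    have ne: "\<alpha> \<noteq> \<beta>" using P root(3) \<beta> by auto
    have "coeff_at (neg_root \<beta>) 2 \<noteq> 0" using P \<beta> coeff_at_neg[OF roots_length[OF \<beta>(1)], of 2] by auto
    then have "\<alpha> \<noteq> neg_root \<beta>" using root(3) by auto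
    with root_form_cases[OF \<alpha> \<beta>(1) ne] consider "root_form \<alpha> \<beta> \<in> {0, 1}" | "root_form \<alpha> \<beta> = - 1" by auto
    then show ?thesis
    proof cases
      case 1
      from x_commute[OF \<alpha> \<beta>(1) 1 one_carrier27, of s t] y show ?thesis
        unfolding root(1) by (auto simp: one \<alpha> \<beta>(1))
    next
      case 2
      let ?\<gamma> = "reflect \<alpha> \<beta>"
      have \<gamma>: "?\<gamma> \<in> roots" using \<alpha> \<beta>(1) by (rule roots.reflect)
      have "coeff_at ?\<gamma> 2 = coeff_at \<beta> 2"
        using coeff_at_reflect[OF roots_length[OF \<alpha>] roots_length[OF \<beta>(1)], of 2] root(3) by simp
      then have \<gamma>u: "x ?\<gamma> r \<in> unip P" for r using x_unip[where P = P, OF \<gamma>] \<beta>(2) by simp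
      obtain \<epsilon> where e: "(\<epsilon> = 1 \<or> \<epsilon> = - 1) \<and> (\<forall>s t. \<forall>X\<in>carrier_mat 27 27.
          x \<alpha> s * (x \<beta> t * X) = x \<beta> t * (x ?\<gamma> (\<epsilon> * s * t) * (x \<alpha> s * X)))"
        using x_commutator[OF \<alpha> \<beta>(1) 2] ..
      have "x \<alpha> s * x \<beta> t = x \<beta> t * (x ?\<gamma> (\<epsilon> * s * t) * x \<alpha> s)"
        using bspec[OF spec[OF spec[OF conjunct2[OF e]]] one_carrier27, of s t] by (simp add: one \<alpha> \<beta>(1))
      also have "\<dots> = (x \<beta> t * x ?\<gamma> (\<epsilon> * s * t)) * x \<alpha> s"
        using mult_assoc27[OF x_carrier[OF \<beta>(1)] x_carrier[OF \<gamma>] x_carrier[OF \<alpha>]] by simp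
      finally show ?thesis unfolding root(1) using generate_mult[OF y \<gamma>u] by blast
    qed
  qed
qed

lemma M_normalizes:
  assumes P: "\<not> P 0" and m: "m \<in> M" and n: "n \<in> unip P"
  shows "\<exists>n'\<in>unip P. m * n = n' * m"
proof -
  have gen: "\<exists>n'\<in>unip P. h * n = n' * h" if h: "h \<in> levi_gens" and n: "n \<in> unip P" for h n
    using n
  proof (rule generate_induct_left[OF _ unip_gens_GL])
    have "h \<in> carrier_mat 27 27" using h levi_gens_GL GL_carrier_mat by blast
    then have "h * 1\<^sub>m 27 = 1\<^sub>m 27 * h" by simp
    then show "\<exists>n'\<in>unip P. h * 1\<^sub>m 27 = n' * h" using generate_one by blast
  next
    fix y n0 assume y: "y \<in> unip_gens P" and n0: "n0 \<in> unip P" and "\<exists>n'\<in>unip P. h * n0 = n' * h"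
    then obtain n1 where n1: "n1 \<in> unip P" "h * n0 = n1 * h" by blast
    obtain y1 where y1: "y1 \<in> unip P" "h * y = y1 * h"
      using y levi_gen_normalizes[where P = P, OF P h] by (auto simp: unip_gens_def)
    note GL = subsetD[OF levi_gens_GL(1) h] subsetD[OF unip_gens_GL(1) y] unip_GL[OF n0] unip_GL[OF n1(1)]
      unip_GL[OF y1(1)]
    have "h * (y * n0) = (h * y) * n0" using GL by (simp add: GL_assoc)
    also have "\<dots> = y1 * (h * n0)" using GL by (simp add: GL_assoc y1(2))
    also have "\<dots> = (y1 * n1) * h" using GL by (simp add: GL_assoc n1(2))
    finally show "\<exists>n'\<in>unip P. h * (y * n0) = n' * h" using generate_mult[OF y1(1) n1(1)] by blast
  qed
  have "\<forall>n\<in>unip P. \<exists>n'\<in>unip P. m * n = n' * m"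
    using m unfolding M_eq
  proof (rule generate_induct_left[OF _ levi_gens_GL])
    have "1\<^sub>m 27 * n = n * 1\<^sub>m 27" if "n \<in> unip P" for n
      using GL_carrier_mat[OF unip_GL[OF that]] by simp
    then show "\<forall>n\<in>unip P. \<exists>n'\<in>unip P. 1\<^sub>m 27 * n = n' * 1\<^sub>m 27" by blast
  next
    fix h g assume h: "h \<in> levi_gens" and g: "g \<in> generate GL27 levi_gens"
      and IH: "\<forall>n\<in>unip P. \<exists>n'\<in>unip P. g * n = n' * g"
    show "\<forall>n\<in>unip P. \<exists>n'\<in>unip P. (h * g) * n = n' * (h * g)"
    proof
      fix n assume n: "n \<in> unip P"
      obtain n1 where n1: "n1 \<in> unip P" "g * n = n1 * g" using IH n by blast
      obtain n2 where n2: "n2 \<in> unip P" "h * n1 = n2 * h" using gen[OF h n1(1)] by blast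
      note GL = subsetD[OF levi_gens_GL(1) h] generate_carrier[OF levi_gens_GL(1) g] unip_GL[OF n]
        unip_GL[OF n1(1)] unip_GL[OF n2(1)]
      have "(h * g) * n = (h * n1) * g" using GL by (simp add: GL_assoc n1(2))
      also have "\<dots> = n2 * (h * g)" using GL by (simp add: GL_assoc n2(2))
      finally show "\<exists>n'\<in>unip P. (h * g) * n = n' * (h * g)" using n2(1) by blast
    qed
  qed
  then show ?thesis using n by blast
qed

lemma M_normalizes_right:
  assumes P: "\<not> P 0" and m: "m \<in> M" and n: "n \<in> unip P"
  shows "\<exists>n'\<in>unip P. n * m = m * n'"
proof -
  let ?i = "inv\<^bsub>GL27\<^esub> m"
  obtain n' where n': "n' \<in> unip P" "?i * n = n' * ?i"
    using M_normalizes[OF P M_closed(3)[OF m] n] by blast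
  note mGL = M_GL[OF m]
  note GL = mGL GL_inv(1)[OF mGL] unip_GL[OF n] unip_GL[OF n'(1)]
  have "n * m = (m * ?i) * (n * m)"
    unfolding GL_inv(2)[OF mGL]
    using left_mult_one_mat[OF GL_carrier_mat[OF GL_mult_closed[OF GL(3) GL(1)]]] by (rule sym)
  also have "\<dots> = m * ((?i * n) * m)" using GL by (simp add: GL_assoc GL_mult_closed)
  also have "\<dots> = m * (n' * (?i * m))" unfolding n'(2) using GL by (simp add: GL_assoc)
  also have "\<dots> = m * n'" using GL_carrier_mat[OF GL(4)] by (simp add: GL_inv[OF mGL])
  finally show ?thesis using n'(1) by blast
qed

section \<open>Products with a known Levi component\<close>

abbreviation "component \<equiv> is_M_component x"

lemma component_M:
  assumes "component g m" "a \<in> M" shows "component (a * g) (a * m)"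
proof -
  obtain n b where *: "m \<in> M" "n \<in> unip_N x" "b \<in> opp_N x" "g = m * n * b"
    using assms(1) by (auto simp: is_M_component_def)
  have GL: "a \<in> carrier GL27" "m \<in> carrier GL27" "n \<in> carrier GL27" "b \<in> carrier GL27"
    using M_GL assms(2) * unip_GL unfolding N_eq opp_N_eq by blast+
  have "a * g = a * m * n * b" using GL by (simp add: *(4) GL_assoc GL_mult_closed)
  then show ?thesis using * M_closed assms(2) by (auto simp: is_M_component_def)
qed

text \<open>
  Since \<open>M\<close> normalizes \<open>N\<close>, a factor from \<open>N\<close> on the left can be moved past \<open>m\<close> into the \<open>N\<close>-part.
\<close>
lemma component_N:
  assumes "component g m" "a \<in> unip_N x" shows "component (a * g) m"
proof -
  obtain n b where *: "m \<in> M" "n \<in> unip_N x" "b \<in> opp_N x" "g = m * n * b"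
    using assms(1) by (auto simp: is_M_component_def)
  obtain a' where a': "a' \<in> unip_N x" "a * m = m * a'"
    using M_normalizes_right[of "\<lambda>k. k > 0", OF _ *(1)] assms(2) unfolding N_eq by auto
  have GL: "a \<in> carrier GL27" "m \<in> carrier GL27" "n \<in> carrier GL27" "b \<in> carrier GL27" "a' \<in> carrier GL27"
    using M_GL assms(2) * a'(1) unip_GL unfolding N_eq opp_N_eq by blast+
  have "a * g = (a * m) * (n * b)" using GL by (simp add: *(4) GL_assoc GL_mult_closed)
  also have "\<dots> = m * (a' * n) * b" using GL by (simp add: a'(2) GL_assoc GL_mult_closed)
  finally show ?thesis using * generate_mult a'(1) unfolding is_M_component_def N_eq by blast
qed

text \<open>
  Membership in the opposite parabolic, with Levi part \<open>m\<close>. Products are read from the right: factors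
  from \<open>M\<close> and the opposite of \<open>N\<close> are collected first, and factors from \<open>N\<close> and \<open>M\<close> after that.
\<close>
definition opposite_parabolic :: "'a mat \<Rightarrow> 'a mat \<Rightarrow> bool" where
  "opposite_parabolic g m \<longleftrightarrow> m \<in> M \<and> (\<exists>b\<in>opp_N x. g = m * b)"

lemma opposite_parabolic_one: "opposite_parabolic (1\<^sub>m 27) (1\<^sub>m 27)"
  unfolding opposite_parabolic_def opp_N_eq
  by (intro conjI M_closed(2) bexI[of _ "1\<^sub>m 27"] generate_one) simp

lemma opposite_parabolic_M:
  assumes "opposite_parabolic g m" "a \<in> M" shows "opposite_parabolic (a * g) (a * m)"
proof -
  obtain b where *: "m \<in> M" "b \<in> opp_N x" "g = m * b"
    using assms(1) by (auto simp: opposite_parabolic_def)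
  have GL: "a \<in> carrier GL27" "m \<in> carrier GL27" "b \<in> carrier GL27"
    using M_GL assms(2) * unip_GL unfolding opp_N_eq by blast+
  have "a * g = a * m * b" using GL by (simp add: *(3) GL_assoc)
  then show ?thesis using * M_closed assms(2) by (auto simp: opposite_parabolic_def)
qed

lemma opposite_parabolic_opp_N:
  assumes "opposite_parabolic g m" "a \<in> opp_N x" shows "opposite_parabolic (a * g) m"
proof -
  obtain b where *: "m \<in> M" "b \<in> opp_N x" "g = m * b"
    using assms(1) by (auto simp: opposite_parabolic_def)
  obtain a' where a': "a' \<in> opp_N x" "a * m = m * a'"
    using M_normalizes_right[of "\<lambda>k. k < 0", OF _ *(1)] assms(2) unfolding opp_N_eq by auto
  have GL: "a \<in> carrier GL27" "m \<in> carrier GL27" "b \<in> carrier GL27" "a' \<in> carrier GL27"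
    using M_GL assms(2) * a'(1) unip_GL unfolding opp_N_eq by blast+
  have "a * g = (a * m) * b" using GL by (simp add: *(3) GL_assoc)
  also have "\<dots> = m * (a' * b)" using GL by (simp add: a'(2) GL_assoc)
  finally show ?thesis using * generate_mult a'(1) unfolding opposite_parabolic_def opp_N_eq by blast
qed

lemma opposite_parabolic_component:
  assumes "opposite_parabolic g m" shows "component g m"
proof -
  obtain b where *: "m \<in> M" "b \<in> opp_N x" "g = m * b"
    using assms(1) by (auto simp: opposite_parabolic_def)
  have "m * 1\<^sub>m 27 = m" using right_mult_one_mat[OF GL_carrier_mat[OF M_GL[OF *(1)]]] .
  then show ?thesis using * generate_one unfolding is_M_component_def N_eq by metis
qed

section \<open>Block form with respect to the levels\<close>

lemma M_block:
  assumes "m \<in> M" "r < 27" "s < 27" "level r \<noteq> level s" shows "m $$ (r, s) = 0"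
proof -
  have "m \<in> carrier_mat 27 27 \<and> (\<forall>r<27. \<forall>s<27. level r \<noteq> level s \<longrightarrow> m $$ (r, s) = 0)"
    using assms(1) unfolding M_eq
  proof (rule generate_induct_left[OF _ levi_gens_GL])
    fix h g :: "'a mat" assume h: "h \<in> levi_gens" and
      g: "g \<in> carrier_mat 27 27 \<and> (\<forall>r<27. \<forall>s<27. level r \<noteq> level s \<longrightarrow> g $$ (r, s) = 0)"
    have "(h * g) $$ (r, s) = 0" if b: "r < 27" "s < 27" "level r \<noteq> level s" for r s
    proof -
      consider (torus) i u where "h = simple_coroot i u" "i \<in> {1..6}"
        | (root) \<alpha> t where "h = x \<alpha> t" "\<alpha> \<in> roots" "coeff_at \<alpha> 2 = 0"
        using h by (auto simp: levi_gens_def)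
      then show ?thesis
      proof cases
        case torus
        then show ?thesis using g b by (simp add: simple_coroot_eq coroot_row del: atLeastAtMost_iff)
      next
        case root
        note \<alpha> = root(2)
        show ?thesis
        proof (cases "pairing \<alpha> r = 1")
          case True
          then obtain q where l: "link \<alpha> q r" using link_to[OF \<alpha> b(1)] by blast
          then have "q < 27" "level r = level q" using link_level[OF \<alpha> l] root(3) link_bound[OF l] by auto
          then show ?thesis using g b by (simp add: root(1) x_row_link[OF \<alpha> \<alpha> l])
        next
          case False
          then show ?thesis using g b by (simp add: root(1) x_row_other[OF \<alpha> \<alpha>])
        qed
      qed
    qed
    moreover have "h * g \<in> carrier_mat 27 27"
      using h levi_gens_GL(1) GL_carrier_mat g mult_carrier27 by blast
    ultimately show "h * g \<in> carrier_mat 27 27 \<and> (\<forall>r<27. \<forall>s<27. level r \<noteq> level s \<longrightarrow> (h * g) $$ (r, s) = 0)"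
      by blast
  qed auto
  then show ?thesis using assms by blast
qed

text \<open>
  The factor \<open>\<sigma>\<close>, 1 or -1, treats elements that raise and elements that lower the level at once.
\<close>
lemma unip_block:
  assumes n: "n \<in> unip P" and \<sigma>: "\<And>k. P k \<Longrightarrow> 0 < \<sigma> * k"
    and b: "r < 27" "s < 27" "\<sigma> * level r \<le> \<sigma> * level s"
  shows "n $$ (r, s) = (if r = s then 1 else 0)"
proof -
  let ?Q = "\<lambda>n :: 'a mat. n \<in> carrier_mat 27 27 \<and> (\<forall>r<27. \<forall>s<27. \<sigma> * level r \<le> \<sigma> * level s \<longrightarrow>
      n $$ (r, s) = (if r = s then 1 else 0))"
  have "?Q n"
    using n
  proof (rule generate_induct_left[OF _ unip_gens_GL])
    fix h g :: "'a mat" assume h: "h \<in> unip_gens P" and g: "?Q g"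
    obtain \<beta> t where \<beta>: "h = x \<beta> t" "\<beta> \<in> roots" "P (coeff_at \<beta> 2)"
      using h by (auto simp: unip_gens_def)
    have "(h * g) $$ (r, s) = (if r = s then 1 else 0)"
      if b: "r < 27" "s < 27" "\<sigma> * level r \<le> \<sigma> * level s" for r s
    proof (cases "pairing \<beta> r = 1")
      case True
      then obtain q where l: "link \<beta> q r" using link_to[OF \<beta>(2) b(1)] by blast
      then have q: "q < 27" "\<sigma> * level q < \<sigma> * level r"
        using link_level[OF \<beta>(2) l] \<sigma>[OF \<beta>(3)] link_bound[OF l] by (auto simp: distrib_left)
      then have "q \<noteq> s" "\<sigma> * level q \<le> \<sigma> * level s" using b(3) by auto
      then have "g $$ (q, s) = 0" using g q b by simp
      then show ?thesis using g b by (simp add: \<beta>(1) x_row_link[OF \<beta>(2) \<beta>(2) l])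
    next
      case False
      then show ?thesis using g b by (simp add: \<beta>(1) x_row_other[OF \<beta>(2) \<beta>(2)])
    qed
    then show "?Q (h * g)" using xm_carrier[OF \<beta>(2)] g \<beta>(1) by blast
  qed auto
  then show ?thesis using b by blast
qed

lemma N_block:
  "n \<in> unip_N x \<Longrightarrow> r < 27 \<Longrightarrow> s < 27 \<Longrightarrow> level r \<le> level s \<Longrightarrow> n $$ (r, s) = (if r = s then 1 else 0)"
  unfolding N_eq by (rule unip_block[where \<sigma> = 1]) auto

lemma opp_N_block:
  "n \<in> opp_N x \<Longrightarrow> r < 27 \<Longrightarrow> s < 27 \<Longrightarrow> level s \<le> level r \<Longrightarrow> n $$ (r, s) = (if r = s then 1 else 0)"
  unfolding opp_N_eq by (rule unip_block[where \<sigma> = "- 1"]) auto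

text \<open>
  For two decompositions, moving factors across gives \<open>m n = b\<close> with \<open>m\<close> the quotient of the two
  components, \<open>n\<close> in \<open>N\<close> and \<open>b\<close> in its opposite. On each level the left side has the diagonal block
  of \<open>m\<close> and the right side the identity.
\<close>
lemma component_unique:
  assumes "component g m1" "component g m2" shows "m1 = m2"
proof -
  obtain n1 b1 where 1: "m1 \<in> M" "n1 \<in> unip_N x" "b1 \<in> opp_N x" "g = m1 * n1 * b1"
    using assms(1) by (auto simp: is_M_component_def)
  obtain n2 b2 where 2: "m2 \<in> M" "n2 \<in> unip_N x" "b2 \<in> opp_N x" "g = m2 * n2 * b2"
    using assms(2) by (auto simp: is_M_component_def)
  let ?i = "\<lambda>a. inv\<^bsub>GL27\<^esub> a"
  have GL: "m1 \<in> carrier GL27" "n1 \<in> carrier GL27" "b1 \<in> carrier GL27"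
    "m2 \<in> carrier GL27" "n2 \<in> carrier GL27" "b2 \<in> carrier GL27"
    using 1 2 M_GL unip_GL unfolding N_eq opp_N_eq by blast+
  note I = GL_inv(1)[OF GL(1)] GL_inv(1)[OF GL(2)] GL_inv(1)[OF GL(3)] GL_inv(1)[OF GL(4)]
    GL_inv(1)[OF GL(5)] GL_inv(1)[OF GL(6)]
  have one: "1\<^sub>m 27 * A = A" "A * 1\<^sub>m 27 = A" if "A \<in> carrier GL27" for A :: "'a mat"
    using GL_carrier_mat[OF that] by simp_all
  have inN: "?i n2 \<in> unip_N x" using 2 generate_inv[OF unip_gens_GL(1)] unfolding N_eq by blast
  have inB: "b2 * ?i b1 \<in> opp_N x"
    using 1 2 generate_inv[OF unip_gens_GL(1)] generate_mult unfolding opp_N_eq by blast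
  define m where "m = ?i m2 * m1"
  have m: "m \<in> M" unfolding m_def using M_closed 1 2 by blast
  note mGL = M_GL[OF m]
  obtain n3 where n3: "n3 \<in> unip_N x" "?i n2 * m = m * n3"
    using M_normalizes_right[of "\<lambda>k. k > 0", OF _ m] inN unfolding N_eq by auto
  have n: "n3 * n1 \<in> unip_N x" using n3 1 generate_mult unfolding N_eq by blast
  have GL3: "n3 \<in> carrier GL27" using n3(1) unip_GL unfolding N_eq by blast
  have e: "m1 * (n1 * b1) = m2 * (n2 * b2)" using 1(4) 2(4) GL by (simp add: GL_assoc)
  have "m * (n1 * b1) = ?i m2 * (m2 * (n2 * b2))"
    unfolding e[symmetric] m_def using GL I by (simp add: GL_assoc GL_mult_closed)
  also have "\<dots> = (?i m2 * m2) * (n2 * b2)" using GL I by (simp add: GL_assoc GL_mult_closed)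
  also have "\<dots> = n2 * b2" using GL by (simp add: GL_inv one GL_mult_closed)
  finally have "?i n2 * (m * (n1 * b1)) = ?i n2 * (n2 * b2)" by simp
  moreover have "?i n2 * (n2 * b2) = (?i n2 * n2) * b2" using GL I by (simp add: GL_assoc)
  moreover have "?i n2 * (m * (n1 * b1)) = (?i n2 * m) * (n1 * b1)"
    using GL I mGL by (simp add: GL_assoc GL_mult_closed)
  ultimately have "m * (n3 * (n1 * b1)) = b2"
    using GL GL3 mGL by (simp add: GL_inv one n3(2) GL_assoc GL_mult_closed)
  then have "m * (n3 * (n1 * b1)) * ?i b1 = b2 * ?i b1" by simp
  then have "m * ((n3 * n1) * (b1 * ?i b1)) = b2 * ?i b1"
    using GL GL3 mGL I by (simp add: GL_assoc GL_mult_closed)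
  then have key: "m * (n3 * n1) = b2 * ?i b1" using GL GL3 by (simp add: GL_inv one GL_mult_closed)
  have "m = 1\<^sub>m 27"
  proof (rule mat27_eqI[OF GL_carrier_mat[OF mGL] one_carrier27])
    fix r s :: nat assume b: "r < 27" "s < 27"
    show "m $$ (r, s) = 1\<^sub>m 27 $$ (r, s)"
    proof (cases "level r = level s")
      case True
      have nC: "n3 * n1 \<in> carrier_mat 27 27" using GL GL3 GL_carrier_mat GL_mult_closed by blast
      have "m $$ (r, p) = 0 \<or> (n3 * n1) $$ (p, s) = 0" if "p < 27" "p \<noteq> s" for p
        using M_block[OF m b(1) that(1)] N_block[OF n that(1) b(2)] that(2) True
        by (cases "level p = level s") auto
      then have "(m * (n3 * n1)) $$ (r, s) = m $$ (r, s) * (n3 * n1) $$ (s, s)"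
        using mult_entry_single[OF GL_carrier_mat[OF mGL] nC b b(2)] by blast
      also have "\<dots> = m $$ (r, s)" using N_block[OF n b(2) b(2)] by simp
      finally show ?thesis unfolding key using opp_N_block[OF inB b] True b by simp
    next
      case False
      then show ?thesis using M_block[OF m b] b by auto
    qed
  qed
  then have "m2 * m = m2" using one GL by simp
  moreover have "m2 * m = (m2 * ?i m2) * m1" unfolding m_def using GL I by (simp add: GL_assoc)
  ultimately show ?thesis using GL by (simp add: GL_inv one)
qed

text \<open>
  A row of the lowest level sees only the diagonal block of \<open>m\<close> and, since \<open>n'\<close> only raises levels,
  the identity block of \<open>n'\<close>; and a column of the lowest level sees only the identity block of the
  last factor.
\<close>
lemma component_low_block:
  assumes "component g m" and b: "r < 27" "s < 27" and low: "level r = - 1" "level s = - 1"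
  shows "g $$ (r, s) = m $$ (r, s)"
proof -
  obtain n' b' where *: "m \<in> M" "n' \<in> unip_N x" "b' \<in> opp_N x" "g = m * n' * b'"
    using assms(1) by (auto simp: is_M_component_def)
  have C: "m \<in> carrier_mat 27 27" "n' \<in> carrier_mat 27 27" "b' \<in> carrier_mat 27 27"
    using * M_GL unip_GL GL_carrier_mat unfolding N_eq opp_N_eq by blast+
  have min: "level s \<le> level p" if "p < 27" for p
    using pairing_cases[OF highest_root_roots that] low by force
  have n: "(m * n') $$ (r, p) = m $$ (r, p) * n' $$ (p, p)"
    if p: "p < 27" "level p = - 1" for p
  proof (rule mult_entry_single[OF C(1,2) b(1) p(1) p(1)])
    fix q assume q: "q < 27" "q \<noteq> p"
    show "m $$ (r, q) = 0 \<or> n' $$ (q, p) = 0"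
      using M_block[OF *(1) b(1) q(1)] N_block[OF *(2) q(1) p(1)] q(2) p(2) low
      by (cases "level q = - 1") auto
  qed
  have n0: "(m * n') $$ (r, p) = 0" if p: "p < 27" "level p \<noteq> - 1" for p
  proof -
    have "m $$ (r, q) * n' $$ (q, p) = 0" if q: "q < 27" for q
    proof (cases "level q = level r")
      case True
      have "level q \<le> level p" "q \<noteq> p" using True low min[OF p(1)] p by auto
      then show ?thesis using N_block[OF *(2) q p(1)] by simp
    next
      case False
      then show ?thesis using M_block[OF *(1) b(1) q] by simp
    qed
    then show ?thesis unfolding mult_entry[OF C(1,2) b(1) p(1)] by (intro sum.neutral) auto
  qed
  have "g $$ (r, s) = (m * n') $$ (r, s) * b' $$ (s, s)"
    unfolding *(4)
  proof (rule mult_entry_single[OF mult_carrier27[OF C(1,2)] C(3) b b(2)])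
    fix q assume q: "q < 27" "q \<noteq> s"
    show "(m * n') $$ (r, q) = 0 \<or> b' $$ (q, s) = 0"
      using n0[OF q(1)] opp_N_block[OF *(3) q(1) b(2)] q(2) low
      by (cases "level q = - 1") auto
  qed
  then show ?thesis
    using n[OF b(2) low(2)] N_block[OF *(2) b(2) b(2)] opp_N_block[OF *(3) b(2) b(2)] by simp
qed

end

section \<open>The representative of the long Weyl element\<close>

lemma weight_coordinates_minus_one:
  "\<forall>i\<in>set [1..<7]. \<exists>\<mu>\<in>set minuscule_weights. \<mu> ! (i - 1) = - 1"
  by code_simp

lemma link_exists:
  assumes "\<beta> \<in> roots" shows "\<exists>s r. link \<beta> s r"
  using assms
proof induction
  case (simple i)
  then have "i \<in> set [1..<7]" by auto
  from bspec[OF weight_coordinates_minus_one this] obtain \<mu> where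
    "\<mu> \<in> set minuscule_weights" "\<mu> ! (i - 1) = - 1" ..
  then obtain s where "s < 27" "weight_coord s i = - 1"
    by (auto simp: in_set_conv_nth length_minuscule_weights weight_coord_def)
  then show ?case
    using link_from[OF roots.simple[OF simple], of s] pairing_simple[OF simple, of s] by auto
next
  case (reflect \<alpha> \<beta>)
  then obtain s r where l: "link \<beta> s r" by blast
  obtain s' r' where "mirror \<alpha> s s'" "mirror \<alpha> r r'"
    using mirror_ex[OF reflect(1)] link_bound[OF l] by metis
  from mirror_link[OF roots_length[OF reflect(1)] roots_length[OF reflect(2)] l this]
  show ?case by blast
qed

context chevalley
begin

lemma weyl_GL: "\<alpha> \<in> roots \<Longrightarrow> w \<alpha> \<in> carrier GL27"
  unfolding weyl_rep_def using x_GL(1) neg_root_roots by (simp add: GL_mult_closed)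

lemma weyl_inv:
  assumes \<alpha>: "\<alpha> \<in> roots"
  shows "w \<alpha> * w \<alpha> = coroot \<alpha> (- 1)" "inv\<^bsub>GL27\<^esub> (w \<alpha>) = coroot \<alpha> (- 1) * w \<alpha>"
proof -
  let ?c = "coroot \<alpha> (- 1) :: 'a mat"
  have one: "A * 1\<^sub>m 27 = A" if "A \<in> carrier_mat 27 27" for A :: "'a mat" using that by simp
  show sq: "w \<alpha> * w \<alpha> = ?c"
    using weyl_square[OF \<alpha> one_carrier27] by (simp add: one weyl_carrier[OF \<alpha>])
  have c: "?c * ?c = 1\<^sub>m 27"
    using coroot_mult[of "- 1 :: 'a" "- 1" "1\<^sub>m 27" \<alpha>] by (simp add: one coroot_one)
  note GL = weyl_GL[OF \<alpha>] coroot_GL(1)[of "- 1 :: 'a" \<alpha>]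
  have "w \<alpha> * (?c * w \<alpha>) = (w \<alpha> * w \<alpha>) * (w \<alpha> * w \<alpha>)"
    unfolding sq[symmetric] using GL by (simp add: GL_assoc GL_mult_closed)
  then have 1: "w \<alpha> * (?c * w \<alpha>) = 1\<^sub>m 27" unfolding sq c .
  have 2: "(?c * w \<alpha>) * w \<alpha> = 1\<^sub>m 27" using GL by (simp add: GL_assoc sq c GL_mult_closed)
  show "inv\<^bsub>GL27\<^esub> (w \<alpha>) = ?c * w \<alpha>"
    by (rule GL_I(2)[OF _ _ 1 2]) (use GL in \<open>simp_all add: GL_carrier_mat GL_mult_closed\<close>)
qed

text \<open>
  The signs for \<open>\<beta>\<close> and \<open>-\<beta>\<close> agree, because the entries of opposite root vectors coincide. With sign
  -1, all three factors of \<open>w(s\<^sub>\<alpha> \<beta>)\<close> are inverted, which gives the inverse.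
\<close>
lemma weyl_conjugate:
  assumes \<alpha>: "\<alpha> \<in> roots" and \<beta>: "\<beta> \<in> roots"
  shows "\<exists>\<omega>\<in>{w (reflect \<alpha> \<beta>), inv\<^bsub>GL27\<^esub> (w (reflect \<alpha> \<beta>))}. w \<alpha> * w \<beta> = \<omega> * w \<alpha>"
proof -
  let ?\<gamma> = "reflect \<alpha> \<beta>"
  have \<gamma>: "?\<gamma> \<in> roots" using \<alpha> \<beta> by (rule roots.reflect)
  note n\<beta> = neg_root_roots[OF \<beta>] and n\<gamma> = neg_root_roots[OF \<gamma>]
  have rn: "reflect \<alpha> (neg_root \<beta>) = neg_root ?\<gamma>"
    using reflect_neg[OF roots_length[OF \<alpha>] roots_length[OF \<beta>]] .
  obtain \<epsilon> where e: "(\<epsilon> = 1 \<or> \<epsilon> = - 1) \<and> (\<forall>t. w \<alpha> * x \<beta> t = x ?\<gamma> (\<epsilon> * t) * w \<alpha>)"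
    using weyl_axiom[OF \<alpha> \<beta>] ..
  obtain \<epsilon>' where e': "(\<epsilon>' = 1 \<or> \<epsilon>' = - 1) \<and>
      (\<forall>t. w \<alpha> * x (neg_root \<beta>) t = x (neg_root ?\<gamma>) (\<epsilon>' * t) * w \<alpha>)"
    using weyl_axiom[OF \<alpha> n\<beta>] unfolding rn ..
  have "\<epsilon>' = \<epsilon>"
  proof -
    obtain p r where l: "link \<beta> p r" using link_exists[OF \<beta>] by blast
    obtain p' r' where m: "mirror \<alpha> p p'" "mirror \<alpha> r r'"
      using mirror_ex[OF \<alpha>] link_bound[OF l] by metis
    have l': "link ?\<gamma> p' r'" using mirror_link[OF roots_length[OF \<alpha>] roots_length[OF \<beta>] l m] .
    have eq: "w \<alpha> * x \<beta> 1 = x ?\<gamma> \<epsilon> * w \<alpha>"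
      "w \<alpha> * x (neg_root \<beta>) 1 = x (reflect \<alpha> (neg_root \<beta>)) \<epsilon>' * w \<alpha>"
      using spec[OF conjunct2[OF e], of 1] spec[OF conjunct2[OF e'], of 1] by (simp_all add: rn)
    have "\<epsilon> * entry ?\<gamma> r' p' = weyl_entry \<alpha> r' r * entry \<beta> r p * weyl_entry \<alpha> p' p"
      using weyl_conjugate_entry_sign[OF \<alpha> \<beta> eq(1) l m] .
    moreover have "\<epsilon>' * entry (neg_root ?\<gamma>) p' r'
        = weyl_entry \<alpha> p' p * entry (neg_root \<beta>) p r * weyl_entry \<alpha> r' r"
      using weyl_conjugate_entry_sign[OF \<alpha> n\<beta> eq(2) link_rows(1)[OF \<beta> l] m(2,1)] unfolding rn .
    ultimately have "\<epsilon>' * entry ?\<gamma> r' p' = \<epsilon> * entry ?\<gamma> r' p'"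
      unfolding link_rows(8)[OF \<beta> l] link_rows(8)[OF \<gamma> l'] by (simp add: mult_ac)
    then show ?thesis using entry_sign_roots[OF \<gamma> l'] by auto
  qed
  have ax: "w \<alpha> * x \<beta> 1 = x ?\<gamma> \<epsilon> * w \<alpha>"
    "w \<alpha> * x (neg_root \<beta>) (- 1) = x (neg_root ?\<gamma>) (- \<epsilon>) * w \<alpha>"
    using spec[OF conjunct2[OF e], of 1] spec[OF conjunct2[OF e'], of "- 1"] \<open>\<epsilon>' = \<epsilon>\<close> by simp_all
  note GL = x_GL(1)[OF \<beta>] x_GL(1)[OF n\<beta>] x_GL(1)[OF \<gamma>] x_GL(1)[OF n\<gamma>] weyl_GL[OF \<alpha>]
  have "w \<alpha> * w \<beta> = ((w \<alpha> * x \<beta> 1) * x (neg_root \<beta>) (- 1)) * x \<beta> 1"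
    unfolding weyl_rep_def[of x \<beta>] using GL by (simp add: GL_assoc GL_mult_closed)
  also have "\<dots> = (x ?\<gamma> \<epsilon> * (w \<alpha> * x (neg_root \<beta>) (- 1))) * x \<beta> 1"
    unfolding ax(1) using GL by (simp add: GL_assoc GL_mult_closed)
  also have "\<dots> = x ?\<gamma> \<epsilon> * (x (neg_root ?\<gamma>) (- \<epsilon>) * (w \<alpha> * x \<beta> 1))"
    unfolding ax(2) using GL by (simp add: GL_assoc GL_mult_closed)
  also have "\<dots> = (x ?\<gamma> \<epsilon> * x (neg_root ?\<gamma>) (- \<epsilon>) * x ?\<gamma> \<epsilon>) * w \<alpha>"
    unfolding ax(1) using GL by (simp add: GL_assoc GL_mult_closed)
  finally have eq: "w \<alpha> * w \<beta> = (x ?\<gamma> \<epsilon> * x (neg_root ?\<gamma>) (- \<epsilon>) * x ?\<gamma> \<epsilon>) * w \<alpha>" .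
  from conjunct1[OF e] show ?thesis
  proof
    assume "\<epsilon> = 1"
    then show ?thesis using eq by (simp add: weyl_rep_def[of x ?\<gamma>])
  next
    assume "\<epsilon> = - 1"
    moreover have "inv\<^bsub>GL27\<^esub> (w ?\<gamma>) = x ?\<gamma> (- 1) * x (neg_root ?\<gamma>) 1 * x ?\<gamma> (- 1)"
      unfolding weyl_rep_def[of x ?\<gamma>] using GL
      by (simp add: GL_inv_mult x_GL(2)[OF \<gamma>] x_GL(2)[OF n\<gamma>] GL_assoc GL_mult_closed)
    ultimately show ?thesis using eq by simp
  qed
qed

lemma weyl_torus:
  assumes \<alpha>: "\<alpha> \<in> roots" and t: "t \<in> torus"
  shows "\<exists>t'\<in>torus. w \<alpha> * t = t' * w \<alpha>"
  using t
proof (rule generate_induct_left[OF _ torus_gens_GL])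
  have "w \<alpha> * 1\<^sub>m 27 = 1\<^sub>m 27 * w \<alpha>" using weyl_carrier[OF \<alpha>] by simp
  then show "\<exists>t'\<in>torus. w \<alpha> * 1\<^sub>m 27 = t' * w \<alpha>" using generate_one by blast
next
  fix h g assume h: "h \<in> torus_gens" and g: "g \<in> torus" and IH: "\<exists>t'\<in>torus. w \<alpha> * g = t' * w \<alpha>"
  then obtain g' where g': "g' \<in> torus" "w \<alpha> * g = g' * w \<alpha>" by blast
  obtain i u where h': "h = simple_coroot i u" "i \<in> {1..6}" "u \<noteq> 0"
    using h unfolding torus_gens_def by blast
  let ?h = "coroot (reflect \<alpha> (simple_root i)) u"
  have hh: "h = coroot (simple_root i) u" using h' simple_coroot_eq by simp
  note GL = weyl_GL[OF \<alpha>] torus_GL[OF g] torus_GL[OF g'(1)] subsetD[OF torus_gens_GL(1) h]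
    coroot_GL(1)[OF h'(3), of "reflect \<alpha> (simple_root i)"]
  have "w \<alpha> * (h * g) = ?h * (w \<alpha> * g)"
    unfolding hh using weyl_coroot[OF \<alpha> roots.simple[OF h'(2)] GL_carrier_mat[OF GL(2)]] .
  also have "\<dots> = (?h * g') * w \<alpha>" unfolding g'(2) using GL by (simp add: GL_assoc GL_mult_closed)
  finally show "\<exists>t'\<in>torus. w \<alpha> * (h * g) = t' * w \<alpha>"
    using generate_mult[OF coroot_torus[OF h'(3)] g'(1)] by blast
qed

lemma word_rep_simps: "word_rep x [] = 1\<^sub>m 27" "word_rep x (i # r) = w (simple_root i) * word_rep x r"
  by (simp_all add: word_rep_def)

lemma word_rep_GL: "set r \<subseteq> {1..6} \<Longrightarrow> word_rep x r \<in> carrier GL27"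
proof (induction r)
  case Nil
  then show ?case using M_GL[OF M_closed(2)] by (simp add: word_rep_simps)
next
  case (Cons i r)
  then show ?case using weyl_GL[OF roots.simple] by (simp add: word_rep_simps GL_mult_closed)
qed

lemma GL_one_mult: "A \<in> carrier GL27 \<Longrightarrow> 1\<^sub>m 27 * A = A" "A \<in> carrier GL27 \<Longrightarrow> A * 1\<^sub>m 27 = A"
  using left_mult_one_mat[OF GL_carrier_mat] right_mult_one_mat[OF GL_carrier_mat] by blast+

lemma word_rep_append:
  "set a \<subseteq> {1..6} \<Longrightarrow> set b \<subseteq> {1..6} \<Longrightarrow> word_rep x (a @ b) = word_rep x a * word_rep x b"
proof (induction a)
  case Nil
  then show ?case using word_rep_GL by (simp add: word_rep_simps GL_one_mult)
next
  case (Cons i a)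
  then show ?case using word_rep_GL weyl_GL[OF roots.simple, of i]
      by (simp add: word_rep_simps GL_assoc GL_mult_closed)
qed

lemma word_rep_torus:
  assumes "set r \<subseteq> {1..6}" "t \<in> torus"
  shows "\<exists>t'\<in>torus. word_rep x r * t = t' * word_rep x r"
  using assms
proof (induction r)
  case Nil
  then show ?case using torus_GL by (auto simp: word_rep_simps GL_one_mult)
next
  case (Cons i r)
  then obtain t1 where t1: "t1 \<in> torus" "word_rep x r * t = t1 * word_rep x r" by auto
  have i: "simple_root i \<in> roots" using Cons.prems roots.simple by auto
  obtain t2 where t2: "t2 \<in> torus" "w (simple_root i) * t1 = t2 * w (simple_root i)"
    using weyl_torus[OF i t1(1)] by blast
  have r: "word_rep x r \<in> carrier GL27" using word_rep_GL Cons.prems by simp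
  note GL = r weyl_GL[OF i] torus_GL[OF t1(1)] torus_GL[OF t2(1)] torus_GL[OF Cons.prems(2)]
  have "word_rep x (i # r) * t = (w (simple_root i) * t1) * word_rep x r"
    using GL by (simp add: word_rep_simps GL_assoc t1(2) GL_mult_closed)
  also have "\<dots> = t2 * word_rep x (i # r)"
      unfolding t2(2) using GL by (simp add: word_rep_simps GL_assoc GL_mult_closed)
  finally show ?case using t2(1) by blast
qed

text \<open>
  The matrix represents the Weyl group element of the word \<open>r\<close>, up to the torus.
\<close>
definition lift :: "nat list \<Rightarrow> 'a mat \<Rightarrow> bool" where
  "lift r g \<longleftrightarrow> set r \<subseteq> {1..6} \<and> (\<exists>t\<in>torus. g = t * word_rep x r)"

lemma lift_mult:
  assumes "lift r g" "lift r' g'" shows "lift (r @ r') (g * g')"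
proof -
  obtain t t' where t: "t \<in> torus" "g = t * word_rep x r" "t' \<in> torus" "g' = t' * word_rep x r'"
    and s: "set r \<subseteq> {1..6}" "set r' \<subseteq> {1..6}" using assms unfolding lift_def by blast
  obtain t2 where t2: "t2 \<in> torus" "word_rep x r * t' = t2 * word_rep x r"
    using word_rep_torus[OF s(1) t(3)] by blast
  note GL = torus_GL[OF t(1)] torus_GL[OF t(3)] torus_GL[OF t2(1)] word_rep_GL[OF s(1)] word_rep_GL[OF s(2)]
  have "g * g' = t * ((word_rep x r * t') * word_rep x r')" using GL by (simp add: t GL_assoc GL_mult_closed)
  also have "\<dots> = (t * t2) * word_rep x (r @ r')"
    unfolding t2(2) word_rep_append[OF s] using GL by (simp add: GL_assoc GL_mult_closed)
  finally show ?thesis unfolding lift_def using generate_mult[OF t(1) t2(1)] s by auto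
qed

lemma lift_torus: "t \<in> torus \<Longrightarrow> lift [] t"
  unfolding lift_def using torus_GL by (auto simp: word_rep_simps GL_one_mult)

lemma lift_simple: "i \<in> {1..6} \<Longrightarrow> lift [i] (w (simple_root i))"
  unfolding lift_def using weyl_GL[OF roots.simple]
  by (auto simp: word_rep_simps GL_one_mult intro!: bexI[OF _ generate_one])

lemma lift_inv:
  assumes "lift r g" shows "lift (rev r) (inv\<^bsub>GL27\<^esub> g)"
proof -
  have word: "lift (rev r) (inv\<^bsub>GL27\<^esub> (word_rep x r))" if "set r \<subseteq> {1..6}" for r
    using that
  proof (induction r)
    case Nil
    have "inv\<^bsub>GL27\<^esub> (1\<^sub>m 27 :: 'a mat) = 1\<^sub>m 27" by (rule GL_I(2)) simp_all
    then show ?case using lift_torus[OF generate_one] by (simp add: word_rep_simps)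
  next
    case (Cons i r)
    have i: "i \<in> {1..6}" using Cons.prems by simp
    note i' = roots.simple[OF i]
    have "lift ([] @ [i]) (inv\<^bsub>GL27\<^esub> (w (simple_root i)))"
      unfolding weyl_inv(2)[OF i'] by (intro lift_mult lift_torus coroot_torus lift_simple i) simp
    then have "lift (rev r @ [i]) (inv\<^bsub>GL27\<^esub> (word_rep x r) * inv\<^bsub>GL27\<^esub> (w (simple_root i)))"
      using lift_mult Cons by auto
    then show ?case
      using GL_inv_mult[OF weyl_GL[OF i'] word_rep_GL, of r] Cons.prems by (simp add: word_rep_simps)
  qed
  obtain t where t: "t \<in> torus" "g = t * word_rep x r" and s: "set r \<subseteq> {1..6}"
    using assms unfolding lift_def by blast
  have "inv\<^bsub>GL27\<^esub> g = inv\<^bsub>GL27\<^esub> (word_rep x r) * inv\<^bsub>GL27\<^esub> t"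
    unfolding t(2) by (rule GL_inv_mult[OF torus_GL[OF t(1)] word_rep_GL[OF s]])
  moreover have "lift [] (inv\<^bsub>GL27\<^esub> t)"
    by (rule lift_torus[OF generate_inv[OF torus_gens_GL(1) t(1)]])
  ultimately show ?thesis using lift_mult[OF word[OF s]] by fastforce
qed

text \<open>
  The representative of \<open>s\<^sub>\<alpha> \<beta>\<close> is, up to inversion, a conjugate of that of \<open>\<beta>\<close>; inversion reverses
  the word, which does no harm for a reflection.
\<close>
lemma lift_weyl:
  assumes "\<alpha> \<in> roots"
  shows "\<exists>r. lift r (w \<alpha>) \<and> (\<forall>\<beta>. length \<beta> = 6 \<longrightarrow> word_act r \<beta> = reflect \<alpha> \<beta>)"
  using assms
proof induction
  case (simple i)
  then show ?case using lift_simple by (intro exI[of _ "[i]"]) simp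
next
  case (reflect \<alpha> \<beta>)
  let ?\<gamma> = "reflect \<alpha> \<beta>"
  have \<gamma>: "?\<gamma> \<in> roots" using reflect by (intro roots.reflect)
  note len = roots_length[OF reflect(1)] roots_length[OF reflect(2)]
  obtain a b where a: "lift a (w \<alpha>)" "\<And>\<beta>. length \<beta> = 6 \<Longrightarrow> word_act a \<beta> = reflect \<alpha> \<beta>"
    and b: "lift b (w \<beta>)" "\<And>\<delta>. length \<delta> = 6 \<Longrightarrow> word_act b \<delta> = reflect \<beta> \<delta>"
    using reflect.IH by blast
  let ?i = "inv\<^bsub>GL27\<^esub> (w \<alpha>)"
  have sa: "set a \<subseteq> {1..6}" using a(1) by (simp add: lift_def)
  have rev_a: "word_act (rev a) \<delta> = reflect \<alpha> \<delta>" if "length \<delta> = 6" for \<delta>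
    using word_act_rev[OF sa, of "reflect \<alpha> \<delta>"] a(2) that len
    by (simp add: reflect_reflect roots_norm[OF reflect(1)])
  define r where "r = (a @ b) @ rev a"
  have lr: "lift r (w \<alpha> * w \<beta> * ?i)" unfolding r_def by (intro lift_mult a(1) b(1) lift_inv)
  have act: "word_act r \<delta> = reflect ?\<gamma> \<delta>" if "length \<delta> = 6" for \<delta>
    using that len reflect_conj[OF len, of "reflect \<alpha> \<delta>"]
    by (simp add: r_def rev_a a(2) b(2) reflect_reflect roots_norm[OF reflect(1)])
  obtain \<omega> where \<omega>: "\<omega> \<in> {w ?\<gamma>, inv\<^bsub>GL27\<^esub> (w ?\<gamma>)}" "w \<alpha> * w \<beta> = \<omega> * w \<alpha>"
    using weyl_conjugate[OF reflect(1,2)] by blast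
  have "\<omega> \<in> carrier GL27" using \<omega>(1) weyl_GL[OF \<gamma>] GL_inv(1)[OF weyl_GL[OF \<gamma>]] by auto
  then have "w \<alpha> * w \<beta> * ?i = \<omega>"
    unfolding \<omega>(2) using weyl_GL[OF reflect(1)] by (simp add: GL_assoc GL_inv GL_one_mult GL_mult_closed)
  then have l\<omega>: "lift r \<omega>" using lr by simp
  from \<omega>(1) consider "\<omega> = w ?\<gamma>" | "\<omega> = inv\<^bsub>GL27\<^esub> (w ?\<gamma>)" by blast
  then show ?case
  proof cases
    case 1
    then show ?thesis using l\<omega> act by blast
  next
    case 2
    have "inv\<^bsub>GL27\<^esub> \<omega> = w ?\<gamma>" unfolding 2 using group.inv_inv[OF GL_group weyl_GL[OF \<gamma>]] .
    then have "lift (rev r) (w ?\<gamma>)" using lift_inv[OF l\<omega>] by simp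
    moreover have "word_act (rev r) \<delta> = reflect ?\<gamma> \<delta>" if "length \<delta> = 6" for \<delta>
    proof -
      have "set r \<subseteq> {1..6}" using lr by (simp add: lift_def)
      from word_act_rev[OF this, of "reflect ?\<gamma> \<delta>"] show ?thesis
        using act[of "reflect ?\<gamma> \<delta>"] that len
        by (simp add: reflect_reflect roots_norm[OF \<gamma>])
    qed
    ultimately show ?thesis by blast
  qed
qed

lemma word_conjugate:
  assumes "set b \<subseteq> {1..6}" "\<beta> \<in> roots"
  shows "\<exists>\<omega>\<in>{w (word_act b \<beta>), inv\<^bsub>GL27\<^esub> (w (word_act b \<beta>))}. word_rep x b * w \<beta> = \<omega> * word_rep x b"
  using assms
proof (induction b)
  case Nil
  then show ?case using weyl_GL by (simp add: word_rep_simps GL_one_mult)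
next
  case (Cons i b)
  have i: "simple_root i \<in> roots" using Cons.prems roots.simple by auto
  have sb: "set b \<subseteq> {1..6}" using Cons.prems by simp
  let ?s = "w (simple_root i)" and ?\<gamma> = "word_act b \<beta>"
  let ?\<delta> = "reflect (simple_root i) ?\<gamma>"
  have \<gamma>: "?\<gamma> \<in> roots" using word_act_roots[OF sb Cons.prems(2)] .
  have \<delta>: "?\<delta> \<in> roots" using i \<gamma> by (rule roots.reflect)
  obtain \<omega> where \<omega>: "\<omega> \<in> {w ?\<gamma>, inv\<^bsub>GL27\<^esub> (w ?\<gamma>)}" "word_rep x b * w \<beta> = \<omega> * word_rep x b"
    using Cons by auto
  obtain \<omega>1 where \<omega>1: "\<omega>1 \<in> {w ?\<delta>, inv\<^bsub>GL27\<^esub> (w ?\<delta>)}" "?s * w ?\<gamma> = \<omega>1 * ?s"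
    using weyl_conjugate[OF i \<gamma>] by blast
  note GL = weyl_GL[OF i] weyl_GL[OF \<gamma>] weyl_GL[OF \<delta>] GL_inv(1)[OF weyl_GL[OF \<gamma>]]
    GL_inv(1)[OF weyl_GL[OF \<delta>]] word_rep_GL[OF sb] weyl_GL[OF Cons.prems(2)]
  have \<omega>1GL: "\<omega>1 \<in> carrier GL27" using \<omega>1(1) GL by auto
  have \<omega>GL: "\<omega> \<in> carrier GL27" using \<omega>(1) GL by auto
  have "\<exists>\<omega>2\<in>{w ?\<delta>, inv\<^bsub>GL27\<^esub> (w ?\<delta>)}. ?s * \<omega> = \<omega>2 * ?s"
  proof (cases "\<omega> = w ?\<gamma>")
    case True
    then show ?thesis using \<omega>1 by blast
  next
    case False
    then have \<omega>i: "\<omega> = inv\<^bsub>GL27\<^esub> (w ?\<gamma>)" using \<omega>(1) by blast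
    let ?j = "inv\<^bsub>GL27\<^esub> \<omega>1"
    note GLj = GL_inv(1)[OF \<omega>1GL]
    have "?j \<in> {w ?\<delta>, inv\<^bsub>GL27\<^esub> (w ?\<delta>)}"
      using \<omega>1(1) group.inv_inv[OF GL_group weyl_GL[OF \<delta>]] by auto
    moreover have "?s * \<omega> = ?j * ?s"
    proof -
      have "?s * \<omega> = ?j * ((\<omega>1 * ?s) * \<omega>)"
        using GL \<omega>1GL GLj \<omega>GL
        by (simp add: GL_assoc[symmetric] GL_mult_closed GL_inv(3)[OF \<omega>1GL] GL_one_mult)
      also have "\<dots> = ?j * (?s * (w ?\<gamma> * \<omega>))"
        unfolding \<omega>1(2)[symmetric] using GL \<omega>GL by (simp add: GL_assoc GL_mult_closed)
      also have "\<dots> = ?j * ?s" unfolding \<omega>i using GL by (simp add: GL_inv(2) GL_one_mult)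
      finally show ?thesis .
    qed
    ultimately show ?thesis by blast
  qed
  then obtain \<omega>2 where \<omega>2: "\<omega>2 \<in> {w ?\<delta>, inv\<^bsub>GL27\<^esub> (w ?\<delta>)}" "?s * \<omega> = \<omega>2 * ?s" by blast
  have \<omega>2GL: "\<omega>2 \<in> carrier GL27" using \<omega>2(1) GL by auto
  have "word_rep x (i # b) * w \<beta> = (?s * \<omega>) * word_rep x b"
    using GL \<omega>GL by (simp add: word_rep_simps GL_assoc \<omega>(2) GL_mult_closed)
  also have "\<dots> = \<omega>2 * word_rep x (i # b)"
    unfolding \<omega>2(2) using GL \<omega>2GL by (simp add: word_rep_simps GL_assoc GL_mult_closed)
  finally show ?case using \<omega>2(1) by auto
qed

lemma weyl_M:
  assumes i: "i \<in> {1..6}" and ne: "i \<noteq> 2" shows "w (simple_root i) \<in> M"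
proof -
  note r = roots.simple[OF i]
  have "coeff_at (simple_root i) 2 = 0" using ne coeff_at_simple[of 2 i] by simp
  moreover from this have "coeff_at (neg_root (simple_root i)) 2 = 0"
    using coeff_at_neg[of "simple_root i" 2] by simp
  ultimately show ?thesis
    unfolding weyl_rep_def using x_M[OF r] x_M[OF neg_root_roots[OF r]] M_closed(1) by blast
qed

text \<open>
  The stabilizer of the highest root in the Weyl group is generated by the simple reflections other
  than the second; this is the version for representatives. If the last letter is 2, then \<open>r\<close> sends
  the second simple root to a root with the same product 1 with the highest root, hence to a positive
  one, and the exchange condition cancels two letters at the cost of a torus element.
\<close>
lemma word_rep_stabilizer:
  assumes "set r \<subseteq> {1..6}" "word_act r highest_root = highest_root"
  shows "word_rep x r \<in> M"
  using assms
proof (induction "length r" arbitrary: r rule: less_induct)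
  case less
  show ?case
  proof (cases r rule: rev_cases)
    case Nil
    then show ?thesis using M_closed(2) by (simp add: word_rep_simps)
  next
    case (snoc r' i)
    have i: "i \<in> {1..6}" and s: "set r' \<subseteq> {1..6}" using less.prems(1) snoc by auto
    note ir = roots.simple[OF i]
    have W: "word_rep x r = word_rep x r' * w (simple_root i)"
      using word_rep_append[OF s, of "[i]"] i weyl_GL[OF ir] by (simp add: snoc word_rep_simps GL_one_mult)
    have hi: "root_form highest_root (simple_root i) = (if i = 2 then 1 else 0)"
      using root_form_highest[of "simple_root i"] coeff_at_simple[of 2 i] by simp
    show ?thesis
    proof (cases "i = 2")
      case False
      then have "reflect (simple_root i) highest_root = highest_root"
        using hi by (intro reflect_orthogonal) simp_all
      then have "word_act r' highest_root = highest_root" using less.prems(2) snoc by simp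
      then have "word_rep x r' \<in> M" using less.hyps[of r'] s snoc by simp
      then show ?thesis unfolding W using weyl_M[OF i False] M_closed(1) by blast
    next
      case True
      have len: "length (simple_root i) = 6" "length highest_root = 6" by simp_all
      have ract: "word_act r (simple_root i) = neg_root (word_act r' (simple_root i))"
        using i by (simp add: snoc reflect_self root_form_simple_self word_act_neg del: atLeastAtMost_iff)
      have "coeff_at (word_act r (simple_root i)) 2 = 1"
        using word_act_isometry[OF less.prems(1) len(2,1)] hi True less.prems(2)
          root_form_highest[of "word_act r (simple_root i)"] by simp
      then have "word_act r (simple_root i) \<in> set positive_roots"
        using nonpositive_coeff[OF word_act_roots[OF less.prems(1) ir], of 2] by force
      then have "word_act r' (simple_root i) \<notin> set positive_roots"
        using neg_positive_not_positive unfolding ract by fastforce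
      then obtain a j b where ab: "r' = a @ j # b" "word_act b (simple_root i) = simple_root j"
        using exchange[OF s i] by blast
      have sab: "set a \<subseteq> {1..6}" "j \<in> {1..6}" "set b \<subseteq> {1..6}" using s ab(1) by auto
      note jr = roots.simple[OF sab(2)]
      obtain \<omega> where \<omega>: "\<omega> \<in> {w (simple_root j), inv\<^bsub>GL27\<^esub> (w (simple_root j))}"
        "word_rep x b * w (simple_root i) = \<omega> * word_rep x b"
        using word_conjugate[OF sab(3) ir] unfolding ab(2) by blast
      have c: "w (simple_root j) * \<omega> \<in> torus"
        using \<omega>(1) weyl_inv(1)[OF jr] coroot_torus[of "- 1" "simple_root j"] GL_inv(2)[OF weyl_GL[OF jr]]
          generate_one by auto
      have \<omega>GL: "\<omega> \<in> carrier GL27" using \<omega>(1) weyl_GL[OF jr] GL_inv(1)[OF weyl_GL[OF jr]] by auto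
      obtain t where t: "t \<in> torus" "word_rep x a * (w (simple_root j) * \<omega>) = t * word_rep x a"
        using word_rep_torus[OF sab(1) c] by blast
      note GL = word_rep_GL[OF sab(1)] word_rep_GL[OF sab(3)] weyl_GL[OF jr] weyl_GL[OF ir]
          \<omega>GL torus_GL[OF t(1)]
      have "word_rep x r = word_rep x a * (w (simple_root j) * (word_rep x b * w (simple_root i)))"
        unfolding W ab(1) using word_rep_append[OF sab(1), of "j # b"] sab GL
        by (simp add: word_rep_simps GL_assoc GL_mult_closed)
      also have "\<dots> = (word_rep x a * (w (simple_root j) * \<omega>)) * word_rep x b"
        unfolding \<omega>(2) using GL by (simp add: GL_assoc GL_mult_closed)
      also have "\<dots> = t * word_rep x (a @ b)"
        unfolding t(2) word_rep_append[OF sab(1,3)] using GL by (simp add: GL_assoc GL_mult_closed)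
      finally have Wr: "word_rep x r = t * word_rep x (a @ b)" .
      have "word_act r highest_root = word_act (a @ b) highest_root"
      proof -
        have l: "length (reflect (simple_root i) highest_root) = 6" by simp
        have "word_act b highest_root
            = word_act b (reflect (simple_root i) (reflect (simple_root i) highest_root))"
          using i by (simp add: reflect_reflect root_form_simple_self del: atLeastAtMost_iff)
        also have "\<dots> = reflect (simple_root j) (word_act b (reflect (simple_root i) highest_root))"
          using word_act_reflect[OF sab(3) len(1) l] by (simp add: ab(2))
        finally show ?thesis by (simp add: snoc ab(1))
      qed
      then have "word_rep x (a @ b) \<in> M"
        using less.hyps[of "a @ b"] sab less.prems(2) snoc ab(1) by simp
      then show ?thesis unfolding Wr using t(1) torus_subset_M M_closed(1) by blast
    qed
  qed
qed

text \<open>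
  The words for the longest element of \<open>M\<close> have their representatives in \<open>M\<close>. What remains is that
  the longest element of \<open>G\<close> and the reflection in the highest root agree on the highest root.
\<close>
lemma w0_rep_inv:
  assumes u: "longest_word {1..6} u" and v: "longest_word {1, 3, 4, 5, 6} v"
  shows "\<exists>m\<in>M. inv\<^bsub>GL27\<^esub> (w0_rep x u v) = m * inv\<^bsub>GL27\<^esub> (w highest_root)"
proof -
  have su: "set u \<subseteq> {1..6}" using u by (auto simp: longest_word_def reduced_word_def)
  have sv: "set v \<subseteq> {1, 3, 4, 5, 6}" using v by (auto simp: longest_word_def reduced_word_def)
  then have sv': "set v \<subseteq> {1..6}" by auto
  have Mv: "word_rep x v \<in> M"
    using sv
  proof (induction v)
    case Nil
    then show ?case using M_closed(2) by (simp add: word_rep_simps)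
  next
    case (Cons i v)
    then show ?case using weyl_M[of i] M_closed(1) by (auto simp: word_rep_simps)
  qed
  note h = highest_root_roots
  obtain r where r: "lift r (w highest_root)" "\<And>\<beta>. length \<beta> = 6 \<Longrightarrow> word_act r \<beta> = reflect highest_root \<beta>"
    using lift_weyl[OF h] by blast
  have "lift u (word_rep x u)"
    unfolding lift_def using su GL_one_mult(1)[OF word_rep_GL[OF su]] generate_one by metis
  from lift_mult[OF lift_inv[OF this] r(1)] obtain t where t: "t \<in> torus"
    "inv\<^bsub>GL27\<^esub> (word_rep x u) * w highest_root = t * word_rep x (rev u @ r)"
    unfolding lift_def by blast
  have sr: "set (rev u @ r) \<subseteq> {1..6}" using su r(1) by (auto simp: lift_def)
  have "word_act (rev u) (word_act u highest_root) = highest_root"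
    by (rule word_act_rev[OF su]) simp
  then have "word_act (rev u) (neg_root highest_root) = highest_root"
    unfolding longest_word_highest_root[OF u] .
  then have "word_act (rev u @ r) highest_root = highest_root"
    using r(2)[of highest_root] reflect_self[of highest_root] roots_norm[OF h] by simp
  then have "word_rep x (rev u @ r) \<in> M" by (rule word_rep_stabilizer[OF sr])
  then have m1: "inv\<^bsub>GL27\<^esub> (word_rep x u) * w highest_root \<in> M"
    unfolding t(2) using t(1) torus_subset_M M_closed(1) by blast
  let ?m = "word_rep x v * (inv\<^bsub>GL27\<^esub> (word_rep x u) * w highest_root)"
  note GLu = word_rep_GL[OF su] and GLv = word_rep_GL[OF sv'] and GLh = weyl_GL[OF h]
  have "inv\<^bsub>GL27\<^esub> (w0_rep x u v) = word_rep x v * inv\<^bsub>GL27\<^esub> (word_rep x u)"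
    unfolding w0_rep_def using GL_inv_mult[OF GLu GL_inv(1)[OF GLv]] group.inv_inv[OF GL_group GLv] by simp
  also have "\<dots> = ?m * inv\<^bsub>GL27\<^esub> (w highest_root)"
    using GLu GLv GLh GL_inv(1)[OF GLu] GL_inv(1)[OF GLh]
    by (simp add: GL_assoc GL_mult_closed GL_inv(2)[OF GLh] GL_one_mult)
  finally show ?thesis using M_closed(1)[OF Mv m1] by blast
qed

end

section \<open>The explicit decomposition\<close>

abbreviation \<gamma>\<^sub>1 :: "int list" where "\<gamma>\<^sub>1 \<equiv> [1, 1, 2, 3, 2, 1]"
abbreviation \<gamma>\<^sub>2 :: "int list" where "\<gamma>\<^sub>2 \<equiv> [1, 1, 2, 2, 2, 1]"
abbreviation \<gamma>\<^sub>3 :: "int list" where "\<gamma>\<^sub>3 \<equiv> [1, 1, 1, 2, 1, 1]"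
abbreviation \<gamma>\<^sub>4 :: "int list" where "\<gamma>\<^sub>4 \<equiv> [0, 1, 1, 2, 1, 0]"
abbreviation \<gamma>\<^sub>5 :: "int list" where "\<gamma>\<^sub>5 \<equiv> [0, 1, 0, 0, 0, 0]"
abbreviation \<delta>\<^sub>2 :: "int list" where "\<delta>\<^sub>2 \<equiv> [0, 1, 0, 1, 0, 0]"
abbreviation \<delta>\<^sub>3 :: "int list" where "\<delta>\<^sub>3 \<equiv> [0, 1, 1, 1, 1, 0]"
abbreviation \<delta>\<^sub>4 :: "int list" where "\<delta>\<^sub>4 \<equiv> [1, 1, 1, 1, 1, 1]"
abbreviation \<beta>\<^sub>1 :: "int list" where "\<beta>\<^sub>1 \<equiv> [1, 0, 1, 1, 1, 1]"
abbreviation \<beta>\<^sub>2 :: "int list" where "\<beta>\<^sub>2 \<equiv> [0, 0, 1, 1, 1, 0]"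
abbreviation \<beta>\<^sub>3 :: "int list" where "\<beta>\<^sub>3 \<equiv> [0, 0, 0, 1, 0, 0]"

text \<open>
  Besides the \<open>\<gamma>\<^sub>i\<close> of the representatives, the decomposition involves \<open>\<delta>\<^sub>i = \<gamma>\<^sub>0 - \<gamma>\<^sub>i\<close>, where
  \<open>\<delta>\<^sub>1 = \<gamma>\<^sub>5\<close> and \<open>\<delta>\<^sub>5 = \<gamma>\<^sub>1\<close>, and three orthogonal roots \<open>\<beta>\<^sub>i\<close> of \<open>M\<close>. In the description of
  the roots of \<open>N\<close> other than \<open>\<gamma>\<^sub>0\<close> as triples from 1 to 6, weights of the exterior cube for \<open>M\<close> of
  type A5, the roots \<open>\<gamma>\<^sub>1, \<dots>, \<gamma>\<^sub>5\<close> are 123, 124, 135, 236, 456, the roots \<open>\<delta>\<^sub>i\<close> are the complementary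
  triples, and \<open>\<beta>\<^sub>1, \<beta>\<^sub>2, \<beta>\<^sub>3\<close> are \<open>e\<^sub>1 - e\<^sub>6\<close>, \<open>e\<^sub>2 - e\<^sub>5\<close>, \<open>e\<^sub>3 - e\<^sub>4\<close>. Two triples have product 1,
  0 or -1 if they share 2, 1 or no elements.
\<close>
lemma decomposition_roots:
  "\<gamma>\<^sub>1 \<in> roots" "\<gamma>\<^sub>2 \<in> roots" "\<gamma>\<^sub>3 \<in> roots" "\<gamma>\<^sub>4 \<in> roots" "\<gamma>\<^sub>5 \<in> roots" "\<delta>\<^sub>2 \<in> roots"
      "\<delta>\<^sub>3 \<in> roots" "\<delta>\<^sub>4 \<in> roots" "\<beta>\<^sub>1 \<in> roots" "\<beta>\<^sub>2 \<in> roots" "\<beta>\<^sub>3 \<in> roots"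
  by (rule subsetD[OF positive_roots_subset_roots], simp add: positive_roots_def)+

lemma commutator_pairs:
  shows "root_form (neg_root highest_root) \<gamma>\<^sub>1 = - 1 \<and> reflect (neg_root highest_root) \<gamma>\<^sub>1 = neg_root \<gamma>\<^sub>5"
  and "root_form (neg_root highest_root) \<gamma>\<^sub>2 = - 1 \<and> reflect (neg_root highest_root) \<gamma>\<^sub>2 = neg_root \<delta>\<^sub>2"
  and "root_form (neg_root highest_root) \<gamma>\<^sub>3 = - 1 \<and> reflect (neg_root highest_root) \<gamma>\<^sub>3 = neg_root \<delta>\<^sub>3"
  and "root_form (neg_root highest_root) \<gamma>\<^sub>4 = - 1 \<and> reflect (neg_root highest_root) \<gamma>\<^sub>4 = neg_root \<delta>\<^sub>4"
  and "root_form (neg_root highest_root) \<gamma>\<^sub>5 = - 1 \<and> reflect (neg_root highest_root) \<gamma>\<^sub>5 = neg_root \<gamma>\<^sub>1"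
  and "root_form (neg_root \<delta>\<^sub>4) \<gamma>\<^sub>5 = - 1 \<and> reflect (neg_root \<delta>\<^sub>4) \<gamma>\<^sub>5 = neg_root \<beta>\<^sub>1"
  and "root_form (neg_root \<delta>\<^sub>3) \<gamma>\<^sub>5 = - 1 \<and> reflect (neg_root \<delta>\<^sub>3) \<gamma>\<^sub>5 = neg_root \<beta>\<^sub>2"
  and "root_form (neg_root \<delta>\<^sub>2) \<gamma>\<^sub>5 = - 1 \<and> reflect (neg_root \<delta>\<^sub>2) \<gamma>\<^sub>5 = neg_root \<beta>\<^sub>3"
  and "root_form (neg_root \<beta>\<^sub>2) \<gamma>\<^sub>4 = - 1 \<and> reflect (neg_root \<beta>\<^sub>2) \<gamma>\<^sub>4 = \<delta>\<^sub>2"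
  and "root_form (neg_root \<delta>\<^sub>2) \<gamma>\<^sub>3 = - 1 \<and> reflect (neg_root \<delta>\<^sub>2) \<gamma>\<^sub>3 = \<beta>\<^sub>1"
  and "root_form (neg_root \<delta>\<^sub>3) \<gamma>\<^sub>4 = - 1 \<and> reflect (neg_root \<delta>\<^sub>3) \<gamma>\<^sub>4 = \<beta>\<^sub>3"
  and "root_form (neg_root \<delta>\<^sub>2) \<gamma>\<^sub>4 = - 1 \<and> reflect (neg_root \<delta>\<^sub>2) \<gamma>\<^sub>4 = \<beta>\<^sub>2"
  and "root_form (neg_root \<delta>\<^sub>2) \<beta>\<^sub>3 = - 1 \<and> reflect (neg_root \<delta>\<^sub>2) \<beta>\<^sub>3 = neg_root \<gamma>\<^sub>5"
  and "root_form (neg_root \<gamma>\<^sub>5) \<delta>\<^sub>2 = - 1 \<and> reflect (neg_root \<gamma>\<^sub>5) \<delta>\<^sub>2 = \<beta>\<^sub>3"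
  by (simp_all add: reflect_def root_form_list neg_root_def)

lemma commuting_pairs:
  shows "root_form (neg_root \<gamma>\<^sub>5) \<gamma>\<^sub>2 \<in> {0, 1}"
  and "root_form (neg_root \<gamma>\<^sub>5) (neg_root \<delta>\<^sub>2) \<in> {0, 1}"
  and "root_form (neg_root \<gamma>\<^sub>5) \<gamma>\<^sub>3 \<in> {0, 1}"
  and "root_form (neg_root \<gamma>\<^sub>5) (neg_root \<delta>\<^sub>3) \<in> {0, 1}"
  and "root_form (neg_root \<gamma>\<^sub>5) \<gamma>\<^sub>4 \<in> {0, 1}"
  and "root_form (neg_root \<gamma>\<^sub>5) (neg_root \<delta>\<^sub>4) \<in> {0, 1}"
  and "root_form \<gamma>\<^sub>4 \<gamma>\<^sub>5 \<in> {0, 1}"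
  and "root_form \<gamma>\<^sub>3 \<gamma>\<^sub>5 \<in> {0, 1}"
  and "root_form (neg_root \<beta>\<^sub>2) (neg_root \<delta>\<^sub>3) \<in> {0, 1}"
  and "root_form (neg_root \<delta>\<^sub>3) \<delta>\<^sub>2 \<in> {0, 1}"
  by (simp_all add: root_form_list neg_root_def)

context chevalley
begin

text \<open>
  The sign of the commutator of the root vectors, as a constant attached to the two roots.
\<close>
definition csign :: "int list \<Rightarrow> int list \<Rightarrow> 'a" where
  "csign \<alpha> \<beta> = (SOME \<epsilon>. (\<epsilon> = 1 \<or> \<epsilon> = - 1) \<and> (\<forall>s t. \<forall>X\<in>carrier_mat 27 27.
      x \<alpha> s * (x \<beta> t * X) = x \<beta> t * (x (reflect \<alpha> \<beta>) (\<epsilon> * s * t) * (x \<alpha> s * X))))"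

lemma commutator_relation:
  assumes "\<alpha> \<in> roots" "\<beta> \<in> roots" "root_form \<alpha> \<beta> = - 1 \<and> reflect \<alpha> \<beta> = \<gamma>"
    and "X \<in> carrier_mat 27 27"
  shows "x \<alpha> s * (x \<beta> t * X) = x \<beta> t * (x \<gamma> (csign \<alpha> \<beta> * s * t) * (x \<alpha> s * X))"
  using someI_ex[OF x_commutator[OF assms(1,2)]] assms(3,4) unfolding csign_def by blast

lemmas cell_roots = decomposition_roots highest_root_roots
lemmas neg_cell_roots = cell_roots[THEN neg_root_roots]

lemmas swap =
  commutator_relation[OF neg_cell_roots(12) cell_roots(1) commutator_pairs(1)]
  commutator_relation[OF neg_cell_roots(12) cell_roots(2) commutator_pairs(2)]
  commutator_relation[OF neg_cell_roots(12) cell_roots(3) commutator_pairs(3)]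
  commutator_relation[OF neg_cell_roots(12) cell_roots(4) commutator_pairs(4)]
  commutator_relation[OF neg_cell_roots(12) cell_roots(5) commutator_pairs(5)]
  commutator_relation[OF neg_cell_roots(8) cell_roots(5) commutator_pairs(6)]
  commutator_relation[OF neg_cell_roots(7) cell_roots(5) commutator_pairs(7)]
  commutator_relation[OF neg_cell_roots(6) cell_roots(5) commutator_pairs(8)]
  commutator_relation[OF neg_cell_roots(10) cell_roots(4) commutator_pairs(9)]
  commutator_relation[OF neg_cell_roots(6) cell_roots(3) commutator_pairs(10)]
  commutator_relation[OF neg_cell_roots(7) cell_roots(4) commutator_pairs(11)]
  commutator_relation[OF neg_cell_roots(6) cell_roots(4) commutator_pairs(12)]
  commutator_relation[OF neg_cell_roots(6) cell_roots(11) commutator_pairs(13)]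
  commutator_relation[OF neg_cell_roots(5) cell_roots(6) commutator_pairs(14)]

lemmas slide =
  x_commute[OF neg_cell_roots(5) cell_roots(2) commuting_pairs(1)]
  x_commute[OF neg_cell_roots(5) neg_cell_roots(6) commuting_pairs(2)]
  x_commute[OF neg_cell_roots(5) cell_roots(3) commuting_pairs(3)]
  x_commute[OF neg_cell_roots(5) neg_cell_roots(7) commuting_pairs(4)]
  x_commute[OF neg_cell_roots(5) cell_roots(4) commuting_pairs(5)]
  x_commute[OF neg_cell_roots(5) neg_cell_roots(8) commuting_pairs(6)]
  x_commute[OF cell_roots(4) cell_roots(5) commuting_pairs(7)]
  x_commute[OF cell_roots(3) cell_roots(5) commuting_pairs(8)]
  x_commute[OF neg_cell_roots(10) neg_cell_roots(7) commuting_pairs(9)]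
  x_commute[OF neg_cell_roots(7) cell_roots(6) commuting_pairs(10)]

lemmas carriers = cell_roots[THEN xm_carrier] neg_cell_roots[THEN xm_carrier] cm_carrier

text \<open>
  The rewriting of \<open>w(\<gamma>\<^sub>0)\<inverse> n\<close> is divided into six moves on segments of the product. Factors that
  lower the level travel to the right past those that raise it; each crossing of two roots with
  product -1 leaves a factor for their sum. The factor for \<open>-\<gamma>\<^sub>0\<close> has to go first: it turns
  into the factors for \<open>-\<delta>\<^sub>i\<close>.
\<close>
lemma move_neg_highest_root:
  assumes X: "X \<in> carrier_mat 27 27"
  shows "x (neg_root highest_root) b * (x \<gamma>\<^sub>1 c1 * (x \<gamma>\<^sub>2 c2 * (x \<gamma>\<^sub>3 c3 * (x \<gamma>\<^sub>4 c4 * (x \<gamma>\<^sub>5 c5 * X)))))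
    = x \<gamma>\<^sub>1 c1 * (x (neg_root \<gamma>\<^sub>5) (csign (neg_root highest_root) \<gamma>\<^sub>1 * b * c1) * (x \<gamma>\<^sub>2 c2 *
        (x (neg_root \<delta>\<^sub>2) (csign (neg_root highest_root) \<gamma>\<^sub>2 * b * c2) * (x \<gamma>\<^sub>3 c3 *
        (x (neg_root \<delta>\<^sub>3) (csign (neg_root highest_root) \<gamma>\<^sub>3 * b * c3) * (x \<gamma>\<^sub>4 c4 *
        (x (neg_root \<delta>\<^sub>4) (csign (neg_root highest_root) \<gamma>\<^sub>4 * b * c4) * (x \<gamma>\<^sub>5 c5 *
        (x (neg_root \<gamma>\<^sub>1) (csign (neg_root highest_root) \<gamma>\<^sub>5 * b * c5) *
        (x (neg_root highest_root) b * X))))))))))"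
  using X by (simp only: swap(1-5) carriers)

text \<open>
  The factor for \<open>-\<gamma>\<^sub>5\<close> meets the one for \<open>\<gamma>\<^sub>5\<close>, which is where the condition \<open>c\<^sub>0 \<plusminus> c\<^sub>1 \<noteq> 0\<close> comes
  from.
\<close>
lemma move_neg_gamma5:
  assumes X: "X \<in> carrier_mat 27 27" and u: "u * (1 + e1 * t) = 1"
  shows "x (neg_root \<gamma>\<^sub>5) e1 * (x \<gamma>\<^sub>2 c2 * (x (neg_root \<delta>\<^sub>2) e2 * (x \<gamma>\<^sub>3 c3 *
      (x (neg_root \<delta>\<^sub>3) e3 * (x \<gamma>\<^sub>4 c4 * (x (neg_root \<delta>\<^sub>4) e4 * (x \<gamma>\<^sub>5 t * X)))))))
    = x \<gamma>\<^sub>2 c2 * (x (neg_root \<delta>\<^sub>2) e2 * (x \<gamma>\<^sub>3 c3 * (x (neg_root \<delta>\<^sub>3) e3 * (x \<gamma>\<^sub>4 c4 *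
        (x (neg_root \<delta>\<^sub>4) e4 * (x \<gamma>\<^sub>5 (t * u) * (coroot \<gamma>\<^sub>5 u * (x (neg_root \<gamma>\<^sub>5) (e1 * u) *
        X))))))))"
  using X by (simp only: slide(1-6) sl2_swap[OF cell_roots(5) u] carriers)

lemma move_gamma5:
  assumes X: "X \<in> carrier_mat 27 27"
  shows "x (neg_root \<delta>\<^sub>2) e2 * (x \<gamma>\<^sub>3 c3 * (x (neg_root \<delta>\<^sub>3) e3 * (x \<gamma>\<^sub>4 c4 *
      (x (neg_root \<delta>\<^sub>4) e4 * (x \<gamma>\<^sub>5 t * X)))))
    = x \<gamma>\<^sub>5 t * (x (neg_root \<beta>\<^sub>3) (csign (neg_root \<delta>\<^sub>2) \<gamma>\<^sub>5 * e2 * t) * (x (neg_root \<delta>\<^sub>2) e2 *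
        (x \<gamma>\<^sub>3 c3 * (x (neg_root \<beta>\<^sub>2) (csign (neg_root \<delta>\<^sub>3) \<gamma>\<^sub>5 * e3 * t) * (x (neg_root \<delta>\<^sub>3) e3 *
        (x \<gamma>\<^sub>4 c4 * (x (neg_root \<beta>\<^sub>1) (csign (neg_root \<delta>\<^sub>4) \<gamma>\<^sub>5 * e4 * t) * (x (neg_root \<delta>\<^sub>4) e4 *
        X))))))))"
  using X by (simp only: swap(6-8) slide(7,8) carriers)

lemma move_neg_beta2:
  assumes X: "X \<in> carrier_mat 27 27"
  shows "x (neg_root \<beta>\<^sub>2) k * (x (neg_root \<delta>\<^sub>3) e3 * (x \<gamma>\<^sub>4 c4 * X))
    = x (neg_root \<delta>\<^sub>3) e3 * (x \<gamma>\<^sub>4 c4 * (x \<delta>\<^sub>2 (csign (neg_root \<beta>\<^sub>2) \<gamma>\<^sub>4 * k * c4) * (x (neg_root \<beta>\<^sub>2) k * X)))"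
  using X by (simp only: slide(9) swap(9) carriers)

lemma move_neg_delta3:
  assumes X: "X \<in> carrier_mat 27 27"
  shows "x (neg_root \<delta>\<^sub>2) e2 * (x \<gamma>\<^sub>3 c3 * (x (neg_root \<delta>\<^sub>3) e3 * (x \<gamma>\<^sub>4 c4 * (x \<delta>\<^sub>2 q * X))))
    = x \<gamma>\<^sub>3 c3 * (x \<beta>\<^sub>1 (csign (neg_root \<delta>\<^sub>2) \<gamma>\<^sub>3 * e2 * c3) * (x (neg_root \<delta>\<^sub>2) e2 * (x \<gamma>\<^sub>4 c4 *
        (x \<beta>\<^sub>3 (csign (neg_root \<delta>\<^sub>3) \<gamma>\<^sub>4 * e3 * c4) * (x \<delta>\<^sub>2 q * (x (neg_root \<delta>\<^sub>3) e3 * X))))))"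
  using X by (simp only: swap(10,11) slide(10) carriers)

text \<open>
  The factor for \<open>-\<delta>\<^sub>2\<close> meets the factor for \<open>\<delta>\<^sub>2\<close> that \<open>move_neg_beta2\<close> has created, which is where
  the condition \<open>c\<^sub>0 (c\<^sub>0 \<plusminus> c\<^sub>1) \<plusminus> c\<^sub>2 c\<^sub>3 c\<^sub>4 \<noteq> 0\<close> comes from.
\<close>
lemma move_neg_delta2:
  assumes X: "X \<in> carrier_mat 27 27" and u: "u * (1 + e2 * q) = 1"
  shows "x (neg_root \<delta>\<^sub>2) e2 * (x \<gamma>\<^sub>4 c4 * (x \<beta>\<^sub>3 p * (x \<delta>\<^sub>2 q * X)))
    = x \<gamma>\<^sub>4 c4 * (x \<beta>\<^sub>2 (csign (neg_root \<delta>\<^sub>2) \<gamma>\<^sub>4 * e2 * c4) * (x \<beta>\<^sub>3 p * (x \<delta>\<^sub>2 (q * u) *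
        (x \<beta>\<^sub>3 (csign (neg_root \<gamma>\<^sub>5) \<delta>\<^sub>2 * (csign (neg_root \<delta>\<^sub>2) \<beta>\<^sub>3 * e2 * p) * (q * u)) *
        (x (neg_root \<gamma>\<^sub>5) (csign (neg_root \<delta>\<^sub>2) \<beta>\<^sub>3 * e2 * p) * (coroot \<delta>\<^sub>2 u *
        (x (neg_root \<delta>\<^sub>2) (e2 * u) * X)))))))"
  using X by (simp only: swap(12-14) sl2_swap[OF cell_roots(6) u] carriers)

end

section \<open>Recovering the coordinates from the lowest block\<close>

text \<open>
  Positions 0, 3, 5, 7 belong to weights of the highest level and 20 to 26 without 22 to the lowest.
  The links are those met when a row of the former kind is expanded along the factors of the point,
  and the pairings below say that there are no others.
\<close>
lemma corner_links:
  shows "link highest_root 20 0"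
  and "link \<gamma>\<^sub>1 18 0"
  and "link \<gamma>\<^sub>5 20 18"
  and "link \<gamma>\<^sub>2 16 0"
  and "link \<gamma>\<^sub>3 26 16"
  and "link \<gamma>\<^sub>3 11 0"
  and "link highest_root 24 3"
  and "link \<gamma>\<^sub>2 22 3"
  and "link \<gamma>\<^sub>5 23 22"
  and "link \<gamma>\<^sub>5 4 3"
  and "link highest_root 25 5"
  and "link \<gamma>\<^sub>3 19 5"
  and "link \<gamma>\<^sub>5 21 19"
  and "link \<gamma>\<^sub>5 6 5"
  and "link highest_root 26 7"
  and "link \<gamma>\<^sub>4 18 7"
  and "link \<gamma>\<^sub>5 9 7"
  unfolding link_def all_1_6 weight_coord_def root_weight_explicit
  by (simp_all add: minuscule_weights_def)

lemma corner_pairings: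
  shows "pairing \<gamma>\<^sub>1 20 \<noteq> 1"
  and "pairing \<gamma>\<^sub>2 20 \<noteq> 1"
  and "pairing \<gamma>\<^sub>3 20 \<noteq> 1"
  and "pairing \<gamma>\<^sub>4 20 \<noteq> 1"
  and "pairing \<gamma>\<^sub>5 20 \<noteq> 1"
  and "pairing \<gamma>\<^sub>2 18 \<noteq> 1"
  and "pairing \<gamma>\<^sub>3 18 \<noteq> 1"
  and "pairing \<gamma>\<^sub>4 18 \<noteq> 1"
  and "pairing \<gamma>\<^sub>4 26 \<noteq> 1"
  and "pairing \<gamma>\<^sub>5 26 \<noteq> 1"
  and "pairing \<gamma>\<^sub>4 16 \<noteq> 1"
  and "pairing \<gamma>\<^sub>5 16 \<noteq> 1"
  and "pairing \<gamma>\<^sub>4 11 \<noteq> 1"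
  and "pairing \<gamma>\<^sub>5 11 \<noteq> 1"
  and "pairing \<gamma>\<^sub>4 0 \<noteq> 1"
  and "pairing \<gamma>\<^sub>5 0 \<noteq> 1"
  and "pairing \<gamma>\<^sub>1 24 \<noteq> 1"
  and "pairing \<gamma>\<^sub>2 24 \<noteq> 1"
  and "pairing \<gamma>\<^sub>3 24 \<noteq> 1"
  and "pairing \<gamma>\<^sub>4 24 \<noteq> 1"
  and "pairing \<gamma>\<^sub>5 24 \<noteq> 1"
  and "pairing \<gamma>\<^sub>1 3 \<noteq> 1"
  and "pairing \<gamma>\<^sub>3 22 \<noteq> 1"
  and "pairing \<gamma>\<^sub>4 22 \<noteq> 1"
  and "pairing \<gamma>\<^sub>3 3 \<noteq> 1"
  and "pairing \<gamma>\<^sub>4 3 \<noteq> 1"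
  and "pairing \<gamma>\<^sub>1 25 \<noteq> 1"
  and "pairing \<gamma>\<^sub>2 25 \<noteq> 1"
  and "pairing \<gamma>\<^sub>3 25 \<noteq> 1"
  and "pairing \<gamma>\<^sub>4 25 \<noteq> 1"
  and "pairing \<gamma>\<^sub>5 25 \<noteq> 1"
  and "pairing \<gamma>\<^sub>1 5 \<noteq> 1"
  and "pairing \<gamma>\<^sub>2 5 \<noteq> 1"
  and "pairing \<gamma>\<^sub>4 19 \<noteq> 1"
  and "pairing \<gamma>\<^sub>4 5 \<noteq> 1"
  and "pairing \<gamma>\<^sub>1 26 \<noteq> 1"
  and "pairing \<gamma>\<^sub>2 26 \<noteq> 1"
  and "pairing \<gamma>\<^sub>3 26 \<noteq> 1"
  and "pairing \<gamma>\<^sub>1 7 \<noteq> 1"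
  and "pairing \<gamma>\<^sub>2 7 \<noteq> 1"
  and "pairing \<gamma>\<^sub>3 7 \<noteq> 1"
  by (simp_all add: pairing_sum_list minuscule_weights_def)

context chevalley
begin

lemmas corner_rows =
  x_row_link[OF cell_roots(12) cell_roots(12) corner_links(1)]
  x_row_link[OF cell_roots(1) cell_roots(1) corner_links(2)]
  x_row_link[OF cell_roots(5) cell_roots(5) corner_links(3)]
  x_row_link[OF cell_roots(2) cell_roots(2) corner_links(4)]
  x_row_link[OF cell_roots(3) cell_roots(3) corner_links(5)]
  x_row_link[OF cell_roots(3) cell_roots(3) corner_links(6)]
  x_row_link[OF cell_roots(12) cell_roots(12) corner_links(7)]
  x_row_link[OF cell_roots(2) cell_roots(2) corner_links(8)]
  x_row_link[OF cell_roots(5) cell_roots(5) corner_links(9)]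
  x_row_link[OF cell_roots(5) cell_roots(5) corner_links(10)]
  x_row_link[OF cell_roots(12) cell_roots(12) corner_links(11)]
  x_row_link[OF cell_roots(3) cell_roots(3) corner_links(12)]
  x_row_link[OF cell_roots(5) cell_roots(5) corner_links(13)]
  x_row_link[OF cell_roots(5) cell_roots(5) corner_links(14)]
  x_row_link[OF cell_roots(12) cell_roots(12) corner_links(15)]
  x_row_link[OF cell_roots(4) cell_roots(4) corner_links(16)]
  x_row_link[OF cell_roots(5) cell_roots(5) corner_links(17)]
  x_row_other[OF cell_roots(12) cell_roots(12)]
  x_row_other[OF cell_roots(1) cell_roots(1)]
  x_row_other[OF cell_roots(2) cell_roots(2)]
  x_row_other[OF cell_roots(3) cell_roots(3)]
  x_row_other[OF cell_roots(4) cell_roots(4)]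
  x_row_other[OF cell_roots(5) cell_roots(5)]

lemma n_point_nested:
  "n_point x c = x highest_root (c $ 0) * (x \<gamma>\<^sub>1 (c $ 1) * (x \<gamma>\<^sub>2 (c $ 2) * (x \<gamma>\<^sub>3 (c $ 3) *
     (x \<gamma>\<^sub>4 (c $ 4) * (x \<gamma>\<^sub>5 1 * 1\<^sub>m 27)))))"
proof -
  have "gamma_root 0 = highest_root" "gamma_root 1 = \<gamma>\<^sub>1" "gamma_root 2 = \<gamma>\<^sub>2" "gamma_root 3 = \<gamma>\<^sub>3"
    "gamma_root 4 = \<gamma>\<^sub>4" "gamma_root 5 = \<gamma>\<^sub>5"
    by (simp_all add: gamma_root_def)
  then show ?thesis
    unfolding n_point_def
    by (simp only: GL_assoc GL_mult_closed GL_one_mult x_GL(1)[OF cell_roots(1)] x_GL(1)[OF cell_roots(2)]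
        x_GL(1)[OF cell_roots(3)] x_GL(1)[OF cell_roots(4)] x_GL(1)[OF cell_roots(5)]
            x_GL(1)[OF cell_roots(12)])
qed

text \<open>
  An entry from the lowest to the highest level collects the ways to cross two levels: one step \<open>\<gamma>\<^sub>0\<close>
  or two steps \<open>\<gamma>\<^sub>i\<close>, \<open>\<gamma>\<^sub>j\<close> with \<open>i < j\<close>. At the five positions chosen here, one of the two
  steps is always \<open>\<gamma>\<^sub>5\<close>, whose coordinate is 1.
\<close>
lemma n_point_entries:
  "n_point x c $$ (3, 24) = entry highest_root 3 24 * c $ 0"
  "n_point x c $$ (3, 23) = (entry \<gamma>\<^sub>2 3 22 * entry \<gamma>\<^sub>5 22 23) * c $ 2"
  "n_point x c $$ (5, 21) = (entry \<gamma>\<^sub>3 5 19 * entry \<gamma>\<^sub>5 19 21) * c $ 3"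
  "n_point x c $$ (7, 20) = (entry \<gamma>\<^sub>4 7 18 * entry \<gamma>\<^sub>5 18 20) * c $ 4"
  "n_point x c $$ (0, 20) = entry highest_root 0 20 * c $ 0 + (entry \<gamma>\<^sub>1 0 18 * entry \<gamma>\<^sub>5 18 20) * c $ 1"
  unfolding n_point_nested by (simp_all add: corner_rows corner_pairings carriers)

lemma inv_weyl_low_row:
  assumes l: "link highest_root i j" and X: "X \<in> carrier_mat 27 27" and s: "s < 27"
  shows "(inv\<^bsub>GL27\<^esub> (w highest_root) * X) $$ (i, s) = entry highest_root j i * X $$ (j, s)"
proof -
  note h = highest_root_roots
  note lr = link_rows[OF h l]
  have "inv\<^bsub>GL27\<^esub> (w highest_root) * X = coroot highest_root (- 1) * (w highest_root * X)"
    unfolding weyl_inv(2)[OF h] by (rule mult_assoc27[OF coroot_carrier weyl_carrier[OF h] X])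
  then show ?thesis
    using lr X s weyl_row_mirror[OF h h h mirror_of_link(1)[OF h l] X s] weyl_entry_simps(2)[OF h l]
    by (simp add: coroot_row wm_carrier[OF h])
qed

lemma coordinates_from_component:
  "\<exists>\<sigma>1 \<sigma>2 \<sigma>3 \<sigma>4. \<forall>c m. component (inv\<^bsub>GL27\<^esub> (w highest_root) * n_point x c) m \<longrightarrow>
       c $ 0 = m $$ (24, 24) \<and> c $ 1 = \<sigma>1 * (m $$ (20, 20) - m $$ (24, 24)) \<and>
       c $ 2 = \<sigma>2 * m $$ (24, 23) \<and> c $ 3 = \<sigma>3 * m $$ (25, 21) \<and> c $ 4 = \<sigma>4 * m $$ (26, 20)"
proof -
  have n: "n_point x c \<in> carrier_mat 27 27" for c
    unfolding n_point_nested by (simp add: carriers)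
  have low: "level 20 = - 1" "level 21 = - 1" "level 23 = - 1" "level 24 = - 1" "level 25 = - 1"
      "level 26 = - 1"
    by (simp_all add: pairing_sum_list minuscule_weights_def)
  have l: "link highest_root 20 0" "link highest_root 24 3" "link highest_root 25 5" "link highest_root 26 7"
    using corner_links by blast+
  note sq = entry_square[OF highest_root_roots l(1)] entry_square[OF highest_root_roots l(2)]
  \<comment> \<open>The signs with which the coordinates appear, the first factor coming from \<open>w(\<gamma>\<^sub>0)\<inverse>\<close>.\<close>
  define a where "a = entry highest_root 0 20 * (entry \<gamma>\<^sub>1 0 18 * entry \<gamma>\<^sub>5 18 20)"
  define a2 where "a2 = entry highest_root 3 24 * (entry \<gamma>\<^sub>2 3 22 * entry \<gamma>\<^sub>5 22 23)"
  define a3 where "a3 = entry highest_root 5 25 * (entry \<gamma>\<^sub>3 5 19 * entry \<gamma>\<^sub>5 19 21)"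
  define a4 where "a4 = entry highest_root 7 26 * (entry \<gamma>\<^sub>4 7 18 * entry \<gamma>\<^sub>5 18 20)"
  note es = entry_sign_roots[OF cell_roots(12) corner_links(1)]
    entry_sign_roots[OF cell_roots(1) corner_links(2)]
    entry_sign_roots[OF cell_roots(5) corner_links(3)]
    entry_sign_roots[OF cell_roots(12) corner_links(7)]
    entry_sign_roots[OF cell_roots(2) corner_links(8)]
    entry_sign_roots[OF cell_roots(5) corner_links(9)]
    entry_sign_roots[OF cell_roots(12) corner_links(11)]
    entry_sign_roots[OF cell_roots(3) corner_links(12)]
    entry_sign_roots[OF cell_roots(5) corner_links(13)]
    entry_sign_roots[OF cell_roots(12) corner_links(15)]
    entry_sign_roots[OF cell_roots(4) corner_links(16)]
    entry_sign_roots[OF cell_roots(5) corner_links(3)]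
  have sm: "p * q = 1 \<or> p * q = - 1" if "p = 1 \<or> p = - 1" "q = 1 \<or> q = - 1" for p q :: 'a
    using that by auto
  have a: "a = 1 \<or> a = - 1" unfolding a_def by (intro sm es(1,2,3))
  have a2: "a2 = 1 \<or> a2 = - 1" unfolding a2_def by (intro sm es(4,5,6))
  have a3: "a3 = 1 \<or> a3 = - 1" unfolding a3_def by (intro sm es(7,8,9))
  have a4: "a4 = 1 \<or> a4 = - 1" unfolding a4_def by (intro sm es(10,11,12))
  have inv: "s * (s * y) = y" if "s = 1 \<or> s = - 1" for s y :: 'a using that by auto
  show ?thesis
  proof (rule exI[of _ a], rule exI[of _ a2], rule exI[of _ a3], rule exI[of _ a4], intro allI impI)
    fix c m assume comp: "component (inv\<^bsub>GL27\<^esub> (w highest_root) * n_point x c) m"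
    have m: "m $$ (i, s) = entry highest_root j i * n_point x c $$ (j, s)"
      if "link highest_root i j" "level i = - 1" "level s = - 1" "s < 27" for i j s
      using component_low_block[OF comp link_bound(1)[OF that(1)] that(4,2,3)]
        inv_weyl_low_row[OF that(1) n that(4)] by simp
    have "m $$ (24, 24) = c $ 0"
      using m[OF l(2) low(4) low(4)] sq(2) by (simp add: n_point_entries mult.assoc[symmetric])
    moreover have "m $$ (20, 20) = c $ 0 + a * c $ 1"
      using m[OF l(1) low(1) low(1)] sq(1)
      by (simp add: n_point_entries mult.assoc[symmetric] distrib_left a_def)
    moreover have "m $$ (24, 23) = a2 * c $ 2" "m $$ (25, 21) = a3 * c $ 3" "m $$ (26, 20) = a4 * c $ 4"
      using m[OF l(2) low(4) low(3)] m[OF l(3) low(5) low(2)] m[OF l(4) low(6) low(1)]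
      by (simp_all add: n_point_entries mult.assoc a2_def a3_def a4_def)
    ultimately show "c $ 0 = m $$ (24, 24) \<and> c $ 1 = a * (m $$ (20, 20) - m $$ (24, 24)) \<and>
       c $ 2 = a2 * m $$ (24, 23) \<and> c $ 3 = a3 * m $$ (25, 21) \<and> c $ 4 = a4 * m $$ (26, 20)"
      using inv[OF a] inv[OF a2] inv[OF a3] inv[OF a4] by simp
  qed
qed

section \<open>The Levi component\<close>

text \<open>
  Parameters of the factors in the decomposition: \<open>par_b\<close> for \<open>-\<gamma>\<^sub>0\<close> and its torus element, \<open>par_e\<close>
  for the factors \<open>-\<delta>\<^sub>1, \<dots>, -\<delta>\<^sub>4\<close> (with \<open>\<delta>\<^sub>1 = \<gamma>\<^sub>5\<close>), \<open>par_u1\<close> and \<open>par_u2\<close> for the torus elements of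
  the two applications of \<open>sl2_swap\<close>, \<open>par_q\<close> for \<open>\<delta>\<^sub>2\<close>, \<open>par_s\<close> for the second factor \<open>-\<gamma>\<^sub>5\<close>,
  \<open>par_k\<close> for the negative and \<open>par_p\<close> for the positive roots of \<open>M\<close>. Their numerators and
  denominators are polynomials in the coordinates.
\<close>
definition par_b :: "'a vec \<Rightarrow> 'a" where "par_b c = 1 / c $ 0"
definition par_e1 :: "'a vec \<Rightarrow> 'a" where "par_e1 c = csign (neg_root highest_root) \<gamma>\<^sub>1 * par_b c * c $ 1"
definition par_e2 :: "'a vec \<Rightarrow> 'a" where "par_e2 c = csign (neg_root highest_root) \<gamma>\<^sub>2 * par_b c * c $ 2"
definition par_e3 :: "'a vec \<Rightarrow> 'a" where "par_e3 c = csign (neg_root highest_root) \<gamma>\<^sub>3 * par_b c * c $ 3"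
definition par_e4 :: "'a vec \<Rightarrow> 'a" where "par_e4 c = csign (neg_root highest_root) \<gamma>\<^sub>4 * par_b c * c $ 4"
definition par_u1 :: "'a vec \<Rightarrow> 'a" where "par_u1 c = 1 / (1 + par_e1 c)"
definition par_k2 :: "'a vec \<Rightarrow> 'a" where "par_k2 c = csign (neg_root \<delta>\<^sub>2) \<gamma>\<^sub>5 * par_e2 c * par_u1 c"
definition par_k3 :: "'a vec \<Rightarrow> 'a" where "par_k3 c = csign (neg_root \<delta>\<^sub>3) \<gamma>\<^sub>5 * par_e3 c * par_u1 c"
definition par_k4 :: "'a vec \<Rightarrow> 'a" where "par_k4 c = csign (neg_root \<delta>\<^sub>4) \<gamma>\<^sub>5 * par_e4 c * par_u1 c"
definition par_q :: "'a vec \<Rightarrow> 'a" where "par_q c = csign (neg_root \<beta>\<^sub>2) \<gamma>\<^sub>4 * par_k3 c * c $ 4"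
definition par_p1 :: "'a vec \<Rightarrow> 'a" where "par_p1 c = csign (neg_root \<delta>\<^sub>2) \<gamma>\<^sub>3 * par_e2 c * c $ 3"
definition par_p2 :: "'a vec \<Rightarrow> 'a" where "par_p2 c = csign (neg_root \<delta>\<^sub>2) \<gamma>\<^sub>4 * par_e2 c * c $ 4"
definition par_p3 :: "'a vec \<Rightarrow> 'a" where "par_p3 c = csign (neg_root \<delta>\<^sub>3) \<gamma>\<^sub>4 * par_e3 c * c $ 4"
definition par_u2 :: "'a vec \<Rightarrow> 'a" where "par_u2 c = 1 / (1 + par_e2 c * par_q c)"
definition par_s :: "'a vec \<Rightarrow> 'a" where "par_s c = csign (neg_root \<delta>\<^sub>2) \<beta>\<^sub>3 * par_e2 c * par_p3 c"
definition par_p4 :: "'a vec \<Rightarrow> 'a" where "par_p4 c = csign (neg_root \<gamma>\<^sub>5) \<delta>\<^sub>2 * par_s c * (par_q c * par_u2 c)"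

text \<open>
  The factors from \<open>M\<close> in the order in which they occur in \<open>inv_weyl_n_point\<close>.
\<close>
definition levi_component :: "'a vec \<Rightarrow> 'a mat" where
  "levi_component c = coroot highest_root (par_b c) * (x (neg_root \<beta>\<^sub>3) (par_k2 c) * (x \<beta>\<^sub>1 (par_p1 c) *
     (x \<beta>\<^sub>2 (par_p2 c) * (x \<beta>\<^sub>3 (par_p3 c) * (x \<beta>\<^sub>3 (par_p4 c) * (coroot \<delta>\<^sub>2 (par_u2 c) *
     (x (neg_root \<beta>\<^sub>2) (par_k3 c) * (x (neg_root \<beta>\<^sub>1) (par_k4 c) * (coroot \<gamma>\<^sub>5 (par_u1 c) * 1\<^sub>m 27)))))))))"

text \<open>
  The factors up to the last one for \<open>\<beta>\<^sub>3\<close> lie in \<open>N\<close> and \<open>M\<close>, the remaining ones in \<open>M\<close> and the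
  opposite of \<open>N\<close>.
\<close>
lemma inv_weyl_n_point:
  assumes nz: "c $ 0 \<noteq> 0" "1 + par_e1 c \<noteq> 0" "1 + par_e2 c * par_q c \<noteq> 0"
  shows "inv\<^bsub>GL27\<^esub> (w highest_root) * n_point x c =
    x highest_root (- par_b c) * (coroot highest_root (par_b c) * (x \<gamma>\<^sub>1 (c $ 1) *
        (x \<gamma>\<^sub>2 (c $ 2) * (x \<gamma>\<^sub>5 (par_u1 c) *
    (x (neg_root \<beta>\<^sub>3) (par_k2 c) * (x \<gamma>\<^sub>3 (c $ 3) * (x \<beta>\<^sub>1 (par_p1 c) * (x \<gamma>\<^sub>4 (c $ 4) * (x \<beta>\<^sub>2 (par_p2 c) *
    (x \<beta>\<^sub>3 (par_p3 c) * (x \<delta>\<^sub>2 (par_q c * par_u2 c) * (x \<beta>\<^sub>3 (par_p4 c) *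
    (x (neg_root \<gamma>\<^sub>5) (par_s c) * (coroot \<delta>\<^sub>2 (par_u2 c) * (x (neg_root \<delta>\<^sub>2) (par_e2 c * par_u2 c) *
    (x (neg_root \<delta>\<^sub>3) (par_e3 c) * (x (neg_root \<beta>\<^sub>2) (par_k3 c) * (x (neg_root \<beta>\<^sub>1) (par_k4 c) *
    (x (neg_root \<delta>\<^sub>4) (par_e4 c) * (coroot \<gamma>\<^sub>5 (par_u1 c) * (x (neg_root \<gamma>\<^sub>5) (par_e1 c * par_u1 c) *
    (x (neg_root \<gamma>\<^sub>1) (csign (neg_root highest_root) \<gamma>\<^sub>5 * par_b c * 1) *
        (x (neg_root highest_root) (par_b c) * 1\<^sub>m 27)))))))))))))))))))))))"
proof -
  note h = highest_root_roots
  let ?i = "inv\<^bsub>GL27\<^esub> (w highest_root)"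
  note C = one_carrier27 carriers
  have iw: "?i * (w highest_root * X) = X" if X: "X \<in> carrier_mat 27 27" for X
  proof -
    note i = GL_inv[OF weyl_GL[OF h]]
    have "?i * (w highest_root * X) = (?i * w highest_root) * X"
      using mult_assoc27[OF GL_carrier_mat[OF i(1)] weyl_carrier[OF h] X] by simp
    then show ?thesis unfolding i(3) using X by simp
  qed
  have b: "par_b c * c $ 0 = 1" using nz(1) by (simp add: par_b_def)
  have u1: "par_u1 c * (1 + par_e1 c * 1) = 1" using nz(2) by (simp add: par_u1_def)
  have u2: "par_u2 c * (1 + par_e2 c * par_q c) = 1" using nz(3) by (simp add: par_u2_def)
  have 1: "?i * (x highest_root (c $ 0) * X)
      = x highest_root (- par_b c) * (coroot highest_root (par_b c) *
          (x (neg_root highest_root) (par_b c) * X))"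
    if X: "X \<in> carrier_mat 27 27" for X
    unfolding weyl_x[OF h b X, symmetric] using X by (intro iw) (simp only: carriers)
  have t: "1 * par_u1 c = par_u1 c" by simp
  show ?thesis
    unfolding n_point_nested
    \<comment> \<open>Each move is followed by folding the parameters that it introduces.\<close>
    apply (subst 1, (simp only: C)?)
    apply (subst move_neg_highest_root, (simp only: C)?)
    unfolding par_e1_def[symmetric] par_e2_def[symmetric] par_e3_def[symmetric] par_e4_def[symmetric]
    apply (subst move_neg_gamma5[OF _ u1], (simp only: C)?)
    unfolding t
    apply (subst move_gamma5, (simp only: C)?)
    unfolding par_k2_def[symmetric] par_k3_def[symmetric] par_k4_def[symmetric]
    apply (subst move_neg_beta2, (simp only: C)?)
    unfolding par_q_def[symmetric]
    apply (subst move_neg_delta3, (simp only: C)?)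
    unfolding par_p1_def[symmetric] par_p3_def[symmetric]
    apply (subst move_neg_delta2[OF _ u2], (simp only: C)?)
    unfolding par_p2_def[symmetric] par_s_def[symmetric] par_p4_def[symmetric]
    by (rule refl)
qed

end

context chevalley
begin

lemma x_in_N: "\<beta> \<in> roots \<Longrightarrow> 0 < coeff_at \<beta> 2 \<Longrightarrow> x \<beta> t \<in> unip_N x"
  unfolding N_eq by (rule x_unip)

lemma x_in_opp_N: "\<beta> \<in> roots \<Longrightarrow> 0 < coeff_at \<beta> 2 \<Longrightarrow> x (neg_root \<beta>) t \<in> opp_N x"
  unfolding opp_N_eq using coeff_at_neg[OF roots_length, of \<beta> 2]
  by (intro x_unip neg_root_roots) simp_all

lemma x_neg_in_M: "\<beta> \<in> roots \<Longrightarrow> coeff_at \<beta> 2 = 0 \<Longrightarrow> x (neg_root \<beta>) t \<in> M"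
  using coeff_at_neg[OF roots_length, of \<beta> 2] by (intro x_M neg_root_roots) simp_all

lemma decomposition_heights:
  "0 < coeff_at highest_root 2" "0 < coeff_at \<gamma>\<^sub>1 2" "0 < coeff_at \<gamma>\<^sub>2 2" "0 < coeff_at \<gamma>\<^sub>3 2"
  "0 < coeff_at \<gamma>\<^sub>4 2" "0 < coeff_at \<gamma>\<^sub>5 2" "0 < coeff_at \<delta>\<^sub>2 2" "0 < coeff_at \<delta>\<^sub>3 2"
  "0 < coeff_at \<delta>\<^sub>4 2" "coeff_at \<beta>\<^sub>1 2 = 0" "coeff_at \<beta>\<^sub>2 2 = 0" "coeff_at \<beta>\<^sub>3 2 = 0"
  by (simp_all add: coeff_at_def)

text \<open>
  The factors are discarded one by one, alternating according to the group to which each belongs.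
\<close>
lemma component_levi_component:
  assumes nz: "c $ 0 \<noteq> 0" "1 + par_e1 c \<noteq> 0" "1 + par_e2 c * par_q c \<noteq> 0"
  shows "component (inv\<^bsub>GL27\<^esub> (w highest_root) * n_point x c) (levi_component c)"
proof -
  have u: "par_b c \<noteq> 0" "par_u1 c \<noteq> 0" "par_u2 c \<noteq> 0"
      using nz by (simp_all add: par_b_def par_u1_def par_u2_def)
  note h = decomposition_heights
  show ?thesis
    unfolding inv_weyl_n_point[OF nz] levi_component_def
    apply (rule component_N, rule component_M, rule component_N, rule component_N, rule component_N,
        rule component_M, rule component_N, rule component_M, rule component_N, rule component_M,
        rule component_M, rule component_N, rule component_M, rule opposite_parabolic_component,
        rule opposite_parabolic_opp_N, rule opposite_parabolic_M, rule opposite_parabolic_opp_N,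
        rule opposite_parabolic_opp_N, rule opposite_parabolic_M, rule opposite_parabolic_M,
        rule opposite_parabolic_opp_N, rule opposite_parabolic_M, rule opposite_parabolic_opp_N,
        rule opposite_parabolic_opp_N, rule opposite_parabolic_opp_N, rule opposite_parabolic_one)
    using u h cell_roots by (simp_all only: x_in_N x_in_opp_N x_M x_neg_in_M coroot_M not_False_eq_True)
qed

lemma levi_component_M:
  assumes "c $ 0 \<noteq> 0" "1 + par_e1 c \<noteq> 0" "1 + par_e2 c * par_q c \<noteq> 0"
  shows "levi_component c \<in> M"
  using component_levi_component[OF assms] by (simp add: is_M_component_def)

end

section \<open>Polynomial and rational functions\<close>

lemma polyfun_uminus: "f \<in> polyfun K \<Longrightarrow> (\<lambda>p. - f p) \<in> polyfun K"
  using polyfun.mult[OF polyfun.const[of "- 1"], of f K] by simp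

lemma polyfun_diff: "f \<in> polyfun K \<Longrightarrow> g \<in> polyfun K \<Longrightarrow> (\<lambda>p. f p - g p) \<in> polyfun K"
  using polyfun.add[of f K "\<lambda>p. - g p"] polyfun_uminus[of g K] by simp

lemma polyfun_power: "f \<in> polyfun K \<Longrightarrow> (\<lambda>p. f p ^ n) \<in> polyfun K"
  by (induction n) (auto intro: polyfun.add polyfun.mult polyfun.const)

lemma polyfun_sum:
  "finite I \<Longrightarrow> (\<And>i. i \<in> I \<Longrightarrow> f i \<in> polyfun K) \<Longrightarrow> (\<lambda>p. \<Sum>i\<in>I. f i p) \<in> polyfun K"
  by (induction rule: finite_induct) (auto intro: polyfun.add polyfun.mult polyfun.const)

lemma polyfun_coord: "i < n \<Longrightarrow> (\<lambda>c. c $ i) \<in> polyfun (vec_coords n)"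
  by (rule polyfun.coord) (auto simp: vec_coords_def)

lemma polyfun_entry: "i < n \<Longrightarrow> j < n \<Longrightarrow> (\<lambda>A. A $$ (i, j)) \<in> polyfun (mat_coords n)"
  by (rule polyfun.coord) (auto simp: mat_coords_def)

lemmas polyfun_intros = polyfun.const polyfun.add polyfun.mult polyfun_uminus polyfun_diff polyfun_power

lemma polyfun_compose:
  assumes "f \<in> polyfun K" and "\<And>y. y \<in> K \<Longrightarrow> (\<lambda>p. y (\<psi> p)) \<in> polyfun L"
  shows "(\<lambda>p. f (\<psi> p)) \<in> polyfun L"
  using assms(1) by induction (auto intro: polyfun.add polyfun.mult polyfun.const assms(2))

definition rational :: "('p \<Rightarrow> 'a::field) set \<Rightarrow> 'p set \<Rightarrow> ('p \<Rightarrow> 'a) \<Rightarrow> bool" where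
  "rational K S f \<longleftrightarrow> (\<exists>p\<in>polyfun K. \<exists>q\<in>polyfun K. \<forall>c\<in>S. q c \<noteq> 0 \<and> f c = p c / q c)"

lemma rationalI:
  "p \<in> polyfun K \<Longrightarrow> q \<in> polyfun K \<Longrightarrow> (\<And>c. c \<in> S \<Longrightarrow> q c \<noteq> 0 \<and> f c = p c / q c) \<Longrightarrow> rational K S f"
  unfolding rational_def by blast

lemma rational_cong:
  assumes "rational K S f" "\<And>c. c \<in> S \<Longrightarrow> f c = g c" shows "rational K S g"
proof -
  obtain p q where "p \<in> polyfun K" "q \<in> polyfun K" "\<forall>c\<in>S. q c \<noteq> 0 \<and> f c = p c / q c"
    using assms(1) unfolding rational_def by (elim bexE)
  then show ?thesis using assms(2) by (intro rationalI[of p K q]) auto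
qed

lemma rational_polyfun: "f \<in> polyfun K \<Longrightarrow> rational K S f"
  using polyfun.const[of 1 K] by (intro rationalI[of f K "\<lambda>_. 1"]) auto

lemma rational_add:
  assumes "rational K S f" "rational K S g" shows "rational K S (\<lambda>c. f c + g c)"
proof -
  obtain p q where f: "p \<in> polyfun K" "q \<in> polyfun K" "\<And>c. c \<in> S \<Longrightarrow> q c \<noteq> 0 \<and> f c = p c / q c"
    using assms(1) unfolding rational_def by blast
  obtain p' q' where g: "p' \<in> polyfun K" "q' \<in> polyfun K" "\<And>c. c \<in> S \<Longrightarrow> q' c \<noteq> 0 \<and> g c = p' c / q' c"
    using assms(2) unfolding rational_def by blast
  show ?thesis
    by (rule rationalI[of "\<lambda>c. p c * q' c + p' c * q c" K "\<lambda>c. q c * q' c"])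
       (use f g in \<open>auto intro!: polyfun.add polyfun.mult simp: add_frac_eq\<close>)
qed

lemma rational_mult:
  assumes "rational K S f" "rational K S g" shows "rational K S (\<lambda>c. f c * g c)"
proof -
  obtain p q where f: "p \<in> polyfun K" "q \<in> polyfun K" "\<And>c. c \<in> S \<Longrightarrow> q c \<noteq> 0 \<and> f c = p c / q c"
    using assms(1) unfolding rational_def by blast
  obtain p' q' where g: "p' \<in> polyfun K" "q' \<in> polyfun K" "\<And>c. c \<in> S \<Longrightarrow> q' c \<noteq> 0 \<and> g c = p' c / q' c"
    using assms(2) unfolding rational_def by blast
  show ?thesis
    by (rule rationalI[of "\<lambda>c. p c * p' c" K "\<lambda>c. q c * q' c"])
       (use f g in \<open>auto intro!: polyfun.add polyfun.mult\<close>)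
qed

lemma rational_inverse:
  assumes "rational K S f" "\<And>c. c \<in> S \<Longrightarrow> f c \<noteq> 0" shows "rational K S (\<lambda>c. 1 / f c)"
proof -
  obtain p q where f: "p \<in> polyfun K" "q \<in> polyfun K" "\<And>c. c \<in> S \<Longrightarrow> q c \<noteq> 0 \<and> f c = p c / q c"
    using assms(1) unfolding rational_def by blast
  show ?thesis
  proof (rule rationalI[OF f(2,1)])
    fix c assume "c \<in> S"
    then show "p c \<noteq> 0 \<and> 1 / f c = q c / p c" using f(3) assms(2) by fastforce
  qed
qed

lemma rational_const: "rational K S (\<lambda>_. a)"
  by (rule rational_polyfun[OF polyfun.const])

lemma rational_power: "rational K S f \<Longrightarrow> rational K S (\<lambda>c. f c ^ n)"
  by (induction n) (auto intro: rational_mult rational_const)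

lemma rational_powi:
  assumes "rational K S f" "\<And>c. c \<in> S \<Longrightarrow> f c \<noteq> 0" shows "rational K S (\<lambda>c. f c powi k)"
proof (cases "k \<ge> 0")
  case True
  then show ?thesis using rational_power[OF assms(1)] by (simp add: power_int_def)
next
  case False
  have "rational K S (\<lambda>c. 1 / f c ^ nat (- k))"
    by (rule rational_inverse[OF rational_power[OF assms(1)]]) (use assms(2) in simp)
  then show ?thesis using False by (simp add: power_int_def inverse_eq_divide power_divide)
qed

lemma rational_sum:
  "finite I \<Longrightarrow> (\<And>i. i \<in> I \<Longrightarrow> rational K S (f i)) \<Longrightarrow> rational K S (\<lambda>c. \<Sum>i\<in>I. f i c)"
  by (induction rule: finite_induct) (auto intro: rational_add rational_const)

definition rational_mat :: "('p \<Rightarrow> 'a::field) set \<Rightarrow> 'p set \<Rightarrow> ('p \<Rightarrow> 'a mat) \<Rightarrow> bool" where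
  "rational_mat K S A \<longleftrightarrow> (\<forall>c. A c \<in> carrier_mat 27 27) \<and>
     (\<forall>r<27. \<forall>s<27. rational K S (\<lambda>c. A c $$ (r, s)))"

lemma rational_mat_const: "B \<in> carrier_mat 27 27 \<Longrightarrow> rational_mat K S (\<lambda>_. B)"
  by (simp add: rational_mat_def rational_const)

lemma rational_mat_mult_const:
  assumes "B \<in> carrier_mat 27 27" "rational_mat K S A" shows "rational_mat K S (\<lambda>c. B * A c)"
  unfolding rational_mat_def
proof (intro conjI allI impI)
  have A: "A c \<in> carrier_mat 27 27" for c using assms(2) by (simp add: rational_mat_def)
  then show "B * A c \<in> carrier_mat 27 27" for c using assms(1) mult_carrier_mat by blast
  fix r s :: nat assume b: "r < 27" "s < 27"
  have "rational K S (\<lambda>c. \<Sum>p<27. B $$ (r, p) * A c $$ (p, s))"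
    using assms(2) b by (intro rational_sum rational_mult rational_const) (auto simp: rational_mat_def)
  then show "rational K S (\<lambda>c. (B * A c) $$ (r, s))" by (simp add: mult_entry[OF assms(1) A b])
qed

lemma rational_mat_coroot:
  assumes "rational K S f" "\<And>c. c \<in> S \<Longrightarrow> f c \<noteq> 0" "rational_mat K S A"
  shows "rational_mat K S (\<lambda>c. coroot \<beta> (f c) * A c)"
  unfolding rational_mat_def
proof (intro conjI allI impI)
  have A: "A c \<in> carrier_mat 27 27" for c using assms(3) by (simp add: rational_mat_def)
  then show "coroot \<beta> (f c) * A c \<in> carrier_mat 27 27" for c by (rule cm_carrier)
  fix r s :: nat assume b: "r < 27" "s < 27"
  show "rational K S (\<lambda>c. (coroot \<beta> (f c) * A c) $$ (r, s))"
    using assms(3) b by (simp add: coroot_row[OF A b]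
        rational_mat_def rational_mult rational_powi[OF assms(1,2)])
qed

context chevalley
begin

lemma rational_mat_x:
  assumes \<beta>: "\<beta> \<in> roots" and f: "rational K S f" and A: "rational_mat K S A"
  shows "rational_mat K S (\<lambda>c. x \<beta> (f c) * A c)"
  unfolding rational_mat_def
proof (intro conjI allI impI)
  have C: "A c \<in> carrier_mat 27 27" for c using A by (simp add: rational_mat_def)
  then show "x \<beta> (f c) * A c \<in> carrier_mat 27 27" for c by (rule xm_carrier[OF \<beta>])
  fix r s :: nat assume b: "r < 27" "s < 27"
  have R: "rational K S (\<lambda>c. A c $$ (p, s))" if "p < 27" for p using A b that by (simp add: rational_mat_def)
  show "rational K S (\<lambda>c. (x \<beta> (f c) * A c) $$ (r, s))"
  proof (cases "pairing \<beta> r = 1")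
    case True
    then obtain q where l: "link \<beta> q r" using link_to[OF \<beta> b(1)] by blast
    show ?thesis unfolding x_row_link[OF \<beta> \<beta> l C b(2)]
      by (intro rational_add rational_mult rational_const f R b(1) link_bound(1)[OF l])
  next
    case False
    show ?thesis unfolding x_row_other[OF \<beta> \<beta> False C b] by (rule R[OF b(1)])
  qed
qed

lemma rational_levi_component:
  assumes nz: "\<And>c. c \<in> S \<Longrightarrow> c $ 0 \<noteq> 0 \<and> 1 + par_e1 c \<noteq> 0 \<and> 1 + par_e2 c * par_q c \<noteq> 0"
  shows "rational_mat (vec_coords 5) S levi_component"
proof -
  let ?R = "rational (vec_coords 5) S"
  note co = rational_polyfun[OF polyfun_coord]
  note R = rational_add rational_mult rational_const
  have cc: "?R (\<lambda>c. c $ 0)" "?R (\<lambda>c. c $ 1)" "?R (\<lambda>c. c $ 2)" "?R (\<lambda>c. c $ 3)" "?R (\<lambda>c. c $ 4)"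
    by (rule co, simp)+
  have b: "?R par_b" unfolding par_b_def by (rule rational_inverse[OF cc(1)]) (use nz in blast)
  have e: "?R par_e1" "?R par_e2" "?R par_e3" "?R par_e4"
    unfolding par_e1_def par_e2_def par_e3_def par_e4_def by (intro R b cc)+
  have u1: "?R par_u1" unfolding par_u1_def
    by (rule rational_inverse[OF rational_add[OF rational_const e(1)]]) (use nz in blast)
  have k: "?R par_k2" "?R par_k3" "?R par_k4" unfolding par_k2_def par_k3_def par_k4_def by (intro R e u1)+
  have q: "?R par_q" unfolding par_q_def by (intro R k cc)
  have p: "?R par_p1" "?R par_p2" "?R par_p3" unfolding par_p1_def par_p2_def par_p3_def by (intro R e cc)+
  have u2: "?R par_u2" unfolding par_u2_def
    by (rule rational_inverse[OF rational_add[OF rational_const rational_mult[OF e(2) q]]]) (use nz in blast)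
  have s: "?R par_s" unfolding par_s_def by (intro R e p)
  have p4: "?R par_p4" unfolding par_p4_def by (intro R s q u2)
  have nz': "par_b c \<noteq> 0" "par_u1 c \<noteq> 0" "par_u2 c \<noteq> 0" if "c \<in> S" for c
    using nz[OF that] by (simp_all add: par_b_def par_u1_def par_u2_def)
  show ?thesis
    unfolding levi_component_def
    by (intro rational_mat_x rational_mat_coroot rational_mat_const cell_roots neg_cell_roots b k
        p p4 u1 u2 nz' one_carrier27)
qed

end

section \<open>The Zariski topology\<close>

lemma topspace_zariski: "topspace (zariski K S) = S"
proof -
  have "UNIV \<in> {{p. f p \<noteq> 0} | f. f \<in> polyfun K}"
    using polyfun.const[of 1 K] by (auto intro!: exI[of _ "\<lambda>_. 1"])
  then have "topspace (topology_generated_by {{p. f p \<noteq> 0} | f. f \<in> polyfun K}) = UNIV"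
    unfolding topology_generated_by_topspace by blast
  then show ?thesis by (simp add: zariski_def)
qed

lemma openin_zariski_nonzero:
  assumes "f \<in> polyfun K" shows "openin (zariski K S) {p \<in> S. f p \<noteq> 0}"
proof -
  have "openin (topology_generated_by {{p. f p \<noteq> 0} | f. f \<in> polyfun K}) {p. f p \<noteq> 0}"
    using assms by (intro topology_generated_by_Basis) blast
  then show ?thesis unfolding zariski_def openin_subtopology by blast
qed

text \<open>
  The nonvanishing sets of polynomial functions are a base, not only a subbase, as products of
  polynomial functions are again such.
\<close>
lemma openin_zariski_basic:
  assumes "openin (zariski K S) W" "p \<in> W"
  shows "\<exists>f\<in>polyfun K. f p \<noteq> 0 \<and> {q \<in> S. f q \<noteq> 0} \<subseteq> W"
proof -
  let ?B = "{{p. f p \<noteq> 0} | f. f \<in> polyfun K}"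
  obtain T where T: "openin (topology_generated_by ?B) T" "W = T \<inter> S"
    using assms(1) unfolding zariski_def openin_subtopology by blast
  have "generate_topology_on ?B T" using T(1) by (simp add: openin_topology_generated_by_iff)
  then have "\<forall>p\<in>T. \<exists>f\<in>polyfun K. f p \<noteq> 0 \<and> {q. f q \<noteq> 0} \<subseteq> T"
  proof induction
    case (Int a b)
    show ?case
    proof
      fix p assume "p \<in> a \<inter> b"
      then obtain f g where "f \<in> polyfun K" "f p \<noteq> 0" "{q. f q \<noteq> 0} \<subseteq> a"
        "g \<in> polyfun K" "g p \<noteq> 0" "{q. g q \<noteq> 0} \<subseteq> b" using Int.IH by blast
      then show "\<exists>f\<in>polyfun K. f p \<noteq> 0 \<and> {q. f q \<noteq> 0} \<subseteq> a \<inter> b"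
        by (intro bexI[of _ "\<lambda>q. f q * g q"]) (auto intro: polyfun.mult)
    qed
  next
    case (UN k)
    then show ?case by blast
  next
    case (Basis s)
    then show ?case by blast
  qed simp
  then obtain f where "f \<in> polyfun K" "f p \<noteq> 0" "{q. f q \<noteq> 0} \<subseteq> T" using assms(2) T(2) by blast
  then show ?thesis using T(2) by blast
qed

lemma rational_regular:
  assumes "rational K S f" shows "regular_fun K S f"
proof -
  obtain g h where gh: "g \<in> polyfun K" "h \<in> polyfun K" "\<forall>q\<in>S. h q \<noteq> 0 \<and> f q = g q / h q"
    using assms unfolding rational_def by (elim bexE)
  have S: "openin (zariski K S) S" using openin_topspace[of "zariski K S"] by (simp add: topspace_zariski)
  show ?thesis
    unfolding regular_fun_def
    by (intro ballI exI[of _ S] conjI S bexI[OF _ gh(1)] bexI[OF _ gh(2)] gh(3))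
qed

lemma polyfun_on_line:
  assumes "f \<in> polyfun (vec_coords n)"
  shows "\<exists>P. \<forall>t. f (vec n (\<lambda>i. a i + t * b i)) = poly P t"
  using assms
proof induction
  case (coord f)
  then obtain i where "i < n" "f = (\<lambda>c. c $ i)" by (auto simp: vec_coords_def)
  then show ?case by (intro exI[of _ "[:a i, b i:]"]) simp
next
  case (const k)
  show ?case by (intro exI[of _ "[:k:]"]) simp
next
  case (add f g)
  then obtain P Q where "\<forall>t. f (vec n (\<lambda>i. a i + t * b i)) = poly P t"
    "\<forall>t. g (vec n (\<lambda>i. a i + t * b i)) = poly Q t" by blast
  then show ?case by (intro exI[of _ "P + Q"]) simp
next
  case (mult f g)
  then obtain P Q where "\<forall>t. f (vec n (\<lambda>i. a i + t * b i)) = poly P t"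
    "\<forall>t. g (vec n (\<lambda>i. a i + t * b i)) = poly Q t" by blast
  then show ?case by (intro exI[of _ "P * Q"]) simp
qed

text \<open>
  Affine space over an infinite field is irreducible: restrict both functions to the line through
  \<open>p\<close> and \<open>q\<close>, where they become nonzero polynomials in one variable.
\<close>
lemma polyfuns_common_nonzero:
  fixes f g :: "'a::field_char_0 vec \<Rightarrow> 'a"
  assumes f: "f \<in> polyfun (vec_coords n)" and g: "g \<in> polyfun (vec_coords n)"
    and p: "p \<in> carrier_vec n" "f p \<noteq> 0" and q: "q \<in> carrier_vec n" "g q \<noteq> 0"
  shows "\<exists>c\<in>carrier_vec n. f c \<noteq> 0 \<and> g c \<noteq> 0"
proof -
  let ?L = "\<lambda>t. vec n (\<lambda>i. p $ i + t * (q $ i - p $ i))"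
  obtain P Q where P: "\<forall>t. f (?L t) = poly P t" and Q: "\<forall>t. g (?L t) = poly Q t"
    using polyfun_on_line[OF f] polyfun_on_line[OF g] by meson
  have "?L 0 = p" "?L 1 = q" using p(1) q(1) by (auto intro!: eq_vecI)
  then have "poly P 0 \<noteq> 0" "poly Q 1 \<noteq> 0" using P Q p(2) q(2) by metis+
  then have "P * Q \<noteq> 0" by auto
  then have "finite {t. poly (P * Q) t = 0}" by (rule poly_roots_finite)
  then obtain t where "poly (P * Q) t \<noteq> 0"
    using infinite_UNIV_char_0 by (metis (mono_tags, lifting) UNIV_eq_I mem_Collect_eq)
  then have "f (?L t) \<noteq> 0" "g (?L t) \<noteq> 0" using P Q by auto
  then show ?thesis by (intro bexI[of _ "?L t"]) auto
qed

lemma zariski_dense: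
  fixes f g :: "'a::field_char_0 vec \<Rightarrow> 'a"
  assumes f: "f \<in> polyfun (vec_coords n)" and g: "g \<in> polyfun (vec_coords n)"
    and S: "S = {c \<in> carrier_vec n. f c \<noteq> 0}" and q: "q \<in> carrier_vec n" "g q \<noteq> 0"
  shows "zariski (vec_coords n) S closure_of {c \<in> S. g c \<noteq> 0} = S"
proof
  show "zariski (vec_coords n) S closure_of {c \<in> S. g c \<noteq> 0} \<subseteq> S"
    using closure_of_subset_topspace[of "zariski (vec_coords n) S"] by (simp add: topspace_zariski)
  show "S \<subseteq> zariski (vec_coords n) S closure_of {c \<in> S. g c \<noteq> 0}"
  proof
    fix p assume p: "p \<in> S"
    show "p \<in> zariski (vec_coords n) S closure_of {c \<in> S. g c \<noteq> 0}"
      unfolding in_closure_of topspace_zariski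
    proof (intro conjI allI impI p)
      fix W assume W: "p \<in> W \<and> openin (zariski (vec_coords n) S) W"
      from openin_zariski_basic[OF conjunct2[OF W] conjunct1[OF W]]
      obtain h where h: "h \<in> polyfun (vec_coords n)" "h p \<noteq> 0" "{q \<in> S. h q \<noteq> 0} \<subseteq> W"
        by (elim bexE conjE)
      have fh: "p \<in> carrier_vec n" "f p * h p \<noteq> 0" using p S h(2) by auto
      from polyfuns_common_nonzero[OF polyfun.mult[OF f h(1)] g fh q]
      obtain c where "c \<in> carrier_vec n" "f c * h c \<noteq> 0" "g c \<noteq> 0"
        by (elim bexE conjE)
      then show "\<exists>y. y \<in> {c \<in> S. g c \<noteq> 0} \<and> y \<in> W" using S h(3) by auto
    qed
  qed
qed

text \<open>
  The image is the intersection of the open set where \<open>\<psi> A\<close> lies in \<open>S\<close> with the Zariski closure of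
  the image in \<open>Y\<close>. Indeed, write an entry of \<open>\<phi>\<close> as \<open>p / q\<close>; then \<open>q(\<psi> A)\<close> times that entry of \<open>A\<close>
  minus \<open>p(\<psi> A)\<close> vanishes on the image, hence on its closure, and this says \<open>A = \<phi> (\<psi> A)\<close>.
\<close>
lemma iso_onto_image_by_retraction:
  assumes f: "f \<in> polyfun (vec_coords n)"
    and S: "S = {c \<in> carrier_vec n. f c \<noteq> 0}"
    and Y: "Y \<subseteq> carrier_mat k k" "\<phi> ` S \<subseteq> Y"
    and \<phi>: "\<And>r s. r < k \<Longrightarrow> s < k \<Longrightarrow> rational (vec_coords n) S (\<lambda>c. \<phi> c $$ (r, s))"
    and \<psi>: "\<And>i. i < n \<Longrightarrow> (\<lambda>A. \<psi> A $ i) \<in> polyfun (mat_coords k)" "\<And>A. \<psi> A \<in> carrier_vec n"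
    and inv: "\<And>c. c \<in> S \<Longrightarrow> \<psi> (\<phi> c) = c"
  shows "iso_onto_image (vec_coords n) (mat_coords k) S Y \<phi>"
proof -
  let ?K = "vec_coords n" and ?L = "mat_coords k"
  have pull: "(\<lambda>A. h (\<psi> A)) \<in> polyfun ?L" if "h \<in> polyfun ?K" for h
    by (rule polyfun_compose[OF that]) (auto simp: vec_coords_def \<psi>(1))
  have "locally_closed_in (zariski ?L Y) (\<phi> ` S)"
  proof -
    define V where "V = {A \<in> Y. f (\<psi> A) \<noteq> 0}"
    define H where "H = {h \<in> polyfun ?L. \<forall>c\<in>S. h (\<phi> c) = 0}"
    define C where "C = {A \<in> Y. \<forall>h\<in>H. h A = 0}"
    have V: "openin (zariski ?L Y) V" unfolding V_def by (rule openin_zariski_nonzero[OF pull[OF f]])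
    have "Y - C = (\<Union>h\<in>H. {A \<in> Y. h A \<noteq> 0})" unfolding C_def by blast
    moreover have "openin (zariski ?L Y) (\<Union>h\<in>H. {A \<in> Y. h A \<noteq> 0})"
      unfolding H_def by (intro openin_Union) (auto intro: openin_zariski_nonzero)
    ultimately have C: "closedin (zariski ?L Y) C"
      unfolding closedin_def topspace_zariski by (auto simp: C_def)
    have "\<phi> ` S = V \<inter> C"
    proof
      show "\<phi> ` S \<subseteq> V \<inter> C"
      proof
        fix A assume "A \<in> \<phi> ` S"
        then obtain c where c: "c \<in> S" "A = \<phi> c" by blast
        then have "f (\<psi> A) \<noteq> 0" using inv S by auto
        then show "A \<in> V \<inter> C" using c Y(2) by (auto simp: V_def C_def H_def)
      qed
      show "V \<inter> C \<subseteq> \<phi> ` S"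
      proof
        fix A assume A: "A \<in> V \<inter> C"
        then have c: "\<psi> A \<in> S" using \<psi>(2) S by (auto simp: V_def)
        have "A = \<phi> (\<psi> A)"
        proof (rule eq_matI)
          have "A \<in> carrier_mat k k" "\<phi> (\<psi> A) \<in> carrier_mat k k" using A c Y by (auto simp: V_def)
          then show d: "dim_row A = dim_row (\<phi> (\<psi> A))" "dim_col A = dim_col (\<phi> (\<psi> A))" by auto
          fix r s assume "r < dim_row (\<phi> (\<psi> A))" "s < dim_col (\<phi> (\<psi> A))"
          then have b: "r < k" "s < k" using \<open>\<phi> (\<psi> A) \<in> carrier_mat k k\<close> by auto
          obtain p q where pq: "p \<in> polyfun ?K" "q \<in> polyfun ?K"
            "\<forall>c\<in>S. q c \<noteq> 0 \<and> \<phi> c $$ (r, s) = p c / q c"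
            using \<phi>[OF b] unfolding rational_def by (elim bexE)
          have "(\<lambda>A. q (\<psi> A) * A $$ (r, s) - p (\<psi> A)) \<in> H"
            unfolding H_def using pq inv
            by (auto intro!: polyfun_diff polyfun.mult pull polyfun_entry b)
          then have "q (\<psi> A) * A $$ (r, s) - p (\<psi> A) = 0" using A by (auto simp: C_def)
          moreover have "q (\<psi> A) \<noteq> 0" "\<phi> (\<psi> A) $$ (r, s) = p (\<psi> A) / q (\<psi> A)" using pq(3) c by auto
          ultimately show "A $$ (r, s) = \<phi> (\<psi> A) $$ (r, s)"
            by (metis eq_iff_diff_eq_0 nonzero_mult_div_cancel_left)
        qed
        then show "A \<in> \<phi> ` S" using c by blast
      qed
    qed
    then show ?thesis unfolding locally_closed_in_def using V C by blast
  qed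
  moreover have "regular_map ?K ?L S (\<phi> ` S) \<phi>"
    unfolding regular_map_def mat_coords_def using \<phi> by (auto intro: rational_regular)
  moreover have "regular_map ?L ?K (\<phi> ` S) S \<psi>"
    unfolding regular_map_def vec_coords_def[of n]
    using \<psi>(1) inv by (auto intro: rational_regular rational_polyfun)
  ultimately show ?thesis
    unfolding iso_onto_image_def regular_iso_def using Y(2) inv by auto
qed

text \<open>
  The product of all the conditions, so that the set of representatives is a principal open set.
\<close>
definition R'_equation :: "'a::field vec \<Rightarrow> 'a" where
  "R'_equation c = c $ 0 * c $ 1 * c $ 2 * c $ 3 * c $ 4 * (c $ 0 - c $ 1) *
     (c $ 0 * (c $ 0 - c $ 1) - c $ 2 * c $ 3 * c $ 4) *
     (2 * (c $ 0)^2 * (c $ 3 * c $ 4 + c $ 2) - 2 * c $ 2 * (c $ 3)^2 * (c $ 4)^2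
       + c $ 0 * c $ 1 * (c $ 4 - c $ 2))"

lemma R'_principal: "R' = {c \<in> carrier_vec 5. R'_equation c \<noteq> 0}"
proof -
  have "(\<forall>i<5. c $ i \<noteq> 0) \<longleftrightarrow> c $ 0 \<noteq> 0 \<and> c $ 1 \<noteq> 0 \<and> c $ 2 \<noteq> 0 \<and> c $ 3 \<noteq> 0 \<and> c $ 4 \<noteq> 0"
    for c :: "'a vec"
    by (auto simp: less_Suc_eq numeral_eq_Suc)
  then show ?thesis unfolding R'_def R'_equation_def mult_eq_0_iff by auto
qed

lemma R'_equation_polyfun: "R'_equation \<in> polyfun (vec_coords 5)"
  unfolding R'_equation_def[abs_def] by (intro polyfun_intros polyfun_coord) simp_all

context chevalley
begin

text \<open>
  The numerator of \<open>1 + par_e1\<close>.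
\<close>
definition shifted_coordinate :: "'a vec \<Rightarrow> 'a" where
  "shifted_coordinate c = c $ 0 + csign (neg_root highest_root) \<gamma>\<^sub>1 * c $ 1"

text \<open>
  The product of the numerators of \<open>1 + par_e1\<close> and \<open>1 + par_e2 par_q\<close>, the two quantities that
  \<open>sl2_swap\<close> needs to be invertible.
\<close>
definition cell_equation :: "'a vec \<Rightarrow> 'a" where
  "cell_equation c = shifted_coordinate c * (c $ 0 * shifted_coordinate c
     + (csign (neg_root highest_root) \<gamma>\<^sub>2 * (csign (neg_root \<beta>\<^sub>2) \<gamma>\<^sub>4
         * (csign (neg_root \<delta>\<^sub>3) \<gamma>\<^sub>5 * csign (neg_root highest_root) \<gamma>\<^sub>3)))
       * (c $ 2 * c $ 3 * c $ 4))"

lemma cell_equation_polyfun: "cell_equation \<in> polyfun (vec_coords 5)"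
  unfolding cell_equation_def[abs_def] shifted_coordinate_def
  by (intro polyfun_intros polyfun_coord) simp_all

lemma cell_equation_nonzero:
  assumes c0: "c $ 0 \<noteq> 0" and nz: "cell_equation c \<noteq> 0"
  shows "1 + par_e1 c \<noteq> 0" "1 + par_e2 c * par_q c \<noteq> 0"
proof -
  let ?d = "shifted_coordinate c"
  have d: "?d \<noteq> 0" using nz by (auto simp: cell_equation_def)
  have e1: "1 + par_e1 c = ?d / c $ 0"
    using c0 by (simp add: par_e1_def par_b_def shifted_coordinate_def field_simps)
  then show "1 + par_e1 c \<noteq> 0" using c0 d by simp
  have "par_u1 c = c $ 0 / ?d" unfolding par_u1_def e1 by simp
  then have "par_e2 c * par_q c = (csign (neg_root highest_root) \<gamma>\<^sub>2 * (csign (neg_root \<beta>\<^sub>2) \<gamma>\<^sub>4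
         * (csign (neg_root \<delta>\<^sub>3) \<gamma>\<^sub>5 * csign (neg_root highest_root) \<gamma>\<^sub>3)))
       * (c $ 2 * c $ 3 * c $ 4) / (c $ 0 * ?d)"
    using c0 d by (simp add: par_e2_def par_q_def par_k3_def par_e3_def par_b_def)
  moreover have "?d * (c $ 0 * ?d * (1 + z / (c $ 0 * ?d))) = ?d * (c $ 0 * ?d + z)" for z
    using c0 d by (simp add: distrib_left)
  ultimately have "?d * (c $ 0 * ?d * (1 + par_e2 c * par_q c)) = cell_equation c"
    by (simp only: cell_equation_def)
  then show "1 + par_e2 c * par_q c \<noteq> 0" using nz by auto
qed

end

theorem corollary3p16:
  fixes x :: "int list \<Rightarrow> 'a::field_char_0 \<Rightarrow> 'a mat"
    and u v :: "nat list"
  assumes "padic_field TYPE('a)"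
    and "chevalley_system x"
    and "longest_word {1..6} u"
    and "longest_word {1, 3, 4, 5, 6} v"
  shows "\<exists>U. openin (zariski (vec_coords 5) R') U
           \<and> (zariski (vec_coords 5) R') closure_of U = R'
           \<and> (\<forall>c\<in>U. \<exists>!m. is_M_component x (inv\<^bsub>GL27\<^esub> (w0_rep x u v) * n_point x c) m)
           \<and> iso_onto_image (vec_coords 5) (mat_coords 27) U (levi_M x)
                (\<lambda>c. N_map x u v (n_point x c))"
proof -
  interpret chevalley x by (rule chevalley.intro[OF assms(2)])
  let ?K = "vec_coords 5 :: ('a vec \<Rightarrow> 'a) set"
  let ?g = "\<lambda>c. inv\<^bsub>GL27\<^esub> (w0_rep x u v) * n_point x c"
  note h = highest_root_roots
  obtain m0 where m0: "m0 \<in> M" "inv\<^bsub>GL27\<^esub> (w0_rep x u v) = m0 * inv\<^bsub>GL27\<^esub> (w highest_root)"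
    using w0_rep_inv[OF assms(3,4)] by (elim bexE)
  note m0GL = M_GL[OF m0(1)]
  note m0C = GL_carrier_mat[OF m0GL] and im0C = GL_carrier_mat[OF GL_inv(1)[OF m0GL]]
  define U where "U = {c \<in> R'. cell_equation c \<noteq> 0}"
  have U: "U = {c \<in> carrier_vec 5. R'_equation c * cell_equation c \<noteq> 0}"
    unfolding U_def R'_principal by auto
  have nz: "c $ 0 \<noteq> 0 \<and> 1 + par_e1 c \<noteq> 0 \<and> 1 + par_e2 c * par_q c \<noteq> 0" if "c \<in> U" for c
  proof -
    have "c $ 0 \<noteq> 0" using that by (simp add: U_def R'_def)
    then show ?thesis using cell_equation_nonzero[of c] that by (simp add: U_def)
  qed
  have nC: "n_point x c \<in> carrier_mat 27 27" for c
    unfolding n_point_nested by (simp only: carriers one_carrier27)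
  have comp: "component (inv\<^bsub>GL27\<^esub> (w highest_root) * n_point x c) (levi_component c)" if "c \<in> U" for c
    using nz[OF that] component_levi_component by blast
  have g: "?g c = m0 * (inv\<^bsub>GL27\<^esub> (w highest_root) * n_point x c)" for c
    unfolding m0(2)
    by (rule mult_assoc27[OF m0C GL_carrier_mat[OF GL_inv(1)[OF weyl_GL[OF h]]] nC])
  have comp0: "component (?g c) (m0 * levi_component c)" if "c \<in> U" for c
    unfolding g by (rule component_M[OF comp[OF that] m0(1)])
  have ex1: "\<exists>!m. component (?g c) m" if "c \<in> U" for c
    using comp0[OF that] component_unique by blast
  have N: "N_map x u v (n_point x c) = m0 * levi_component c" if "c \<in> U" for c
    unfolding N_map_def by (rule the1_equality[OF ex1[OF that] comp0[OF that]])
  have NM: "N_map x u v (n_point x c) \<in> M" if "c \<in> U" for c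
    unfolding N[OF that] using comp[OF that] m0(1) M_closed(1) by (simp add: is_M_component_def)
  obtain \<sigma>1 \<sigma>2 \<sigma>3 \<sigma>4 where \<sigma>:
    "\<forall>c m. component (inv\<^bsub>GL27\<^esub> (w highest_root) * n_point x c) m \<longrightarrow>
       c $ 0 = m $$ (24, 24) \<and> c $ 1 = \<sigma>1 * (m $$ (20, 20) - m $$ (24, 24)) \<and>
       c $ 2 = \<sigma>2 * m $$ (24, 23) \<and> c $ 3 = \<sigma>3 * m $$ (25, 21) \<and> c $ 4 = \<sigma>4 * m $$ (26, 20)"
    using coordinates_from_component by (elim exE)
  \<comment> \<open>The \<open>(r, s)\<close> entry of \<open>m\<^sub>0\<inverse> A\<close>, as a linear form in the entries of \<open>A\<close>.\<close>
  define L where "L r s A = (\<Sum>p<27. (inv\<^bsub>GL27\<^esub> m0) $$ (r, p) * A $$ (p, s))" for r s and A :: "'a mat"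
  define \<psi> where "\<psi> A = vec 5 (\<lambda>i. [L 24 24 A, \<sigma>1 * (L 20 20 A - L 24 24 A), \<sigma>2 * L 24 23 A,
      \<sigma>3 * L 25 21 A, \<sigma>4 * L 26 20 A] ! i)" for A
  have L: "L r s \<in> polyfun (mat_coords 27)" if "s < 27" for r s
    unfolding L_def[abs_def] using that
    by (intro polyfun_sum polyfun.mult polyfun.const polyfun_entry) auto
  have \<psi>_poly: "(\<lambda>A. \<psi> A $ i) \<in> polyfun (mat_coords 27)" if "i < 5" for i
  proof -
    have "i = 0 \<or> i = 1 \<or> i = 2 \<or> i = 3 \<or> i = 4" using that by auto
    then show ?thesis unfolding \<psi>_def
      by (elim disjE) (simp_all add: L polyfun.mult polyfun.const polyfun_diff)
  qed
  have \<psi>_carrier: "\<psi> A \<in> carrier_vec 5" for A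
    by (simp add: \<psi>_def)
  have inv: "\<psi> (N_map x u v (n_point x c)) = c" if c: "c \<in> U" for c
  proof -
    have lC: "levi_component c \<in> carrier_mat 27 27"
      using nz[OF c] by (intro GL_carrier_mat M_GL levi_component_M) blast+
    have "inv\<^bsub>GL27\<^esub> m0 * (m0 * levi_component c) = levi_component c"
      using mult_assoc27[OF im0C m0C lC] unfolding GL_inv(3)[OF m0GL] left_mult_one_mat[OF lC] by (rule sym)
    then have "L r s (m0 * levi_component c) = levi_component c $$ (r, s)" if "r < 27" "s < 27" for r s
      using mult_entry[OF im0C mult_carrier27[OF m0C lC] that] by (simp add: L_def)
    note L = this
    show ?thesis
    proof (rule eq_vecI)
      have "dim_vec c = 5" using c by (auto simp: U)
      then show "dim_vec (\<psi> (N_map x u v (n_point x c))) = dim_vec c" by (simp add: \<psi>_def)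
      fix i assume "i < dim_vec c"
      then have "i = 0 \<or> i = 1 \<or> i = 2 \<or> i = 3 \<or> i = 4" using \<open>dim_vec c = 5\<close> by auto
      then show "\<psi> (N_map x u v (n_point x c)) $ i = c $ i"
        using \<sigma>[rule_format, OF comp[OF c]] unfolding N[OF c]
        by (elim disjE) (simp_all add: \<psi>_def L)
    qed
  qed
  have rat: "rational ?K U (\<lambda>c. N_map x u v (n_point x c) $$ (r, s))" if "r < 27" "s < 27" for r s
  proof (rule rational_cong)
    have "rational_mat ?K U (\<lambda>c. m0 * levi_component c)"
      by (rule rational_mat_mult_const[OF m0C rational_levi_component[OF nz]])
    then show "rational ?K U (\<lambda>c. (m0 * levi_component c) $$ (r, s))" using that by (simp add: rational_mat_def)
  qed (simp add: N)
  have iso: "iso_onto_image ?K (mat_coords 27) U M (\<lambda>c. N_map x u v (n_point x c))"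
  proof (rule iso_onto_image_by_retraction[OF _ U _ _ rat \<psi>_poly \<psi>_carrier inv])
    show "(\<lambda>c. R'_equation c * cell_equation c) \<in> polyfun ?K"
      by (rule polyfun.mult[OF R'_equation_polyfun cell_equation_polyfun])
    show "M \<subseteq> carrier_mat 27 27" using M_GL GL_carrier_mat by blast
    show "(\<lambda>c. N_map x u v (n_point x c)) ` U \<subseteq> M" using NM by blast
  qed
  have opn: "openin (zariski ?K R') U"
    unfolding U_def by (rule openin_zariski_nonzero[OF cell_equation_polyfun])
  have dense: "zariski ?K R' closure_of U = R'"
    unfolding U_def
  proof (rule zariski_dense[OF R'_equation_polyfun cell_equation_polyfun R'_principal])
    \<comment> \<open>At the first unit vector the function takes the value 1, whatever the signs are.\<close>
    show "vec 5 (\<lambda>i. if i = 0 then 1 else 0) \<in> carrier_vec 5" by simp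
    show "cell_equation (vec 5 (\<lambda>i. if i = 0 then 1 else 0)) \<noteq> 0"
      by (simp add: cell_equation_def shifted_coordinate_def)
  qed
  show ?thesis by (intro exI[of _ U] conjI ballI opn dense ex1 iso)
qed

end
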